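(* Let $\Delta$ be the simplex category. Define the kernel $P:\Delta\times\Delta\times\Delta^{\mathrm{op}}\to\mathbf{Set}$ by the coend $$P([p],[q];[r]) := \int^{[m]\in\Delta} \Delta([m],[p])\times\Delta([m],[q])\times\Delta([r],[m]),$$ with action on morphisms given by composition in the respective factors, and define the unit $J:\Delta^{\mathrm{op}}\to\mathbf{Set}$ by $J([r]) := \Delta([r],[0])$. Then the data $(P,J)$ equips $\Delta$ with a symmetric promonoidal structure; that is, there exist an associator $\alpha$, unitors $\lambda,\rho$ and a symmetry $\sigma$ for $(P,J)$, all natural isomorphisms, satisfying the coherence axioms of a symmetric promonoidal category.
   Context: The simplex category $\Delta$ has objects the finite ordinals $[n]=\{0<1<\cdots<n\}$ for $n\in\mathbb{N}$ (including $n=0$) and morphisms the nondecreasing maps. $\Delta([a],[b])$ denotes the set of morphisms $[a]\to[b]$. A promonoidal structure on a small category $C$ consists of a kernel functor $P:C\times C\times C^{\mathrm{op}}\to\mathbf{Set}$, written $P(x,y;u)$ (covariant in $x,y$, contravariant in $u$), a unit functor $J:C^{\mathrm{op}}\to\mathbf{Set}$, and natural isomorphisms $$\alpha:\ \int^{x\in C} P(a,b;x)\times P(x,c;d)\ \cong\ \int^{y\in C} P(b,c;y)\times P(a,y;d),$$ $$\lambda:\ \int^{x\in C} J(x)\times P(x,b;d)\ \cong\ C(d,b),\qquad \rho:\ \int^{y\in C} J(y)\times P(a,y;d)\ \cong\ C(d,a),$$ satisfying Mac Lane's coherence axioms (the pentagon and the triangle), i.e. $(C,P,J,\alpha,\lambda,\rho)$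 is a pseudomonoid in the monoidal bicategory of profunctors. It is symmetric if it is equipped with natural isomorphisms $\sigma: P(a,b;d)\cong P(b,a;d)$ that are involutive ($\sigma\circ\sigma=\mathrm{id}$) and coherent with $\alpha$ (the hexagon axiom). *)

theory Defs
  imports Main "HOL-Library.FuncSet"
begin

section \<open>Small categories and set-valued functors\<close>

text \<open>
  Hom-sets of different pairs of objects need not be disjoint, so composition and the morphism
  part of a functor take the objects involved as arguments:
  \<open>Comp C x y z g f\<close> is the composite of \<open>f : x \<rightarrow> y\<close> and \<open>g : y \<rightarrow> z\<close>.
\<close>

record ('o, 'm) cat =
  Obj :: "'o set"
  Hom :: "'o \<Rightarrow> 'o \<Rightarrow> 'm set"
  Ident :: "'o \<Rightarrow> 'm"
  Comp :: "'o \<Rightarrow> 'o \<Rightarrow> 'o \<Rightarrow> 'm \<Rightarrow> 'm \<Rightarrow> 'm"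

locale small_category =
  fixes C :: "('o, 'm) cat"
  assumes Ident_in: "x \<in> Obj C \<Longrightarrow> Ident C x \<in> Hom C x x"
    and Comp_in: "\<lbrakk>x \<in> Obj C; y \<in> Obj C; z \<in> Obj C; f \<in> Hom C x y; g \<in> Hom C y z\<rbrakk>
      \<Longrightarrow> Comp C x y z g f \<in> Hom C x z"
    and Comp_Ident_left: "\<lbrakk>x \<in> Obj C; y \<in> Obj C; f \<in> Hom C x y\<rbrakk>
      \<Longrightarrow> Comp C x y y (Ident C y) f = f"
    and Comp_Ident_right: "\<lbrakk>x \<in> Obj C; y \<in> Obj C; f \<in> Hom C x y\<rbrakk>
      \<Longrightarrow> Comp C x x y f (Ident C x) = f"
    and Comp_assoc: "\<lbrakk>w \<in> Obj C; x \<in> Obj C; y \<in> Obj C; z \<in> Obj C;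
        f \<in> Hom C w x; g \<in> Hom C x y; h \<in> Hom C y z\<rbrakk>
      \<Longrightarrow> Comp C w y z h (Comp C w x y g f) = Comp C w x z (Comp C x y z h g) f"

definition op_cat :: "('o, 'm) cat \<Rightarrow> ('o, 'm) cat" where
  "op_cat C = \<lparr>Obj = Obj C, Hom = (\<lambda>x y. Hom C y x), Ident = Ident C,
     Comp = (\<lambda>x y z g f. Comp C z y x f g)\<rparr>"

definition prod_cat :: "('o, 'm) cat \<Rightarrow> ('p, 'n) cat \<Rightarrow> ('o \<times> 'p, 'm \<times> 'n) cat"
    (infixr \<open>\<times>\<^sub>C\<close> 80) where
  "C \<times>\<^sub>C D = \<lparr>Obj = Obj C \<times> Obj D,
     Hom = (\<lambda>(x, x') (y, y'). Hom C x y \<times> Hom D x' y'),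
     Ident = (\<lambda>(x, x'). (Ident C x, Ident D x')),
     Comp = (\<lambda>(x, x') (y, y') (z, z') (g, g') (f, f'). (Comp C x y z g f, Comp D x' y' z' g' f'))\<rparr>"

record ('o, 'm, 'e) setfun =
  Ob :: "'o \<Rightarrow> 'e set"
  Ar :: "'o \<Rightarrow> 'o \<Rightarrow> 'm \<Rightarrow> 'e \<Rightarrow> 'e"

locale set_functor = small_category C for C :: "('o, 'm) cat" +
  fixes F :: "('o, 'm, 'e) setfun"
  assumes Ar_in: "\<lbrakk>x \<in> Obj C; y \<in> Obj C; f \<in> Hom C x y; e \<in> Ob F x\<rbrakk>
      \<Longrightarrow> Ar F x y f e \<in> Ob F y"
    and Ar_Ident: "\<lbrakk>x \<in> Obj C; e \<in> Ob F x\<rbrakk> \<Longrightarrow> Ar F x x (Ident C x) e = e"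
    and Ar_Comp: "\<lbrakk>x \<in> Obj C; y \<in> Obj C; z \<in> Obj C; f \<in> Hom C x y; g \<in> Hom C y z; e \<in> Ob F x\<rbrakk>
      \<Longrightarrow> Ar F x z (Comp C x y z g f) e = Ar F y z g (Ar F x y f e)"

definition natural_iso ::
    "('o, 'm) cat \<Rightarrow> ('o, 'm, 'e) setfun \<Rightarrow> ('o, 'm, 'd) setfun \<Rightarrow> ('o \<Rightarrow> 'e \<Rightarrow> 'd) \<Rightarrow> bool" where
  "natural_iso C F G \<eta> \<longleftrightarrow>
     (\<forall>x\<in>Obj C. bij_betw (\<eta> x) (Ob F x) (Ob G x)) \<and>
     (\<forall>x\<in>Obj C. \<forall>y\<in>Obj C. \<forall>f\<in>Hom C x y. \<forall>e\<in>Ob F x. \<eta> y (Ar F x y f e) = Ar G x y f (\<eta> x e))"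

text \<open>
  \<open>precomp F u v\<close> is the composite of \<open>F\<close> with the functor whose object part is \<open>u\<close> and whose
  morphism part is \<open>v\<close>; \<open>F \<otimes> G\<close> is the external product \<open>(x, y) \<mapsto> F x \<times> G y\<close>.
\<close>

definition precomp ::
    "('o, 'm, 'e) setfun \<Rightarrow> ('p \<Rightarrow> 'o) \<Rightarrow> ('n \<Rightarrow> 'm) \<Rightarrow> ('p, 'n, 'e) setfun" where
  "precomp F u v = \<lparr>Ob = (\<lambda>x. Ob F (u x)), Ar = (\<lambda>x y f. Ar F (u x) (u y) (v f))\<rparr>"

definition ext_prod ::
    "('o, 'm, 'e) setfun \<Rightarrow> ('p, 'n, 'd) setfun \<Rightarrow> ('o \<times> 'p, 'm \<times> 'n, 'e \<times> 'd) setfun"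
    (infixr \<open>\<otimes>\<close> 75) where
  "F \<otimes> G = \<lparr>Ob = (\<lambda>(x, y). Ob F x \<times> Ob G y),
     Ar = (\<lambda>(x, y) (x', y') (f, g). map_prod (Ar F x x' f) (Ar G y y' g))\<rparr>"

text \<open>The hom-functor on \<open>op_cat C \<times>\<^sub>C C\<close>; its action is \<open>h \<mapsto> g \<circ> h \<circ> f\<close>.\<close>

definition hom_functor :: "('o, 'm) cat \<Rightarrow> ('o \<times> 'o, 'm \<times> 'm, 'm) setfun" where
  "hom_functor C = \<lparr>Ob = (\<lambda>(x, y). Hom C x y),
     Ar = (\<lambda>(x, y) (x', y') (f, g) h. Comp C x' x y' (Comp C x y y' g h) f)\<rparr>"


section \<open>Coends\<close>

text \<open>
  The coend of a functor \<open>F\<close> on \<open>op_cat C \<times>\<^sub>C C\<close> is the quotient of the disjoint union of the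
  sets \<open>F (x, x)\<close> by the equivalence relation generated by
  \<open>F (f, 1) z \<sim> F (1, f) z\<close> for \<open>f : x \<rightarrow> y\<close> and \<open>z \<in> F (y, x)\<close>.
\<close>

definition coend_carrier ::
    "('o, 'm) cat \<Rightarrow> ('o \<times> 'o, 'm \<times> 'm, 'e) setfun \<Rightarrow> ('o \<times> 'e) set" where
  "coend_carrier C F = (SIGMA x:Obj C. Ob F (x, x))"

definition coend_step ::
    "('o, 'm) cat \<Rightarrow> ('o \<times> 'o, 'm \<times> 'm, 'e) setfun \<Rightarrow> (('o \<times> 'e) \<times> ('o \<times> 'e)) set" where
  "coend_step C F =
     {((x, Ar F (y, x) (x, x) (f, Ident C x) z), (y, Ar F (y, x) (y, y) (Ident C y, f) z)) | x y f z.
        x \<in> Obj C \<and> y \<in> Obj C \<and> f \<in> Hom C x y \<and> z \<in> Ob F (y, x)}"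

definition coend_rel ::
    "('o, 'm) cat \<Rightarrow> ('o \<times> 'o, 'm \<times> 'm, 'e) setfun \<Rightarrow> (('o \<times> 'e) \<times> ('o \<times> 'e)) set" where
  "coend_rel C F =
     (coend_step C F \<union> (coend_step C F)\<inverse>)\<^sup>* \<inter> coend_carrier C F \<times> coend_carrier C F"

definition coend ::
    "('o, 'm) cat \<Rightarrow> ('o \<times> 'o, 'm \<times> 'm, 'e) setfun \<Rightarrow> ('o \<times> 'e) set set" where
  "coend C F = coend_carrier C F // coend_rel C F"

definition coend_class ::
    "('o, 'm) cat \<Rightarrow> ('o \<times> 'o, 'm \<times> 'm, 'e) setfun \<Rightarrow> 'o \<Rightarrow> 'e \<Rightarrow> ('o \<times> 'e) set" where
  "coend_class C F x e = coend_rel C F `` {(x, e)}"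

text \<open>
  \<open>coend_desc h\<close> is the map out of a coend given on representatives by \<open>h\<close>; it is meaningful
  when \<open>h\<close> is constant on equivalence classes.
\<close>

definition coend_desc :: "('o \<Rightarrow> 'e \<Rightarrow> 'd) \<Rightarrow> ('o \<times> 'e) set \<Rightarrow> 'd" where
  "coend_desc h X = the_elem ((\<lambda>(x, e). h x e) ` X)"

text \<open>The map into the coend of \<open>G\<close> induced by a family \<open>\<phi> x\<close> with values in \<open>G (x, x)\<close>.\<close>

definition coend_map ::
    "('o, 'm) cat \<Rightarrow> ('o \<times> 'o, 'm \<times> 'm, 'd) setfun \<Rightarrow> ('o \<Rightarrow> 'e \<Rightarrow> 'd)
      \<Rightarrow> ('o \<times> 'e) set \<Rightarrow> ('o \<times> 'd) set" where
  "coend_map C G \<phi> = coend_desc (\<lambda>x e. coend_class C G x (\<phi> x e))"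

text \<open>
  Coends with parameters: for \<open>G\<close> on \<open>D \<times>\<^sub>C (op_cat C \<times>\<^sub>C C)\<close>, \<open>at_param D G d\<close> is \<open>G (d, -, -)\<close>
  and \<open>coend_functor D C G\<close> is the functor on \<open>D\<close> sending \<open>d\<close> to the coend of \<open>G (d, -, -)\<close>.
\<close>

definition at_param ::
    "('p, 'n) cat \<Rightarrow> ('p \<times> ('o \<times> 'o), 'n \<times> ('m \<times> 'm), 'e) setfun \<Rightarrow> 'p
      \<Rightarrow> ('o \<times> 'o, 'm \<times> 'm, 'e) setfun" where
  "at_param D G d = precomp G (\<lambda>xy. (d, xy)) (\<lambda>uv. (Ident D d, uv))"

definition coend_functor ::
    "('p, 'n) cat \<Rightarrow> ('o, 'm) cat \<Rightarrow> ('p \<times> ('o \<times> 'o), 'n \<times> ('m \<times> 'm), 'e) setfun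
      \<Rightarrow> ('p, 'n, ('o \<times> 'e) set) setfun" where
  "coend_functor D C G =
     \<lparr>Ob = (\<lambda>d. coend C (at_param D G d)),
      Ar = (\<lambda>d d' f. coend_map C (at_param D G d')
                (\<lambda>x. Ar G (d, (x, x)) (d', (x, x)) (f, (Ident C x, Ident C x))))\<rparr>"

text \<open>
  The Fubini isomorphisms between iterated coends. The arguments \<open>out\<close> and \<open>inn\<close> form classes in
  the outer and inner coend of the target, the latter depending on the outer variable.
\<close>

definition fubini_right ::
    "('o \<Rightarrow> 'u \<times> 's \<Rightarrow> 'r) \<Rightarrow> ('o \<Rightarrow> 'o \<Rightarrow> 'v \<times> 'w \<Rightarrow> 's)
      \<Rightarrow> ('o \<times> (('o \<times> ('u \<times> 'v)) set \<times> 'w)) set \<Rightarrow> 'r" where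
  "fubini_right out inn =
     coend_desc (\<lambda>y (t, w). coend_desc (\<lambda>x (u, v). out x (u, inn x y (v, w))) t)"

definition fubini_left ::
    "('o \<Rightarrow> 's \<times> 'w \<Rightarrow> 'r) \<Rightarrow> ('o \<Rightarrow> 'o \<Rightarrow> 'u \<times> 'v \<Rightarrow> 's)
      \<Rightarrow> ('o \<times> ('u \<times> ('o \<times> ('v \<times> 'w)) set)) set \<Rightarrow> 'r" where
  "fubini_left out inn =
     coend_desc (\<lambda>x (u, t). coend_desc (\<lambda>y (v, w). out y (inn y x (u, v), w)) t)"

definition fubini_swap ::
    "('o \<Rightarrow> 'v \<times> 's \<Rightarrow> 'r) \<Rightarrow> ('o \<Rightarrow> 'o \<Rightarrow> 'u \<times> 'w \<Rightarrow> 's)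
      \<Rightarrow> ('o \<times> ('u \<times> ('o \<times> ('v \<times> 'w)) set)) set \<Rightarrow> 'r" where
  "fubini_swap out inn =
     coend_desc (\<lambda>x (u, t). coend_desc (\<lambda>y (v, w). out y (v, inn y x (u, w))) t)"


section \<open>Promonoidal categories\<close>

text \<open>A kernel \<open>P\<close> is a functor on \<open>kernel_cat C\<close>; \<open>P (a, b, d)\<close> is contravariant in \<open>d\<close>.\<close>

definition kernel_cat :: "('o, 'm) cat \<Rightarrow> ('o \<times> 'o \<times> 'o, 'm \<times> 'm \<times> 'm) cat" where
  "kernel_cat C = C \<times>\<^sub>C C \<times>\<^sub>C op_cat C"

definition assoc_cat :: "('o, 'm) cat \<Rightarrow> ('o \<times> 'o \<times> 'o \<times> 'o, 'm \<times> 'm \<times> 'm \<times> 'm) cat" where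
  "assoc_cat C = C \<times>\<^sub>C C \<times>\<^sub>C C \<times>\<^sub>C op_cat C"

definition unit_cat :: "('o, 'm) cat \<Rightarrow> ('o \<times> 'o, 'm \<times> 'm) cat" where
  "unit_cat C = C \<times>\<^sub>C op_cat C"

text \<open>
  \<open>left_comp\<close> is \<open>(a, b, c, d) \<mapsto> \<integral>x. P (a, b, x) \<times> P (x, c, d)\<close>,
  \<open>right_comp\<close> is \<open>(a, b, c, d) \<mapsto> \<integral>y. P (b, c, y) \<times> P (a, y, d)\<close>,
  \<open>left_unit\<close> is \<open>(b, d) \<mapsto> \<integral>x. J x \<times> P (x, b, d)\<close> and
  \<open>right_unit\<close> is \<open>(a, d) \<mapsto> \<integral>y. J y \<times> P (a, y, d)\<close>.
  In each integrand the first (contravariant) and second (covariant) occurrence of the bound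
  variable are named \<open>x\<close> and \<open>x'\<close>.
\<close>

definition left_integrand where
  "left_integrand P = precomp (P \<otimes> P)
     (\<lambda>((a, b, c, d), (x, x')). ((a, b, x), (x', c, d)))
     (\<lambda>((a, b, c, d), (x, x')). ((a, b, x), (x', c, d)))"

definition right_integrand where
  "right_integrand P = precomp (P \<otimes> P)
     (\<lambda>((a, b, c, d), (x, x')). ((b, c, x), (a, x', d)))
     (\<lambda>((a, b, c, d), (x, x')). ((b, c, x), (a, x', d)))"

definition left_unit_integrand where
  "left_unit_integrand P J = precomp (J \<otimes> P)
     (\<lambda>((b, d), (x, x')). (x, (x', b, d))) (\<lambda>((b, d), (x, x')). (x, (x', b, d)))"

definition right_unit_integrand where
  "right_unit_integrand P J = precomp (J \<otimes> P)
     (\<lambda>((a, d), (x, x')). (x, (a, x', d))) (\<lambda>((a, d), (x, x')). (x, (a, x', d)))"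

definition left_comp where
  "left_comp C P = coend_functor (assoc_cat C) C (left_integrand P)"

definition right_comp where
  "right_comp C P = coend_functor (assoc_cat C) C (right_integrand P)"

definition left_unit where
  "left_unit C P J = coend_functor (unit_cat C) C (left_unit_integrand P J)"

definition right_unit where
  "right_unit C P J = coend_functor (unit_cat C) C (right_unit_integrand P J)"

definition left_comp_class where
  "left_comp_class C P abcd = coend_class C (at_param (assoc_cat C) (left_integrand P) abcd)"

definition right_comp_class where
  "right_comp_class C P abcd = coend_class C (at_param (assoc_cat C) (right_integrand P) abcd)"

definition left_unit_class where
  "left_unit_class C P J bd = coend_class C (at_param (unit_cat C) (left_unit_integrand P J) bd)"

definition right_unit_class where
  "right_unit_class C P J ad = coend_class C (at_param (unit_cat C) (right_unit_integrand P J) ad)"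

text \<open>\<open>(b, d) \<mapsto> C(d, b)\<close>, covariant in \<open>b\<close> and contravariant in \<open>d\<close>.\<close>

definition hom_profunctor :: "('o, 'm) cat \<Rightarrow> ('o \<times> 'o, 'm \<times> 'm, 'm) setfun" where
  "hom_profunctor C = precomp (hom_functor C) (\<lambda>(b, d). (d, b)) (\<lambda>(f, g). (g, f))"

text \<open>The functors obtained by fixing all but one of the variables.\<close>

definition snd_of_2 where
  "snd_of_2 C U a = precomp U (\<lambda>x. (a, x)) (\<lambda>f. (Ident C a, f))"
definition fst_of_3 where
  "fst_of_3 C P b d = precomp P (\<lambda>x. (x, b, d)) (\<lambda>f. (f, Ident C b, Ident C d))"
definition snd_of_3 where
  "snd_of_3 C P a d = precomp P (\<lambda>x. (a, x, d)) (\<lambda>f. (Ident C a, f, Ident C d))"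
definition thd_of_3 where
  "thd_of_3 C P a b = precomp P (\<lambda>x. (a, b, x)) (\<lambda>f. (Ident C a, Ident C b, f))"
definition fst_of_4 where
  "fst_of_4 C T b c d = precomp T (\<lambda>x. (x, b, c, d)) (\<lambda>f. (f, Ident C b, Ident C c, Ident C d))"
definition snd_of_4 where
  "snd_of_4 C T a c d = precomp T (\<lambda>x. (a, x, c, d)) (\<lambda>f. (Ident C a, f, Ident C c, Ident C d))"
definition thd_of_4 where
  "thd_of_4 C T a b d = precomp T (\<lambda>x. (a, b, x, d)) (\<lambda>f. (Ident C a, Ident C b, f, Ident C d))"
definition fth_of_4 where
  "fth_of_4 C T a b c = precomp T (\<lambda>x. (a, b, c, x)) (\<lambda>f. (Ident C a, Ident C b, Ident C c, f))"

text \<open>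
  The two composites of the pentagon, from
  \<open>\<integral>y. (\<integral>x. P (a, b, x) \<times> P (x, c, y)) \<times> P (y, d, e)\<close> to
  \<open>\<integral>z. (\<integral>w. P (c, d, w) \<times> P (b, w, z)) \<times> P (a, z, e)\<close>.
\<close>

definition pentagon_source where
  "pentagon_source C P a b c d e =
     coend C (fth_of_4 C (left_comp C P) a b c \<otimes> fst_of_3 C P d e)"

definition pentagon_three where
  "pentagon_three C P \<alpha> a b c d e =
     coend_map C (fth_of_4 C (right_comp C P) b c d \<otimes> snd_of_3 C P a e)
       (\<lambda>z (t, p). (\<alpha> (b, c, d, z) t, p)) \<circ>
     fubini_left
       (coend_class C (fth_of_4 C (left_comp C P) b c d \<otimes> snd_of_3 C P a e))
       (\<lambda>z. left_comp_class C P (b, c, d, z)) \<circ>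
     coend_map C (thd_of_3 C P b c \<otimes> snd_of_4 C (right_comp C P) a d e)
       (\<lambda>x (p, t). (p, \<alpha> (a, x, d, e) t)) \<circ>
     fubini_right
       (coend_class C (thd_of_3 C P b c \<otimes> snd_of_4 C (left_comp C P) a d e))
       (\<lambda>x. left_comp_class C P (a, x, d, e)) \<circ>
     coend_map C (fth_of_4 C (right_comp C P) a b c \<otimes> fst_of_3 C P d e)
       (\<lambda>y (t, p). (\<alpha> (a, b, c, y) t, p))"

definition pentagon_two where
  "pentagon_two C P \<alpha> a b c d e =
     fubini_left
       (coend_class C (fth_of_4 C (right_comp C P) b c d \<otimes> snd_of_3 C P a e))
       (\<lambda>z. right_comp_class C P (b, c, d, z)) \<circ>
     coend_map C (thd_of_3 C P c d \<otimes> thd_of_4 C (right_comp C P) a b e)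
       (\<lambda>w (p, t). (p, \<alpha> (a, b, w, e) t)) \<circ>
     fubini_swap
       (coend_class C (thd_of_3 C P c d \<otimes> thd_of_4 C (left_comp C P) a b e))
       (\<lambda>w. left_comp_class C P (a, b, w, e)) \<circ>
     coend_map C (thd_of_3 C P a b \<otimes> fst_of_4 C (right_comp C P) c d e)
       (\<lambda>x (p, t). (p, \<alpha> (x, c, d, e) t)) \<circ>
     fubini_right
       (coend_class C (thd_of_3 C P a b \<otimes> fst_of_4 C (left_comp C P) c d e))
       (\<lambda>x. left_comp_class C P (x, c, d, e))"

text \<open>
  The two composites of the triangle, from \<open>\<integral>y. J y \<times> (\<integral>x. P (a, y, x) \<times> P (x, b, d))\<close> to
  \<open>P (a, b, d)\<close>. The last map of each is the Yoneda isomorphism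
  \<open>\<integral>x. C(x, a) \<times> P (x, b, d) \<cong> P (a, b, d)\<close>, respectively
  \<open>\<integral>x. C(x, b) \<times> P (a, x, d) \<cong> P (a, b, d)\<close>.
\<close>

definition triangle_source where
  "triangle_source C P J a b d = coend C (J \<otimes> snd_of_4 C (left_comp C P) a b d)"

definition triangle_right where
  "triangle_right C P J \<rho> a b d =
     coend_desc (\<lambda>x (f, p). Ar P (x, b, d) (a, b, d) (f, Ident C b, Ident C d) p) \<circ>
     coend_map C (snd_of_2 C (hom_profunctor C) a \<otimes> fst_of_3 C P b d)
       (\<lambda>x (t, p). (\<rho> (a, x) t, p)) \<circ>
     fubini_left
       (coend_class C (snd_of_2 C (right_unit C P J) a \<otimes> fst_of_3 C P b d))
       (\<lambda>x. right_unit_class C P J (a, x))"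

definition triangle_left where
  "triangle_left C P J \<alpha> l a b d =
     coend_desc (\<lambda>x (f, p). Ar P (a, x, d) (a, b, d) (Ident C a, f, Ident C d) p) \<circ>
     coend_map C (snd_of_2 C (hom_profunctor C) b \<otimes> snd_of_3 C P a d)
       (\<lambda>x (t, p). (l (b, x) t, p)) \<circ>
     fubini_left
       (coend_class C (snd_of_2 C (left_unit C P J) b \<otimes> snd_of_3 C P a d))
       (\<lambda>x. left_unit_class C P J (b, x)) \<circ>
     coend_map C (J \<otimes> snd_of_4 C (right_comp C P) a b d)
       (\<lambda>y (j, t). (j, \<alpha> (a, y, b, d) t))"

locale promonoidal_category =
    small_category C + P: set_functor "kernel_cat C" P + J: set_functor "op_cat C" J
  for C :: "('o, 'm) cat"
    and P :: "('o \<times> 'o \<times> 'o, 'm \<times> 'm \<times> 'm, 'p) setfun"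
    and J :: "('o, 'm, 'j) setfun" +
  fixes \<alpha> :: "'o \<times> 'o \<times> 'o \<times> 'o \<Rightarrow> ('o \<times> 'p \<times> 'p) set \<Rightarrow> ('o \<times> 'p \<times> 'p) set"
    and l :: "'o \<times> 'o \<Rightarrow> ('o \<times> 'j \<times> 'p) set \<Rightarrow> 'm"
    and \<rho> :: "'o \<times> 'o \<Rightarrow> ('o \<times> 'j \<times> 'p) set \<Rightarrow> 'm"
  assumes associator: "natural_iso (assoc_cat C) (left_comp C P) (right_comp C P) \<alpha>"
    and left_unitor: "natural_iso (unit_cat C) (left_unit C P J) (hom_profunctor C) l"
    and right_unitor: "natural_iso (unit_cat C) (right_unit C P J) (hom_profunctor C) \<rho>"
    and pentagon: "\<lbrakk>a \<in> Obj C; b \<in> Obj C; c \<in> Obj C; d \<in> Obj C; e \<in> Obj C;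
        X \<in> pentagon_source C P a b c d e\<rbrakk>
      \<Longrightarrow> pentagon_three C P \<alpha> a b c d e X = pentagon_two C P \<alpha> a b c d e X"
    and triangle: "\<lbrakk>a \<in> Obj C; b \<in> Obj C; d \<in> Obj C; Y \<in> triangle_source C P J a b d\<rbrakk>
      \<Longrightarrow> triangle_left C P J \<alpha> l a b d Y = triangle_right C P J \<rho> a b d Y"

text \<open>
  The hexagon compares the two maps from \<open>\<integral>x. P (a, b, x) \<times> P (x, c, d)\<close> to
  \<open>\<integral>y. P (c, a, y) \<times> P (b, y, d)\<close> that correspond to \<open>(a \<otimes> b) \<otimes> c \<rightarrow> b \<otimes> (c \<otimes> a)\<close> in a
  symmetric monoidal category.
\<close>

locale symmetric_promonoidal_category = promonoidal_category C P J \<alpha> l \<rho>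
  for C :: "('o, 'm) cat"
    and P :: "('o \<times> 'o \<times> 'o, 'm \<times> 'm \<times> 'm, 'p) setfun"
    and J :: "('o, 'm, 'j) setfun"
    and \<alpha> l \<rho> +
  fixes \<sigma> :: "'o \<times> 'o \<times> 'o \<Rightarrow> 'p \<Rightarrow> 'p"
  assumes symmetry: "natural_iso (kernel_cat C) P
        (precomp P (\<lambda>(a, b, d). (b, a, d)) (\<lambda>(f, g, h). (g, f, h))) \<sigma>"
    and involutive: "\<lbrakk>a \<in> Obj C; b \<in> Obj C; d \<in> Obj C; p \<in> Ob P (a, b, d)\<rbrakk>
      \<Longrightarrow> \<sigma> (b, a, d) (\<sigma> (a, b, d) p) = p"
    and hexagon: "\<lbrakk>a \<in> Obj C; b \<in> Obj C; c \<in> Obj C; d \<in> Obj C; X \<in> Ob (left_comp C P) (a, b, c, d)\<rbrakk>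
      \<Longrightarrow>
        \<alpha> (b, c, a, d)
          (coend_map C (at_param (assoc_cat C) (left_integrand P) (b, c, a, d))
             (\<lambda>y (q, p). (q, \<sigma> (a, y, d) p))
             (\<alpha> (a, b, c, d) X))
        = coend_map C (at_param (assoc_cat C) (right_integrand P) (b, c, a, d))
            (\<lambda>y (q, p). (\<sigma> (a, c, y) q, p))
            (\<alpha> (b, a, c, d)
              (coend_map C (at_param (assoc_cat C) (left_integrand P) (b, a, c, d))
                (\<lambda>x (p, q). (\<sigma> (a, b, x) p, q)) X))"


section \<open>The simplex category\<close>

text \<open>The object \<open>n\<close> stands for the ordinal \<open>{..n}\<close>; monotone maps are extensional functions.\<close>

definition simplex_cat :: "(nat, nat \<Rightarrow> nat) cat" where
  "simplex_cat = \<lparr>Obj = UNIV,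
     Hom = (\<lambda>m n. {f \<in> {..m} \<rightarrow>\<^sub>E {..n}. mono_on {..m} f}),
     Ident = (\<lambda>n. \<lambda>i\<in>{..n}. i),
     Comp = (\<lambda>k m n g f. compose {..k} g f)\<rparr>"

text \<open>\<open>(p, q, r) \<mapsto> \<integral>m. \<Delta>(m, p) \<times> \<Delta>(m, q) \<times> \<Delta>(r, m)\<close>\<close>

definition simplex_kernel where
  "simplex_kernel = coend_functor (kernel_cat simplex_cat) simplex_cat
     (precomp (hom_functor simplex_cat \<otimes> hom_functor simplex_cat \<otimes> hom_functor simplex_cat)
        (\<lambda>((p, q, r), (m, m')). ((m, p), (m, q), (r, m')))
        (\<lambda>((p, q, r), (m, m')). ((m, p), (m, q), (r, m'))))"

definition simplex_unit :: "(nat, nat \<Rightarrow> nat, nat \<Rightarrow> nat) setfun" where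
  "simplex_unit = precomp (hom_functor simplex_cat) (\<lambda>r. (r, 0)) (\<lambda>f. (f, Ident simplex_cat 0))"

end

theory Submission
  imports Defs
begin

text \<open>
  By the co-Yoneda lemma \<open>P (a, b; d) \<cong> C(d, a) \<times> C(d, b)\<close>, so every iterated coend that occurs in
  the axioms is in bijection with a set of tuples of morphisms \<open>d \<rightarrow> a\<^sub>1, \<dots>, d \<rightarrow> a\<^sub>n\<close>, its normal
  forms. In these coordinates the Fubini isomorphisms, the associators, the unitors and the Yoneda
  isomorphisms all become the identity and the symmetry becomes a permutation of the entries, so
  that the coherence diagrams commute because normal forms separate points. The argument needs
  nothing about \<open>\<Delta>\<close> except that \<open>[0]\<close> is terminal, which makes \<open>J\<close> a family of singletons.
\<close>

section \<open>Coends classified by a normal form\<close>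

text \<open>Once P (a, b; d) is C(d, a) x C(d, b), Day convolution of presheaves along P is the
  pointwise product, so the coherence at stake is that of a cartesian product, whose unit is the
  terminal presheaf; that is the part played by terminality of [0]. The obstacle is concrete: a
  coend is a quotient by a generated equivalence relation and a map out of it is given by
  \<open>the_elem\<close> of an image, so every map in a diagram needs its own proof of being well
  defined. A normal form settles this: it is invariant under the generating steps, and each
  representative is one step away from a canonical one that the normal form determines. A single
  pattern covers all iterated coends: an integrand A(x) x B(x), where A(x) consists of tuples of
  morphisms out of x and B(x) of tuples out of a fixed e with one entry h : e -> x. Moving h over to
  the first factor replaces x by e and substitutes the first tuple into an entry of the second
  (\<open>plug\<close>). Composites of kernels are again of this kind, so the pattern iterates, and
  what remains to be computed is associativity and interchange of substitutions.\<close>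

lemma equiv_coend_rel: "equiv (coend_carrier C F) (coend_rel C F)"
proof (rule equivI)
  show "coend_rel C F \<subseteq> coend_carrier C F \<times> coend_carrier C F"
    by (auto simp: coend_rel_def)
  show "refl_on (coend_carrier C F) (coend_rel C F)"
    by (auto simp: coend_rel_def refl_on_def)
  have "sym ((coend_step C F \<union> (coend_step C F)\<inverse>)\<^sup>*)"
    by (intro sym_rtrancl) (auto simp: sym_def)
  then show "sym (coend_rel C F)"
    by (auto simp: coend_rel_def sym_def)
  \<comment> \<open>Only the end points of a chain of steps are confined to the carrier, so chains
    still concatenate.\<close>
  show "trans (coend_rel C F)"
    by (auto simp: coend_rel_def trans_def)
qed

lemma coend_class_in: "(x, e) \<in> coend_carrier C F \<Longrightarrow> coend_class C F x e \<in> coend C F"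
  unfolding coend_class_def coend_def by (rule quotientI)

lemma coendE:
  assumes "X \<in> coend C F"
  obtains x e where "x \<in> Obj C" "e \<in> Ob F (x, x)" "X = coend_class C F x e"
  using assms unfolding coend_def coend_class_def coend_carrier_def by (auto elim!: quotientE)

text \<open>A complete invariant of the coend. It is phrased on representatives instead of as a
  bijection from the quotient, so that it can be checked on generating steps and applied to explicit
  elements.\<close>

definition coend_nf ::
    "('o, 'm) cat \<Rightarrow> ('o \<times> 'o, 'm \<times> 'm, 'e) setfun \<Rightarrow> ('o \<Rightarrow> 'e \<Rightarrow> 't) \<Rightarrow> 't set \<Rightarrow> bool" where
  "coend_nf C F nf T \<longleftrightarrow>
     (\<forall>p\<in>coend_carrier C F. \<forall>q\<in>coend_carrier C F.
        (p, q) \<in> coend_rel C F \<longleftrightarrow> case_prod nf p = case_prod nf q) \<and>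
     case_prod nf ` coend_carrier C F = T"

text \<open>For one half of completeness, invariance under a single generating step suffices, by
  induction along chains; the other half is the assumption \<open>connected\<close>, which instances
  prove by linking both elements to one canonical representative.\<close>

lemma coend_nfI:
  assumes step: "\<And>x y f z. \<lbrakk>x \<in> Obj C; y \<in> Obj C; f \<in> Hom C x y; z \<in> Ob F (y, x)\<rbrakk> \<Longrightarrow>
      nf x (Ar F (y, x) (x, x) (f, Ident C x) z) = nf y (Ar F (y, x) (y, y) (Ident C y, f) z)"
    and connected: "\<And>x y e e'. \<lbrakk>x \<in> Obj C; y \<in> Obj C; e \<in> Ob F (x, x); e' \<in> Ob F (y, y);
      nf x e = nf y e'\<rbrakk> \<Longrightarrow> ((x, e), (y, e')) \<in> coend_rel C F"
    and mem: "\<And>x e. \<lbrakk>x \<in> Obj C; e \<in> Ob F (x, x)\<rbrakk> \<Longrightarrow> nf x e \<in> T"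
    and surj: "\<And>t. t \<in> T \<Longrightarrow> \<exists>x\<in>Obj C. \<exists>e\<in>Ob F (x, x). nf x e = t"
  shows "coend_nf C F nf T"
proof -
  \<comment> \<open>Stated for the bare closure, since the intermediate points of a chain are not
    known to lie in the carrier. Inverse steps are harmless because equality is symmetric.\<close>
  have *: "case_prod nf p = case_prod nf q"
    if "(p, q) \<in> (coend_step C F \<union> (coend_step C F)\<inverse>)\<^sup>*" for p q
    using that
  proof (induction rule: rtrancl_induct)
    case (step q r)
    then show ?case
      by (auto simp: coend_step_def assms(1))
  qed simp
  show ?thesis
    unfolding coend_nf_def
  proof (intro conjI ballI iffI)
    fix p q assume "(p, q) \<in> coend_rel C F"
    then show "case_prod nf p = case_prod nf q"
      by (intro *) (simp add: coend_rel_def)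
  next
    fix p q assume "p \<in> coend_carrier C F" "q \<in> coend_carrier C F" "case_prod nf p = case_prod nf q"
    then show "(p, q) \<in> coend_rel C F"
      by (cases p, cases q) (simp add: coend_carrier_def connected)
  next
    show "case_prod nf ` coend_carrier C F = T"
    proof (intro set_eqI iffI)
      fix t assume "t \<in> T"
      then obtain x e where "x \<in> Obj C" "e \<in> Ob F (x, x)" "nf x e = t"
        using surj by blast
      then show "t \<in> case_prod nf ` coend_carrier C F"
        by (intro image_eqI[of _ _ "(x, e)"]) (auto simp: coend_carrier_def)
    qed (auto simp: coend_carrier_def mem)
  qed
qed

lemma coend_nf_eq_iff:
  assumes "coend_nf C F nf T" "x \<in> Obj C" "e \<in> Ob F (x, x)" "y \<in> Obj C" "e' \<in> Ob F (y, y)"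
  shows "((x, e), (y, e')) \<in> coend_rel C F \<longleftrightarrow> nf x e = nf y e'"
proof -
  have "(x, e) \<in> coend_carrier C F" "(y, e') \<in> coend_carrier C F"
    using assms by (simp_all add: coend_carrier_def)
  then show ?thesis
    using assms(1) unfolding coend_nf_def by (metis case_prod_conv)
qed

lemma coend_nf_in:
  assumes "coend_nf C F nf T" "x \<in> Obj C" "e \<in> Ob F (x, x)"
  shows "nf x e \<in> T"
proof -
  have "case_prod nf (x, e) \<in> case_prod nf ` coend_carrier C F"
    using assms(2,3) by (intro imageI) (simp add: coend_carrier_def)
  then show ?thesis
    using assms(1) by (simp add: coend_nf_def)
qed

lemma coend_nf_Ex_class:
  assumes "coend_nf C F nf T" "t \<in> T"
  obtains x e where "x \<in> Obj C" "e \<in> Ob F (x, x)" "nf x e = t"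
  using assms by (auto simp: coend_nf_def coend_carrier_def)

text \<open>\<open>coend_desc\<close> extracts the only element of an image. That the image of the
  class is a singleton comes from h factoring through the invariant, via K.\<close>

lemma coend_desc_class:
  assumes nf: "coend_nf C F nf T"
    and "x \<in> Obj C" "e \<in> Ob F (x, x)"
    and h: "\<And>x e. \<lbrakk>x \<in> Obj C; e \<in> Ob F (x, x)\<rbrakk> \<Longrightarrow> h x e = K (nf x e)"
  shows "coend_desc h (coend_class C F x e) = K (nf x e)"
proof -
  have "case_prod h ` coend_class C F x e = {K (nf x e)}" (is "?I = _")
  proof
    show "?I \<subseteq> {K (nf x e)}"
    proof clarsimp
      fix y e' assume "(y, e') \<in> coend_class C F x e"
      then have "((x, e), (y, e')) \<in> coend_rel C F" "y \<in> Obj C" "e' \<in> Ob F (y, y)"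
        by (auto simp: coend_class_def coend_rel_def coend_carrier_def)
      then show "h y e' = K (nf x e)"
        using coend_nf_eq_iff[OF nf assms(2,3)] h by simp
    qed
    have "(x, e) \<in> coend_class C F x e"
      using assms(2,3) by (auto simp: coend_class_def coend_rel_def coend_carrier_def)
    then have "case_prod h (x, e) \<in> ?I"
      by (rule imageI)
    then show "{K (nf x e)} \<subseteq> ?I"
      using h[OF assms(2,3)] by simp
  qed
  then show ?thesis
    by (simp add: coend_desc_def)
qed

lemma coend_desc_nf_class:
  assumes "coend_nf C F nf T" "x \<in> Obj C" "e \<in> Ob F (x, x)"
  shows "coend_desc nf (coend_class C F x e) = nf x e"
  using coend_desc_class[OF assms, of nf "\<lambda>t. t"] by simp

text \<open>The source of both uses of coordinates: surjectivity lets structure maps be defined by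
  prescribing coordinates, injectivity lets equations between coend elements be checked on
  coordinates.\<close>

lemma bij_betw_coend_desc_nf:
  assumes nf: "coend_nf C F nf T"
  shows "bij_betw (coend_desc nf) (coend C F) T"
  unfolding bij_betw_def
proof
  show "inj_on (coend_desc nf) (coend C F)"
  proof (rule inj_onI)
    fix X Y assume "X \<in> coend C F" "Y \<in> coend C F" and eq: "coend_desc nf X = coend_desc nf Y"
    then obtain x e y e' where *: "x \<in> Obj C" "e \<in> Ob F (x, x)" "X = coend_class C F x e"
      "y \<in> Obj C" "e' \<in> Ob F (y, y)" "Y = coend_class C F y e'"
      by (metis coendE)
    then have "nf x e = nf y e'"
      using eq coend_desc_nf_class[OF nf] by simp
    then have "((x, e), (y, e')) \<in> coend_rel C F"
      using coend_nf_eq_iff[OF nf] * by simp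
    then show "X = Y"
      using * equiv_class_eq[OF equiv_coend_rel] by (metis coend_class_def)
  qed
  show "coend_desc nf ` coend C F = T"
  proof (intro set_eqI iffI)
    fix t assume "t \<in> coend_desc nf ` coend C F"
    then obtain x e where *: "x \<in> Obj C" "e \<in> Ob F (x, x)" "t = coend_desc nf (coend_class C F x e)"
      by (metis coendE imageE)
    then show "t \<in> T"
      using coend_desc_nf_class[OF nf] coend_nf_in[OF nf] by simp
  next
    fix t assume "t \<in> T"
    then obtain x e where *: "x \<in> Obj C" "e \<in> Ob F (x, x)" "nf x e = t"
      using coend_nf_Ex_class[OF nf] by metis
    then show "t \<in> coend_desc nf ` coend C F"
      using coend_desc_nf_class[OF nf *(1,2)] coend_class_in[of x e C F]
      by (intro image_eqI[of _ _ "coend_class C F x e"]) (auto simp: coend_carrier_def)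
  qed
qed

text \<open>
  A map out of a coend is well defined as soon as, in coordinates \<open>N\<close> that separate the points of
  its codomain, it is a function \<open>K\<close> of the normal form.
\<close>

lemma coend_desc_coordinates:
  assumes nf: "coend_nf C F nf T" and X: "X \<in> coend C F" and N: "inj_on N Y"
    and h: "\<And>x e. \<lbrakk>x \<in> Obj C; e \<in> Ob F (x, x)\<rbrakk> \<Longrightarrow> h x e \<in> Y \<and> N (h x e) = K (nf x e)"
  shows "coend_desc h X \<in> Y \<and> N (coend_desc h X) = K (coend_desc nf X)"
proof -
  obtain x e where *: "x \<in> Obj C" "e \<in> Ob F (x, x)" "X = coend_class C F x e"
    using X by (rule coendE)
  \<comment> \<open>Injectivity of N recovers h from its coordinates, so h itself is a function of
    the normal form, as \<open>coend_desc_class\<close> demands.\<close>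
  have "h x e = inv_into Y N (K (nf x e))" if "x \<in> Obj C" "e \<in> Ob F (x, x)" for x e
    using h[OF that] N by (metis inv_into_f_f)
  then have "coend_desc h X = inv_into Y N (K (nf x e))"
    using coend_desc_class[OF nf *(1,2), of h "\<lambda>t. inv_into Y N (K t)"] *(3) by simp
  also have "\<dots> = h x e"
    using h[OF *(1,2)] N by (metis inv_into_f_f)
  finally show ?thesis
    using h * coend_desc_nf_class[OF nf] by simp
qed

text \<open>The coordinate of a class is the normal form of any representative, so \<phi> only has
  to be followed on representatives. K will be the identity for associators and unitors, a
  permutation for the symmetry, and the action of morphisms in naturality proofs.\<close>

lemma coend_map_coordinates:
  assumes nf: "coend_nf C F nf T" and X: "X \<in> coend C F" and nf': "coend_nf C G nf' T'"
    and \<phi>: "\<And>x e. \<lbrakk>x \<in> Obj C; e \<in> Ob F (x, x)\<rbrakk> \<Longrightarrow>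
      \<phi> x e \<in> Ob G (x, x) \<and> nf' x (\<phi> x e) = K (nf x e)"
  shows "coend_map C G \<phi> X \<in> coend C G \<and> coend_desc nf' (coend_map C G \<phi> X) = K (coend_desc nf X)"
  unfolding coend_map_def
proof (rule coend_desc_coordinates[OF nf X])
  show "inj_on (coend_desc nf') (coend C G)"
    using bij_betw_coend_desc_nf[OF nf'] by (rule bij_betw_imp_inj_on)
  fix x e assume *: "x \<in> Obj C" "e \<in> Ob F (x, x)"
  then show "coend_class C G x (\<phi> x e) \<in> coend C G \<and>
      coend_desc nf' (coend_class C G x (\<phi> x e)) = K (nf x e)"
    using \<phi>[OF *] coend_desc_nf_class[OF nf'] by (simp add: coend_class_in coend_carrier_def)
qed

section \<open>Functors represented by tuples of morphisms\<close>

lemma natural_iso_bij: "natural_iso C F G \<eta> \<Longrightarrow> x \<in> Obj C \<Longrightarrow> bij_betw (\<eta> x) (Ob F x) (Ob G x)"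
  by (simp add: natural_iso_def)

lemma natural_iso_inj:
  "\<lbrakk>natural_iso C F G \<eta>; x \<in> Obj C; \<eta> x e = \<eta> x e'; e \<in> Ob F x; e' \<in> Ob F x\<rbrakk> \<Longrightarrow> e = e'"
  by (rule inj_onD[OF bij_betw_imp_inj_on[OF natural_iso_bij]])

lemma natural_iso_in: "\<lbrakk>natural_iso C F G \<eta>; x \<in> Obj C; e \<in> Ob F x\<rbrakk> \<Longrightarrow> \<eta> x e \<in> Ob G x"
  by (rule bij_betw_apply[OF natural_iso_bij])

lemma natural_iso_natural:
  "\<lbrakk>natural_iso C F G \<eta>; x \<in> Obj C; y \<in> Obj C; f \<in> Hom C x y; e \<in> Ob F x\<rbrakk>
    \<Longrightarrow> \<eta> y (Ar F x y f e) = Ar G x y f (\<eta> x e)"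
  by (simp add: natural_iso_def)

lemma natural_iso_surj:
  assumes "natural_iso C F G \<eta>" "x \<in> Obj C" "t \<in> Ob G x"
  obtains e where "e \<in> Ob F x" "\<eta> x e = t"
proof -
  have "t \<in> \<eta> x ` Ob F x"
    using assms(3) bij_betw_imp_surj_on[OF natural_iso_bij[OF assms(1,2)]] by simp
  then show thesis
    using that by (elim imageE) simp
qed

text \<open>Injectivity of the components of \<eta> pulls the two functor laws back from G. Typing
  of the action has to be assumed separately, because \<open>natural_iso\<close> does not say that
  the action of F stays inside \<open>Ob F\<close>.\<close>

lemma set_functor_transport:
  assumes G: "set_functor C G" and \<eta>: "natural_iso C F G \<eta>"
    and F: "\<And>x y f e. \<lbrakk>x \<in> Obj C; y \<in> Obj C; f \<in> Hom C x y; e \<in> Ob F x\<rbrakk> \<Longrightarrow> Ar F x y f e \<in> Ob F y"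
  shows "set_functor C F"
proof -
  interpret G: set_functor C G by fact
  show ?thesis
  proof
    fix x e assume "x \<in> Obj C" "e \<in> Ob F x"
    then show "Ar F x x (Ident C x) e = e"
      by (intro natural_iso_inj[OF \<eta>])
        (auto simp: G.Ident_in F natural_iso_natural[OF \<eta>] natural_iso_in[OF \<eta>] G.Ar_Ident)
  next
    fix x y z f g e
    assume "x \<in> Obj C" "y \<in> Obj C" "z \<in> Obj C" "f \<in> Hom C x y" "g \<in> Hom C y z" "e \<in> Ob F x"
    then show "Ar F x z (Comp C x y z g f) e = Ar F y z g (Ar F x y f e)"
      by (intro natural_iso_inj[OF \<eta>, of z])
        (auto simp: G.Comp_in F natural_iso_natural[OF \<eta>] natural_iso_in[OF \<eta>] G.Ar_Comp)
  qed (rule F)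
qed

text \<open>Lists instead of nested products: tuples of every length then share one type, and
  substituting a tuple for an entry is concatenation.\<close>

definition homs :: "('o, 'm) cat \<Rightarrow> 'o \<Rightarrow> 'o list \<Rightarrow> 'm list set" where
  "homs C d as = {fs. list_all2 (\<lambda>f a. f \<in> Hom C d a) fs as}"

lemma homs_Nil [simp]: "homs C d [] = {[]}"
  by (auto simp: homs_def)

lemma in_homs_Cons: "fs \<in> homs C d (a # as) \<longleftrightarrow> (\<exists>u us. fs = u # us \<and> u \<in> Hom C d a \<and> us \<in> homs C d as)"
  by (auto simp: homs_def list_all2_Cons2)

lemma Cons_in_homs_Cons [simp]: "u # us \<in> homs C d (a # as) \<longleftrightarrow> u \<in> Hom C d a \<and> us \<in> homs C d as"
  by (auto simp: homs_def)

lemma homs_length: "fs \<in> homs C d as \<Longrightarrow> length fs = length as"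
  by (auto simp: homs_def list_all2_lengthD)

text \<open>The shape of the contravariant factor of an integrand. For the empty list it is the
  constant singleton functor, which is how the unit J enters.\<close>

definition precomp_tuples :: "('o, 'm) cat \<Rightarrow> 'o list \<Rightarrow> ('o, 'm, 'm list) setfun" where
  "precomp_tuples C as = \<lparr>Ob = (\<lambda>x. homs C x as),
     Ar = (\<lambda>x y f us. map2 (\<lambda>u a. Comp C y x a u f) us as)\<rparr>"

text \<open>The shape of the covariant factor: bs and cs are the targets that stay fixed around the
  slot of the bound variable, and \<open>length bs\<close> is the index of that slot.\<close>

definition postcomp_tuples :: "('o, 'm) cat \<Rightarrow> 'o \<Rightarrow> 'o list \<Rightarrow> 'o list \<Rightarrow> ('o, 'm, 'm list) setfun" where
  "postcomp_tuples C e bs cs = \<lparr>Ob = (\<lambda>x. homs C e (bs @ x # cs)),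
     Ar = (\<lambda>x y f us. us[length bs := Comp C e x y f (us ! length bs)])\<rparr>"

text \<open>
  Substitution of the tuple \<open>us\<close> with source \<open>x\<close> for the entry \<open>n\<close>, a morphism \<open>e \<rightarrow> x\<close>,
  of the tuple \<open>vs\<close>.
\<close>

definition plug :: "('o, 'm) cat \<Rightarrow> 'o \<Rightarrow> 'o \<Rightarrow> nat \<Rightarrow> 'o list \<Rightarrow> 'm list \<Rightarrow> 'm list \<Rightarrow> 'm list" where
  "plug C e x n as us vs =
     take n vs @ map2 (\<lambda>u a. Comp C e x a u (vs ! n)) us as @ drop (Suc n) vs"

lemma in_homs_append:
  "vs \<in> homs C e (bs @ cs) \<longleftrightarrow> (\<exists>ps rs. vs = ps @ rs \<and> ps \<in> homs C e bs \<and> rs \<in> homs C e cs)"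
proof
  assume "vs \<in> homs C e (bs @ cs)"
  then show "\<exists>ps rs. vs = ps @ rs \<and> ps \<in> homs C e bs \<and> rs \<in> homs C e cs"
    by (auto simp: homs_def list_all2_append2)
qed (auto simp: homs_def intro: list_all2_appendI)

lemma in_homs_append_Cons:
  "vs \<in> homs C e (bs @ x # cs) \<longleftrightarrow>
    (\<exists>ps h rs. vs = ps @ h # rs \<and> ps \<in> homs C e bs \<and> h \<in> Hom C e x \<and> rs \<in> homs C e cs)"
  by (simp add: in_homs_append in_homs_Cons) blast

lemma append_in_homs:
  "\<lbrakk>ps \<in> homs C e bs; rs \<in> homs C e cs\<rbrakk> \<Longrightarrow> ps @ rs \<in> homs C e (bs @ cs)"
  unfolding in_homs_append by blast

lemma append_Cons_in_homs:
  "\<lbrakk>ps \<in> homs C e bs; h \<in> Hom C e x; rs \<in> homs C e cs\<rbrakk> \<Longrightarrow> ps @ h # rs \<in> homs C e (bs @ x # cs)"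
  unfolding in_homs_append_Cons by blast

section \<open>Composition of tuples and the co-Yoneda lemma with a context of fixed entries\<close>

context small_category
begin

lemma precomp_in_homs:
  assumes "us \<in> homs C x as" "x \<in> Obj C" "y \<in> Obj C" "set as \<subseteq> Obj C" "f \<in> Hom C y x"
  shows "map2 (\<lambda>u a. Comp C y x a u f) us as \<in> homs C y as"
  using assms by (induction as arbitrary: us) (auto simp: in_homs_Cons intro: Comp_in)

lemma precomp_homs_assoc:
  assumes "us \<in> homs C z as" "x \<in> Obj C" "y \<in> Obj C" "z \<in> Obj C" "set as \<subseteq> Obj C"
    "f \<in> Hom C x y" "g \<in> Hom C y z"
  shows "map2 (\<lambda>u a. Comp C x y a u f) (map2 (\<lambda>u a. Comp C y z a u g) us as) as =
    map2 (\<lambda>u a. Comp C x z a u (Comp C x y z g f)) us as"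
  using assms by (induction as arbitrary: us) (auto simp: in_homs_Cons Comp_assoc)

text \<open>The entry h : e -> x of b can be carried across the coend relation to a. This turns x
  into e and leaves an identity in the slot, so the surviving information is a precomposed with h
  together with the remaining entries of b, which is exactly what \<open>plug\<close>
  records.\<close>

lemma coend_nf_coyoneda:
  assumes A: "set_functor (op_cat C) A" "natural_iso (op_cat C) A (precomp_tuples C as) \<nu>"
    and B: "set_functor C B" "natural_iso C B (postcomp_tuples C e bs cs) \<beta>"
    and obj: "e \<in> Obj C" "set as \<subseteq> Obj C" "set bs \<subseteq> Obj C" "set cs \<subseteq> Obj C"
  shows "coend_nf C (A \<otimes> B) (\<lambda>x (a, b). plug C e x (length bs) as (\<nu> x a) (\<beta> x b))
    (homs C e (bs @ as @ cs))"
proof -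
  interpret A: set_functor "op_cat C" A by fact
  interpret B: set_functor C B by fact
  have A_in: "Ar A y x f a \<in> Ob A x" if "x \<in> Obj C" "y \<in> Obj C" "f \<in> Hom C x y" "a \<in> Ob A y" for x y f a
    using A.Ar_in[of y x f a] that by (simp add: op_cat_def)
  have A_id: "Ar A x x (Ident C x) a = a" if "x \<in> Obj C" "a \<in> Ob A x" for x a
    using A.Ar_Ident[of x a] that by (simp add: op_cat_def)
  have \<nu>_nat: "\<nu> x (Ar A y x f a) = map2 (\<lambda>u a. Comp C x y a u f) (\<nu> y a) as"
    if "x \<in> Obj C" "y \<in> Obj C" "f \<in> Hom C x y" "a \<in> Ob A y" for x y f a
    using natural_iso_natural[OF A(2), of y x f a] that by (simp add: op_cat_def precomp_tuples_def)
  have \<nu>_in: "\<nu> x a \<in> homs C x as" if "x \<in> Obj C" "a \<in> Ob A x" for x a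
    using natural_iso_in[OF A(2), of x a] that by (simp add: op_cat_def precomp_tuples_def)
  have \<nu>_surj: "\<exists>a\<in>Ob A x. \<nu> x a = us" if "x \<in> Obj C" "us \<in> homs C x as" for x us
    using natural_iso_surj[OF A(2), of x us] that by (auto simp: op_cat_def precomp_tuples_def)
  have \<nu>_inj: "a = a'" if "x \<in> Obj C" "\<nu> x a = \<nu> x a'" "a \<in> Ob A x" "a' \<in> Ob A x" for x a a'
    using natural_iso_inj[OF A(2), of x a a'] that by (simp add: op_cat_def)
  have \<beta>_nat: "\<beta> y (Ar B x y f b) = (\<beta> x b)[length bs := Comp C e x y f (\<beta> x b ! length bs)]"
    if "x \<in> Obj C" "y \<in> Obj C" "f \<in> Hom C x y" "b \<in> Ob B x" for x y f b
    using natural_iso_natural[OF B(2), of x y f b] that by (simp add: postcomp_tuples_def)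
  have \<beta>_split: "\<exists>ps h rs. \<beta> x b = ps @ h # rs \<and> ps \<in> homs C e bs \<and> h \<in> Hom C e x \<and> rs \<in> homs C e cs
      \<and> length ps = length bs"
    if "x \<in> Obj C" "b \<in> Ob B x" for x b
  proof -
    have "\<beta> x b \<in> homs C e (bs @ x # cs)"
      using natural_iso_in[OF B(2) that] by (simp add: postcomp_tuples_def)
    then show ?thesis
      unfolding in_homs_append_Cons using homs_length by metis
  qed
  have \<beta>_surj: "\<exists>b\<in>Ob B x. \<beta> x b = vs" if "x \<in> Obj C" "vs \<in> homs C e (bs @ x # cs)" for x vs
    using natural_iso_surj[OF B(2), of x vs] that by (auto simp: postcomp_tuples_def)
  have \<beta>_inj: "b = b'" if "x \<in> Obj C" "\<beta> x b = \<beta> x b'" "b \<in> Ob B x" "b' \<in> Ob B x" for x b b'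
    using natural_iso_inj[OF B(2), of x b b'] that by simp
  let ?nf = "\<lambda>x (a, b). plug C e x (length bs) as (\<nu> x a) (\<beta> x b)"
  \<comment> \<open>Every representative is linked to one over e with the identity in the slot, and
    this one can be read off from the normal form: \<open>ps\<close> and \<open>rs\<close> give b0,
    the middle block gives a0.\<close>
  have canonical: "\<exists>ps rs a0 b0. length ps = length bs \<and> a0 \<in> Ob A e \<and> b0 \<in> Ob B e \<and>
      \<beta> e b0 = ps @ Ident C e # rs \<and> ?nf x (a, b) = ps @ \<nu> e a0 @ rs \<and>
      ((e, (a0, b0)), (x, (a, b))) \<in> coend_rel C (A \<otimes> B)"
    if xab: "x \<in> Obj C" "a \<in> Ob A x" "b \<in> Ob B x" for x a b
  proof -
    obtain ps h rs where s: "\<beta> x b = ps @ h # rs" "ps \<in> homs C e bs" "h \<in> Hom C e x" "rs \<in> homs C e cs"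
      "length ps = length bs"
      using \<beta>_split[OF xab(1,3)] by blast
    have "ps @ Ident C e # rs \<in> homs C e (bs @ e # cs)"
      using s obj Ident_in by (intro append_Cons_in_homs) auto
    then obtain b0 where b0: "b0 \<in> Ob B e" "\<beta> e b0 = ps @ Ident C e # rs"
      using \<beta>_surj[OF obj(1)] by blast
    \<comment> \<open>Pushing the identity in the slot of b0 forward along h restores h, so b is the
      image of b0.\<close>
    have b: "Ar B e x h b0 = b"
      by (rule \<beta>_inj[OF xab(1)])
        (use xab s b0 obj in \<open>auto simp: \<beta>_nat B.Ar_in list_update_append nth_append Comp_Ident_right\<close>)
    \<comment> \<open>The generating step along h at the mixed element (a, b0) of A x \<times> B e:
      one end lets h act on a, the other on b0.\<close>
    have "((e, (Ar A x e h a, b0)), (x, (a, b))) \<in> coend_step C (A \<otimes> B)"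
      unfolding coend_step_def mem_Collect_eq
      by (rule exI[of _ e], rule exI[of _ x], rule exI[of _ h], rule exI[of _ "(a, b0)"])
        (use xab obj s b0 b in \<open>simp add: ext_prod_def A_id B.Ar_Ident\<close>)
    then have "((e, (Ar A x e h a, b0)), (x, (a, b))) \<in> coend_rel C (A \<otimes> B)"
      using xab obj s b0 A_in by (auto simp: coend_rel_def coend_carrier_def ext_prod_def)
    moreover have "?nf x (a, b) = ps @ \<nu> e (Ar A x e h a) @ rs"
      using that s obj by (simp add: plug_def \<nu>_nat nth_append)
    ultimately show ?thesis
      using s(5) b0 A_in[OF obj(1) xab(1) s(3) xab(2)] by blast
  qed
  show ?thesis
  proof (rule coend_nfI)
    fix x y f z assume *: "x \<in> Obj C" "y \<in> Obj C" "f \<in> Hom C x y" "z \<in> Ob (A \<otimes> B) (y, x)"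
    obtain a b where z: "z = (a, b)" "a \<in> Ob A y" "b \<in> Ob B x"
      using * by (auto simp: ext_prod_def)
    obtain ps h rs where s: "\<beta> x b = ps @ h # rs" "h \<in> Hom C e x" "length ps = length bs"
      using \<beta>_split[OF *(1) z(3)] by blast
    \<comment> \<open>On the left the tuple is precomposed with f and then with h, on the right with
      the composite of h and f: associativity.\<close>
    show "?nf x (Ar (A \<otimes> B) (y, x) (x, x) (f, Ident C x) z) =
        ?nf y (Ar (A \<otimes> B) (y, x) (y, y) (Ident C y, f) z)"
      using *(1-3) z s(1,3) obj
        precomp_homs_assoc[OF \<nu>_in[OF *(2) z(2)] obj(1) *(1,2) obj(2) s(2) *(3)]
      by (simp add: ext_prod_def plug_def A_id B.Ar_Ident \<nu>_nat \<beta>_nat nth_append)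
  next
    fix x y p q assume *: "x \<in> Obj C" "y \<in> Obj C" "p \<in> Ob (A \<otimes> B) (x, x)" "q \<in> Ob (A \<otimes> B) (y, y)"
      and eq: "?nf x p = ?nf y q"
    obtain a b a' b' where z: "p = (a, b)" "a \<in> Ob A x" "b \<in> Ob B x"
      "q = (a', b')" "a' \<in> Ob A y" "b' \<in> Ob B y"
      using * by (auto simp: ext_prod_def)
    obtain ps rs a0 b0 where s: "length ps = length bs" "a0 \<in> Ob A e" "b0 \<in> Ob B e"
      "\<beta> e b0 = ps @ Ident C e # rs" "?nf x (a, b) = ps @ \<nu> e a0 @ rs"
      "((e, (a0, b0)), (x, (a, b))) \<in> coend_rel C (A \<otimes> B)"
      using canonical[OF *(1) z(2,3)] by blast
    obtain ps' rs' a0' b0' where s': "length ps' = length bs" "a0' \<in> Ob A e" "b0' \<in> Ob B e"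
      "\<beta> e b0' = ps' @ Ident C e # rs'" "?nf y (a', b') = ps' @ \<nu> e a0' @ rs'"
      "((e, (a0', b0')), (y, (a', b'))) \<in> coend_rel C (A \<otimes> B)"
      using canonical[OF *(2) z(5,6)] by blast
    \<comment> \<open>Equal block lengths make the decomposition of the normal form into three
      blocks unique, so both elements have the same canonical representative.\<close>
    have "length (\<nu> e a0) = length (\<nu> e a0')"
      using homs_length[OF \<nu>_in[OF obj(1) s(2)]] homs_length[OF \<nu>_in[OF obj(1) s'(2)]] by simp
    then have "ps = ps' \<and> \<nu> e a0 = \<nu> e a0' \<and> rs = rs'"
      using eq s s' z by simp
    then have "(a0, b0) = (a0', b0')"
      using \<nu>_inj[of e a0 a0'] \<beta>_inj[of e b0 b0'] s s' obj by simp
    then have "((e, (a0, b0)), (y, (a', b'))) \<in> coend_rel C (A \<otimes> B)"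
      using s'(6) by simp
    then show "((x, p), (y, q)) \<in> coend_rel C (A \<otimes> B)"
      unfolding z(1,4) using equiv_coend_rel[of C "A \<otimes> B"] s(6)
      by (auto simp: equiv_def dest: symD transD)
  next
    fix x p assume *: "x \<in> Obj C" "p \<in> Ob (A \<otimes> B) (x, x)"
    obtain a b where z: "p = (a, b)" "a \<in> Ob A x" "b \<in> Ob B x"
      using * by (auto simp: ext_prod_def)
    obtain ps h rs where s: "\<beta> x b = ps @ h # rs" "ps \<in> homs C e bs" "h \<in> Hom C e x" "rs \<in> homs C e cs"
      "length ps = length bs"
      using \<beta>_split[OF *(1) z(3)] by blast
    show "?nf x p \<in> homs C e (bs @ as @ cs)"
      using z s * obj precomp_in_homs[OF \<nu>_in, of x a e h]
      by (auto simp: plug_def nth_append intro!: append_in_homs)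
  next
    fix t assume "t \<in> homs C e (bs @ as @ cs)"
    then obtain ps qs rs where s: "t = ps @ qs @ rs" "ps \<in> homs C e bs" "qs \<in> homs C e as"
      "rs \<in> homs C e cs"
      by (auto simp: in_homs_append)
    obtain a where a: "a \<in> Ob A e" "\<nu> e a = qs"
      using \<nu>_surj[OF obj(1) s(3)] by blast
    \<comment> \<open>The preimage is the canonical representative: identity in the slot, and the
      middle block as the tuple to be substituted.\<close>
    have "ps @ Ident C e # rs \<in> homs C e (bs @ e # cs)"
      using s obj Ident_in by (intro append_Cons_in_homs) auto
    then obtain b where b: "b \<in> Ob B e" "\<beta> e b = ps @ Ident C e # rs"
      using \<beta>_surj[OF obj(1)] by blast
    have "map2 (\<lambda>u a. Comp C e e a u (Ident C e)) qs as = qs"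
      using s(3) obj by (induction as arbitrary: qs) (auto simp: in_homs_Cons Comp_Ident_right)
    then show "\<exists>x\<in>Obj C. \<exists>p\<in>Ob (A \<otimes> B) (x, x). ?nf x p = t"
      using a b s obj homs_length[OF s(2)]
      by (intro bexI[of _ e] bexI[of _ "(a, b)"]) (auto simp: plug_def ext_prod_def nth_append)
  qed
qed

end

section \<open>Opposite and product categories, and functors restricted along functors\<close>

lemma small_category_op: "small_category C \<Longrightarrow> small_category (op_cat C)"
  unfolding small_category_def op_cat_def by auto

lemma small_category_prod:
  assumes "small_category C" "small_category D"
  shows "small_category (C \<times>\<^sub>C D)"
proof -
  interpret C: small_category C by fact
  interpret D: small_category D by fact
  show ?thesis
    by unfold_locales
      (auto simp: prod_cat_def C.Ident_in D.Ident_in C.Comp_in D.Comp_in C.Comp_Ident_left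
        D.Comp_Ident_left C.Comp_Ident_right D.Comp_Ident_right C.Comp_assoc D.Comp_assoc)
qed

lemmas prod_op_simps = kernel_cat_def assoc_cat_def unit_cat_def prod_cat_def op_cat_def

lemma natural_isoI:
  assumes "\<And>x. x \<in> Obj C \<Longrightarrow> bij_betw (\<eta> x) (Ob F x) (Ob G x)"
    and "\<And>x y f e. \<lbrakk>x \<in> Obj C; y \<in> Obj C; f \<in> Hom C x y; e \<in> Ob F x\<rbrakk>
      \<Longrightarrow> \<eta> y (Ar F x y f e) = Ar G x y f (\<eta> x e)"
  shows "natural_iso C F G \<eta>"
  using assms by (simp add: natural_iso_def)

lemma (in small_category) small_category_kernel_cat: "small_category (kernel_cat C)"
  and small_category_assoc_cat: "small_category (assoc_cat C)"
  and small_category_unit_cat: "small_category (unit_cat C)"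
  unfolding kernel_cat_def assoc_cat_def unit_cat_def
  by (intro small_category_prod small_category_op small_category_axioms)+

lemma set_functor_precomp:
  assumes F: "set_functor C F" and D: "small_category D"
    and u: "\<And>x. x \<in> Obj D \<Longrightarrow> u x \<in> Obj C"
    and v: "\<And>x y f. \<lbrakk>x \<in> Obj D; y \<in> Obj D; f \<in> Hom D x y\<rbrakk> \<Longrightarrow> v f \<in> Hom C (u x) (u y)"
    and "\<And>x. x \<in> Obj D \<Longrightarrow> v (Ident D x) = Ident C (u x)"
    and "\<And>x y z f g. \<lbrakk>x \<in> Obj D; y \<in> Obj D; z \<in> Obj D; f \<in> Hom D x y; g \<in> Hom D y z\<rbrakk>
      \<Longrightarrow> v (Comp D x y z g f) = Comp C (u x) (u y) (u z) (v g) (v f)"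
  shows "set_functor D (precomp F u v)"
proof -
  interpret F: set_functor C F by fact
  interpret D: small_category D by fact
  show ?thesis
    by unfold_locales (auto simp: precomp_def assms F.Ar_in F.Ar_Ident F.Ar_Comp)
qed

section \<open>Model functors: one, two or three morphisms with a common source\<close>

definition act :: "('o, 'm) cat \<Rightarrow> 'o \<times> 'o \<Rightarrow> 'o \<times> 'o \<Rightarrow> 'm \<Rightarrow> 'm \<Rightarrow> 'm \<Rightarrow> 'm" where
  "act C = (\<lambda>(d, a) (d', a') h f u. Comp C d' d a' (Comp C d a a' f u) h)"

definition hom_singles :: "('o, 'm) cat \<Rightarrow> ('o \<times> 'o, 'm \<times> 'm, 'm list) setfun" where
  "hom_singles C = \<lparr>Ob = (\<lambda>(a, d). homs C d [a]),
     Ar = (\<lambda>(a, d) (a', d') (f, h) us. [act C (d, a) (d', a') h f (us ! 0)])\<rparr>"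

definition hom_pairs :: "('o, 'm) cat \<Rightarrow> ('o \<times> 'o \<times> 'o, 'm \<times> 'm \<times> 'm, 'm list) setfun" where
  "hom_pairs C = \<lparr>Ob = (\<lambda>(a, b, d). homs C d [a, b]),
     Ar = (\<lambda>(a, b, d) (a', b', d') (f, g, h) us.
       [act C (d, a) (d', a') h f (us ! 0), act C (d, b) (d', b') h g (us ! 1)])\<rparr>"

text \<open>The common model of \<open>left_comp\<close> and \<open>right_comp\<close>: both
  bracketings of a threefold product have the same normal forms, and this is what makes an
  associator exist.\<close>

definition hom_triples ::
    "('o, 'm) cat \<Rightarrow> ('o \<times> 'o \<times> 'o \<times> 'o, 'm \<times> 'm \<times> 'm \<times> 'm, 'm list) setfun" where
  "hom_triples C = \<lparr>Ob = (\<lambda>(a, b, c, d). homs C d [a, b, c]),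
     Ar = (\<lambda>(a, b, c, d) (a', b', c', d') (f, g, k, h) us.
       [act C (d, a) (d', a') h f (us ! 0), act C (d, b) (d', b') h g (us ! 1),
        act C (d, c) (d', c') h k (us ! 2)])\<rparr>"

context small_category
begin

lemmas cat_rules = Ident_in Comp_in Comp_Ident_left Comp_Ident_right Comp_assoc

lemma set_functor_hom_singles: "set_functor (unit_cat C) (hom_singles C)"
proof -
  interpret D: small_category "unit_cat C" by (rule small_category_unit_cat)
  show ?thesis
    by unfold_locales
      (auto simp: hom_singles_def prod_op_simps act_def in_homs_Cons cat_rules)
qed

lemma set_functor_hom_pairs: "set_functor (kernel_cat C) (hom_pairs C)"
proof -
  interpret D: small_category "kernel_cat C" by (rule small_category_kernel_cat)
  show ?thesis
    by unfold_locales
      (auto simp: hom_pairs_def prod_op_simps act_def in_homs_Cons cat_rules)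
qed

lemma set_functor_hom_triples: "set_functor (assoc_cat C) (hom_triples C)"
proof -
  interpret D: small_category "assoc_cat C" by (rule small_category_assoc_cat)
  show ?thesis
    by unfold_locales
      (auto simp: hom_triples_def prod_op_simps act_def in_homs_Cons cat_rules)
qed

end

section \<open>Represented functors with all but one variable fixed\<close>

locale single_rep = small_category C + U: set_functor "unit_cat C" U
  for C :: "('o, 'm) cat" and U :: "('o \<times> 'o, 'm \<times> 'm, 'u) setfun" +
  fixes \<upsilon> :: "'o \<times> 'o \<Rightarrow> 'u \<Rightarrow> 'm list"
  assumes iso: "natural_iso (unit_cat C) U (hom_singles C) \<upsilon>"
begin

text \<open>Opens a coordinate as an explicit list, so that the simplifier can evaluate
  \<open>plug\<close>, \<open>map2\<close> and indexing.\<close>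

lemma rep:
  assumes "a \<in> Obj C" "d \<in> Obj C" "u \<in> Ob U (a, d)"
  obtains f where "\<upsilon> (a, d) u = [f]" "f \<in> Hom C d a"
proof -
  have "\<upsilon> (a, d) u \<in> homs C d [a]"
    using natural_iso_in[OF iso, of "(a, d)" u] assms by (simp add: prod_op_simps hom_singles_def)
  then show thesis
    using that by (auto simp: in_homs_Cons)
qed

lemma rep_bij: "a \<in> Obj C \<Longrightarrow> d \<in> Obj C \<Longrightarrow> bij_betw (\<upsilon> (a, d)) (Ob U (a, d)) (homs C d [a])"
  using natural_iso_bij[OF iso, of "(a, d)"] by (simp add: prod_op_simps hom_singles_def)

lemma rep_natural:
  assumes "a \<in> Obj C" "d \<in> Obj C" "a' \<in> Obj C" "d' \<in> Obj C" "f \<in> Hom C a a'" "h \<in> Hom C d' d"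
    and "u \<in> Ob U (a, d)"
  shows "\<upsilon> (a', d') (Ar U (a, d) (a', d') (f, h) u) = [act C (d, a) (d', a') h f (\<upsilon> (a, d) u ! 0)]"
  using natural_iso_natural[OF iso, of "(a, d)" "(a', d')" "(f, h)" u] assms
  by (simp add: prod_op_simps hom_singles_def)

lemma set_functor_snd_of_2: "a \<in> Obj C \<Longrightarrow> set_functor (op_cat C) (snd_of_2 C U a)"
  unfolding snd_of_2_def
  by (rule set_functor_precomp[OF U.set_functor_axioms small_category_op[OF small_category_axioms]])
    (auto simp: prod_op_simps cat_rules)

text \<open>With \<open>set_functor_snd_of_2\<close> this is the input that
  \<open>coend_nf_coyoneda\<close> expects of a contravariant factor. The analogous lemmas for three
  and four variables serve the same purpose.\<close>

lemma natural_iso_snd_of_2: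
  assumes obj: "a \<in> Obj C"
  shows "natural_iso (op_cat C) (snd_of_2 C U a) (precomp_tuples C [a]) (\<lambda>x. \<upsilon> (a, x))"
proof (rule natural_isoI)
  fix x y h e
  assume "x \<in> Obj (op_cat C)" "y \<in> Obj (op_cat C)" "h \<in> Hom (op_cat C) x y" "e \<in> Ob (snd_of_2 C U a) x"
  then have *: "x \<in> Obj C" "y \<in> Obj C" "h \<in> Hom C y x" "e \<in> Ob U (a, x)"
    by (simp_all add: snd_of_2_def precomp_def op_cat_def)
  obtain f where "\<upsilon> (a, x) e = [f]" "f \<in> Hom C x a"
    by (rule rep[of a x e]) (use obj * in auto)
  then show "\<upsilon> (a, y) (Ar (snd_of_2 C U a) x y h e) = Ar (precomp_tuples C [a]) x y h
      (\<upsilon> (a, x) e)"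
    using obj *
    by (simp add: snd_of_2_def precomp_def precomp_tuples_def op_cat_def
      rep_natural act_def cat_rules)
qed (use obj in \<open>simp add: snd_of_2_def precomp_def precomp_tuples_def op_cat_def rep_bij\<close>)

end

locale pair_rep = small_category C + P: set_functor "kernel_cat C" P
  for C :: "('o, 'm) cat" and P :: "('o \<times> 'o \<times> 'o, 'm \<times> 'm \<times> 'm, 'p) setfun" +
  fixes \<kappa> :: "'o \<times> 'o \<times> 'o \<Rightarrow> 'p \<Rightarrow> 'm list"
  assumes iso: "natural_iso (kernel_cat C) P (hom_pairs C) \<kappa>"
begin

lemma rep:
  assumes "a \<in> Obj C" "b \<in> Obj C" "d \<in> Obj C" "p \<in> Ob P (a, b, d)"
  obtains f g where "\<kappa> (a, b, d) p = [f, g]" "f \<in> Hom C d a" "g \<in> Hom C d b"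
proof -
  have "\<kappa> (a, b, d) p \<in> homs C d [a, b]"
    using natural_iso_in[OF iso, of "(a, b, d)" p] assms by (simp add: prod_op_simps hom_pairs_def)
  then show thesis
    using that by (auto simp: in_homs_Cons)
qed

lemma rep_bij:
  "\<lbrakk>a \<in> Obj C; b \<in> Obj C; d \<in> Obj C\<rbrakk> \<Longrightarrow> bij_betw (\<kappa> (a, b, d)) (Ob P (a, b, d)) (homs C d [a, b])"
  using natural_iso_bij[OF iso, of "(a, b, d)"] by (simp add: prod_op_simps hom_pairs_def)

lemma rep_natural:
  assumes "a \<in> Obj C" "b \<in> Obj C" "d \<in> Obj C" "a' \<in> Obj C" "b' \<in> Obj C" "d' \<in> Obj C"
    "f \<in> Hom C a a'" "g \<in> Hom C b b'" "h \<in> Hom C d' d" "p \<in> Ob P (a, b, d)"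
  shows "\<kappa> (a', b', d') (Ar P (a, b, d) (a', b', d') (f, g, h) p) =
    [act C (d, a) (d', a') h f (\<kappa> (a, b, d) p ! 0), act C (d, b) (d', b') h g (\<kappa> (a, b, d) p ! 1)]"
  using natural_iso_natural[OF iso, of "(a, b, d)" "(a', b', d')" "(f, g, h)" p] assms
  by (simp add: prod_op_simps hom_pairs_def)

lemma Ar_P_in:
  assumes "a \<in> Obj C" "b \<in> Obj C" "d \<in> Obj C" "a' \<in> Obj C" "b' \<in> Obj C" "d' \<in> Obj C"
    "f \<in> Hom C a a'" "g \<in> Hom C b b'" "h \<in> Hom C d' d" "p \<in> Ob P (a, b, d)"
  shows "Ar P (a, b, d) (a', b', d') (f, g, h) p \<in> Ob P (a', b', d')"
  using P.Ar_in[of "(a, b, d)" "(a', b', d')" "(f, g, h)" p] assms by (simp add: prod_op_simps)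

lemma set_functor_fst_of_3: "\<lbrakk>b \<in> Obj C; d \<in> Obj C\<rbrakk> \<Longrightarrow> set_functor C (fst_of_3 C P b d)"
  unfolding fst_of_3_def
  by (rule set_functor_precomp[OF P.set_functor_axioms small_category_axioms])
    (auto simp: prod_op_simps cat_rules)

lemma set_functor_snd_of_3: "\<lbrakk>a \<in> Obj C; d \<in> Obj C\<rbrakk> \<Longrightarrow> set_functor C (snd_of_3 C P a d)"
  unfolding snd_of_3_def
  by (rule set_functor_precomp[OF P.set_functor_axioms small_category_axioms])
    (auto simp: prod_op_simps cat_rules)

lemma set_functor_thd_of_3: "\<lbrakk>a \<in> Obj C; b \<in> Obj C\<rbrakk> \<Longrightarrow> set_functor (op_cat C) (thd_of_3 C P a b)"
  unfolding thd_of_3_def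
  by (rule set_functor_precomp[OF P.set_functor_axioms small_category_op[OF small_category_axioms]])
    (auto simp: prod_op_simps cat_rules)

text \<open>The free variable is the first of the two targets, so nothing precedes the slot and b
  follows it.\<close>

lemma natural_iso_fst_of_3:
  assumes obj: "b \<in> Obj C" "d \<in> Obj C"
  shows "natural_iso C (fst_of_3 C P b d) (postcomp_tuples C d [] [b]) (\<lambda>x. \<kappa> (x, b, d))"
proof (rule natural_isoI)
  fix x y h e
  assume "x \<in> Obj C" "y \<in> Obj C" "h \<in> Hom C x y" "e \<in> Ob (fst_of_3 C P b d) x"
  then have *: "x \<in> Obj C" "y \<in> Obj C" "h \<in> Hom C x y" "e \<in> Ob P (x, b, d)"
    by (simp_all add: fst_of_3_def precomp_def op_cat_def)
  obtain f g where "\<kappa> (x, b, d) e = [f, g]" "f \<in> Hom C d x" "g \<in> Hom C d b"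
    by (rule rep[of x b d e]) (use obj * in auto)
  then show "\<kappa> (y, b, d) (Ar (fst_of_3 C P b d) x y h e) = Ar (postcomp_tuples C d [] [b]) x y h
      (\<kappa> (x, b, d) e)"
    using obj *
    by (simp add: fst_of_3_def precomp_def postcomp_tuples_def
      rep_natural act_def cat_rules)
qed (use obj in \<open>simp add: fst_of_3_def precomp_def postcomp_tuples_def rep_bij\<close>)

lemma natural_iso_snd_of_3:
  assumes obj: "a \<in> Obj C" "d \<in> Obj C"
  shows "natural_iso C (snd_of_3 C P a d) (postcomp_tuples C d [a] []) (\<lambda>x. \<kappa> (a, x, d))"
proof (rule natural_isoI)
  fix x y h e
  assume "x \<in> Obj C" "y \<in> Obj C" "h \<in> Hom C x y" "e \<in> Ob (snd_of_3 C P a d) x"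
  then have *: "x \<in> Obj C" "y \<in> Obj C" "h \<in> Hom C x y" "e \<in> Ob P (a, x, d)"
    by (simp_all add: snd_of_3_def precomp_def op_cat_def)
  obtain f g where "\<kappa> (a, x, d) e = [f, g]" "f \<in> Hom C d a" "g \<in> Hom C d x"
    by (rule rep[of a x d e]) (use obj * in auto)
  then show "\<kappa> (a, y, d) (Ar (snd_of_3 C P a d) x y h e) = Ar (postcomp_tuples C d [a] []) x y h
      (\<kappa> (a, x, d) e)"
    using obj *
    by (simp add: snd_of_3_def precomp_def postcomp_tuples_def
      rep_natural act_def cat_rules)
qed (use obj in \<open>simp add: snd_of_3_def precomp_def postcomp_tuples_def rep_bij\<close>)

lemma natural_iso_thd_of_3:
  assumes obj: "a \<in> Obj C" "b \<in> Obj C"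
  shows "natural_iso (op_cat C) (thd_of_3 C P a b) (precomp_tuples C [a, b]) (\<lambda>x. \<kappa> (a, b, x))"
proof (rule natural_isoI)
  fix x y h e
  assume "x \<in> Obj (op_cat C)" "y \<in> Obj (op_cat C)" "h \<in> Hom (op_cat C) x y" "e \<in> Ob (thd_of_3 C P a b) x"
  then have *: "x \<in> Obj C" "y \<in> Obj C" "h \<in> Hom C y x" "e \<in> Ob P (a, b, x)"
    by (simp_all add: thd_of_3_def precomp_def op_cat_def)
  obtain f g where "\<kappa> (a, b, x) e = [f, g]" "f \<in> Hom C x a" "g \<in> Hom C x b"
    by (rule rep[of a b x e]) (use obj * in auto)
  then show "\<kappa> (a, b, y) (Ar (thd_of_3 C P a b) x y h e) = Ar (precomp_tuples C [a, b]) x y h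
      (\<kappa> (a, b, x) e)"
    using obj *
    by (simp add: thd_of_3_def precomp_def precomp_tuples_def op_cat_def
      rep_natural act_def cat_rules)
qed (use obj in \<open>simp add: thd_of_3_def precomp_def precomp_tuples_def op_cat_def rep_bij\<close>)

end

locale triple_rep = small_category C + T: set_functor "assoc_cat C" T
  for C :: "('o, 'm) cat" and T :: "('o \<times> 'o \<times> 'o \<times> 'o, 'm \<times> 'm \<times> 'm \<times> 'm, 't) setfun" +
  fixes \<tau> :: "'o \<times> 'o \<times> 'o \<times> 'o \<Rightarrow> 't \<Rightarrow> 'm list"
  assumes iso: "natural_iso (assoc_cat C) T (hom_triples C) \<tau>"
begin

lemma rep:
  assumes "a \<in> Obj C" "b \<in> Obj C" "c \<in> Obj C" "d \<in> Obj C" "t \<in> Ob T (a, b, c, d)"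
  obtains f g k where "\<tau> (a, b, c, d) t = [f, g, k]" "f \<in> Hom C d a" "g \<in> Hom C d b" "k \<in> Hom C d c"
proof -
  have "\<tau> (a, b, c, d) t \<in> homs C d [a, b, c]"
    using natural_iso_in[OF iso, of "(a, b, c, d)" t] assms
    by (simp add: prod_op_simps hom_triples_def)
  then show thesis
    using that by (auto simp: in_homs_Cons)
qed

lemma rep_bij:
  "\<lbrakk>a \<in> Obj C; b \<in> Obj C; c \<in> Obj C; d \<in> Obj C\<rbrakk> \<Longrightarrow>
    bij_betw (\<tau> (a, b, c, d)) (Ob T (a, b, c, d)) (homs C d [a, b, c])"
  using natural_iso_bij[OF iso, of "(a, b, c, d)"] by (simp add: prod_op_simps hom_triples_def)

lemma rep_natural:
  assumes "a \<in> Obj C" "b \<in> Obj C" "c \<in> Obj C" "d \<in> Obj C"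
    "a' \<in> Obj C" "b' \<in> Obj C" "c' \<in> Obj C" "d' \<in> Obj C"
    "f \<in> Hom C a a'" "g \<in> Hom C b b'" "k \<in> Hom C c c'" "h \<in> Hom C d' d" "t \<in> Ob T (a, b, c, d)"
  shows "\<tau> (a', b', c', d') (Ar T (a, b, c, d) (a', b', c', d') (f, g, k, h) t) =
    [act C (d, a) (d', a') h f (\<tau> (a, b, c, d) t ! 0),
     act C (d, b) (d', b') h g (\<tau> (a, b, c, d) t ! 1),
     act C (d, c) (d', c') h k (\<tau> (a, b, c, d) t ! 2)]"
  using natural_iso_natural[OF iso, of "(a, b, c, d)" "(a', b', c', d')" "(f, g, k, h)" t] assms
  by (simp add: prod_op_simps hom_triples_def)

lemma set_functor_fst_of_4:
  "\<lbrakk>b \<in> Obj C; c \<in> Obj C; d \<in> Obj C\<rbrakk> \<Longrightarrow> set_functor C (fst_of_4 C T b c d)"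
  unfolding fst_of_4_def
  by (rule set_functor_precomp[OF T.set_functor_axioms small_category_axioms])
    (auto simp: prod_op_simps cat_rules)

lemma set_functor_snd_of_4:
  "\<lbrakk>a \<in> Obj C; c \<in> Obj C; d \<in> Obj C\<rbrakk> \<Longrightarrow> set_functor C (snd_of_4 C T a c d)"
  unfolding snd_of_4_def
  by (rule set_functor_precomp[OF T.set_functor_axioms small_category_axioms])
    (auto simp: prod_op_simps cat_rules)

lemma set_functor_thd_of_4:
  "\<lbrakk>a \<in> Obj C; b \<in> Obj C; d \<in> Obj C\<rbrakk> \<Longrightarrow> set_functor C (thd_of_4 C T a b d)"
  unfolding thd_of_4_def
  by (rule set_functor_precomp[OF T.set_functor_axioms small_category_axioms])
    (auto simp: prod_op_simps cat_rules)

lemma set_functor_fth_of_4: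
  "\<lbrakk>a \<in> Obj C; b \<in> Obj C; c \<in> Obj C\<rbrakk> \<Longrightarrow> set_functor (op_cat C) (fth_of_4 C T a b c)"
  unfolding fth_of_4_def
  by (rule set_functor_precomp[OF T.set_functor_axioms small_category_op[OF small_category_axioms]])
    (auto simp: prod_op_simps cat_rules)

lemma natural_iso_fst_of_4:
  assumes obj: "b \<in> Obj C" "c \<in> Obj C" "d \<in> Obj C"
  shows "natural_iso C (fst_of_4 C T b c d) (postcomp_tuples C d [] [b, c]) (\<lambda>x. \<tau> (x, b, c, d))"
proof (rule natural_isoI)
  fix x y h e
  assume "x \<in> Obj C" "y \<in> Obj C" "h \<in> Hom C x y" "e \<in> Ob (fst_of_4 C T b c d) x"
  then have *: "x \<in> Obj C" "y \<in> Obj C" "h \<in> Hom C x y" "e \<in> Ob T (x, b, c, d)"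
    by (simp_all add: fst_of_4_def precomp_def op_cat_def)
  obtain f g k where "\<tau> (x, b, c, d) e = [f, g, k]" "f \<in> Hom C d x" "g \<in> Hom C d b" "k \<in> Hom C d c"
    by (rule rep[of x b c d e]) (use obj * in auto)
  then show "\<tau> (y, b, c, d) (Ar (fst_of_4 C T b c d) x y h e) = Ar (postcomp_tuples C d [] [b, c]) x y h
      (\<tau> (x, b, c, d) e)"
    using obj *
    by (simp add: fst_of_4_def precomp_def postcomp_tuples_def
      rep_natural act_def cat_rules)
qed (use obj in \<open>simp add: fst_of_4_def precomp_def postcomp_tuples_def rep_bij\<close>)

lemma natural_iso_snd_of_4:
  assumes obj: "a \<in> Obj C" "c \<in> Obj C" "d \<in> Obj C"
  shows "natural_iso C (snd_of_4 C T a c d) (postcomp_tuples C d [a] [c]) (\<lambda>x. \<tau> (a, x, c, d))"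
proof (rule natural_isoI)
  fix x y h e
  assume "x \<in> Obj C" "y \<in> Obj C" "h \<in> Hom C x y" "e \<in> Ob (snd_of_4 C T a c d) x"
  then have *: "x \<in> Obj C" "y \<in> Obj C" "h \<in> Hom C x y" "e \<in> Ob T (a, x, c, d)"
    by (simp_all add: snd_of_4_def precomp_def op_cat_def)
  obtain f g k where "\<tau> (a, x, c, d) e = [f, g, k]" "f \<in> Hom C d a" "g \<in> Hom C d x" "k \<in> Hom C d c"
    by (rule rep[of a x c d e]) (use obj * in auto)
  then show "\<tau> (a, y, c, d) (Ar (snd_of_4 C T a c d) x y h e) = Ar (postcomp_tuples C d [a] [c]) x y h
      (\<tau> (a, x, c, d) e)"
    using obj *
    by (simp add: snd_of_4_def precomp_def postcomp_tuples_def
      rep_natural act_def cat_rules)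
qed (use obj in \<open>simp add: snd_of_4_def precomp_def postcomp_tuples_def rep_bij\<close>)

lemma natural_iso_thd_of_4:
  assumes obj: "a \<in> Obj C" "b \<in> Obj C" "d \<in> Obj C"
  shows "natural_iso C (thd_of_4 C T a b d) (postcomp_tuples C d [a, b] []) (\<lambda>x. \<tau> (a, b, x, d))"
proof (rule natural_isoI)
  fix x y h e
  assume "x \<in> Obj C" "y \<in> Obj C" "h \<in> Hom C x y" "e \<in> Ob (thd_of_4 C T a b d) x"
  then have *: "x \<in> Obj C" "y \<in> Obj C" "h \<in> Hom C x y" "e \<in> Ob T (a, b, x, d)"
    by (simp_all add: thd_of_4_def precomp_def op_cat_def)
  obtain f g k where "\<tau> (a, b, x, d) e = [f, g, k]" "f \<in> Hom C d a" "g \<in> Hom C d b" "k \<in> Hom C d x"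
    by (rule rep[of a b x d e]) (use obj * in auto)
  then show "\<tau> (a, b, y, d) (Ar (thd_of_4 C T a b d) x y h e) = Ar (postcomp_tuples C d [a, b] []) x y h
      (\<tau> (a, b, x, d) e)"
    using obj *
    by (simp add: thd_of_4_def precomp_def postcomp_tuples_def
      rep_natural act_def cat_rules)
qed (use obj in \<open>simp add: thd_of_4_def precomp_def postcomp_tuples_def rep_bij\<close>)

lemma natural_iso_fth_of_4:
  assumes obj: "a \<in> Obj C" "b \<in> Obj C" "c \<in> Obj C"
  shows "natural_iso (op_cat C) (fth_of_4 C T a b c) (precomp_tuples C [a, b, c]) (\<lambda>x. \<tau> (a, b, c, x))"
proof (rule natural_isoI)
  fix x y h e
  assume "x \<in> Obj (op_cat C)" "y \<in> Obj (op_cat C)" "h \<in> Hom (op_cat C) x y" "e \<in> Ob (fth_of_4 C T a b c) x"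
  then have *: "x \<in> Obj C" "y \<in> Obj C" "h \<in> Hom C y x" "e \<in> Ob T (a, b, c, x)"
    by (simp_all add: fth_of_4_def precomp_def op_cat_def)
  obtain f g k where "\<tau> (a, b, c, x) e = [f, g, k]" "f \<in> Hom C x a" "g \<in> Hom C x b" "k \<in> Hom C x c"
    by (rule rep[of a b c x e]) (use obj * in auto)
  then show "\<tau> (a, b, c, y) (Ar (fth_of_4 C T a b c) x y h e) = Ar (precomp_tuples C [a, b, c]) x y h
      (\<tau> (a, b, c, x) e)"
    using obj *
    by (simp add: fth_of_4_def precomp_def precomp_tuples_def op_cat_def
      rep_natural act_def cat_rules)
qed (use obj in \<open>simp add: fth_of_4_def precomp_def precomp_tuples_def op_cat_def rep_bij\<close>)

end

section \<open>Maps preserving normal forms\<close>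

text \<open>N and M are coordinates with values in the same set; the predicate says that \<phi> is
  the identity in these coordinates. Each leg of a coherence diagram is shown to have this
  property.\<close>

definition preserves :: "('a \<Rightarrow> 't) \<Rightarrow> 'a set \<Rightarrow> ('b \<Rightarrow> 't) \<Rightarrow> 'b set \<Rightarrow> ('a \<Rightarrow> 'b) \<Rightarrow> bool" where
  "preserves N A M B \<phi> \<longleftrightarrow> (\<forall>X\<in>A. \<phi> X \<in> B \<and> M (\<phi> X) = N X)"

lemma preserves_comp:
  "preserves M B L D \<psi> \<Longrightarrow> preserves N A M B \<phi> \<Longrightarrow> preserves N A L D (\<psi> \<circ> \<phi>)"
  by (simp add: preserves_def)

text \<open>The mechanism behind pentagon and triangle: parallel maps with equal coordinates agree
  because M separates the points of the target.\<close>

lemma preserves_unique: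
  "\<lbrakk>preserves N A M B \<phi>; preserves N A M B \<psi>; inj_on M B; X \<in> A\<rbrakk> \<Longrightarrow> \<phi> X = \<psi> X"
  by (metis preserves_def inj_on_eq_iff)

lemma coend_desc_preserves:
  assumes "coend_nf C F nf T" "inj_on N Y"
    and "\<And>x e. \<lbrakk>x \<in> Obj C; e \<in> Ob F (x, x)\<rbrakk> \<Longrightarrow> h x e \<in> Y \<and> N (h x e) = nf x e"
  shows "preserves (coend_desc nf) (coend C F) N Y (coend_desc h)"
  unfolding preserves_def
  using coend_desc_coordinates[OF assms(1) _ assms(2), where K = "\<lambda>t. t"] assms(3) by blast

lemma coend_map_preserves:
  assumes "coend_nf C F nf T" "coend_nf C G nf' T'"
    and "\<And>x a b. \<lbrakk>x \<in> Obj C; (a, b) \<in> Ob F (x, x)\<rbrakk> \<Longrightarrow>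
      \<phi> x (a, b) \<in> Ob G (x, x) \<and> nf' x (\<phi> x (a, b)) = nf x (a, b)"
  shows "preserves (coend_desc nf) (coend C F) (coend_desc nf') (coend C G) (coend_map C G \<phi>)"
  unfolding preserves_def
  using coend_map_coordinates[OF assms(1) _ assms(2), where K = "\<lambda>t. t"] assms(3)
  by (metis surj_pair)

lemma coend_class_coordinates:
  assumes "coend_nf C S nfS TS" "x \<in> Obj C" "e \<in> Ob S (x, x)"
  shows "coend_class C S x e \<in> coend C S \<and>
    coend_desc nfS (coend_class C S x e) = nfS x e"
  using assms by (simp add: coend_class_in coend_carrier_def coend_desc_nf_class)

text \<open>A Fubini map is a descent inside a descent. For fixed outer data the inner one is
  governed by \<open>coend_map_coordinates\<close>, where K tells how the outer normal form depends
  on the inner coordinate; the outer one follows from \<open>coend_desc_preserves\<close>. The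
  computation left to an instance is \<open>key\<close>, which compares two orders of
  substitution.\<close>

lemma fubini_right_preserves:
  assumes nf: "coend_nf C F nf T" and S: "coend_nf C S nfS TS"
    and inner: "\<And>y t w. \<lbrakk>y \<in> Obj C; (t, w) \<in> Ob F (y, y)\<rbrakk> \<Longrightarrow>
      coend_nf C (G y) (nfG y) (TG y) \<and> t \<in> coend C (G y) \<and> K y w (coend_desc (nfG y) t) = nf y (t, w)"
    and key: "\<And>x y t w u v. \<lbrakk>x \<in> Obj C; y \<in> Obj C; (t, w) \<in> Ob F (y, y); (u, v) \<in> Ob (G y) (x, x)\<rbrakk>
      \<Longrightarrow> (u, inn x y (v, w)) \<in> Ob S (x, x) \<and> nfS x (u, inn x y (v, w)) = K y w (nfG y x (u, v))"
  shows "preserves (coend_desc nf) (coend C F) (coend_desc nfS) (coend C S)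
    (fubini_right (coend_class C S) inn)"
  unfolding fubini_right_def
proof (rule coend_desc_preserves[OF nf bij_betw_imp_inj_on[OF bij_betw_coend_desc_nf[OF S]]])
  fix y e assume y: "y \<in> Obj C" "e \<in> Ob F (y, y)"
  obtain t w where e: "e = (t, w)" by fastforce
  have inner': "coend_nf C (G y) (nfG y) (TG y)" "t \<in> coend C (G y)"
    "K y w (coend_desc (nfG y) t) = nf y (t, w)"
    using inner[of y t w] y e by auto
  show "(case e of (t, w) \<Rightarrow>
      coend_desc (\<lambda>x (u, v). coend_class C S x (u, inn x y (v, w))) t) \<in> coend C S \<and>
    coend_desc nfS ((case e of (t, w) \<Rightarrow>
      coend_desc (\<lambda>x (u, v). coend_class C S x (u, inn x y (v, w))) t)) = nf y e"
    \<comment> \<open>Up to the notation for pairs, the inner descent is a \<open>coend_map\<close>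
      into the coend of S.\<close>
    using coend_map_coordinates[OF inner'(1,2) S, of "\<lambda>x (u, v). (u, inn x y (v, w))" "K y w"]
      key[of _ y t w] y inner'(3)
    by (simp add: coend_map_def e split_def)
qed

lemma fubini_left_preserves:
  assumes nf: "coend_nf C F nf T" and S: "coend_nf C S nfS TS"
    and inner: "\<And>x u t. \<lbrakk>x \<in> Obj C; (u, t) \<in> Ob F (x, x)\<rbrakk> \<Longrightarrow>
      coend_nf C (G x) (nfG x) (TG x) \<and> t \<in> coend C (G x) \<and> K x u (coend_desc (nfG x) t) = nf x (u, t)"
    and key: "\<And>x y u t v w. \<lbrakk>x \<in> Obj C; y \<in> Obj C; (u, t) \<in> Ob F (x, x); (v, w) \<in> Ob (G x) (y, y)\<rbrakk>
      \<Longrightarrow> (inn y x (u, v), w) \<in> Ob S (y, y) \<and> nfS y (inn y x (u, v), w) = K x u (nfG x y (v, w))"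
  shows "preserves (coend_desc nf) (coend C F) (coend_desc nfS) (coend C S)
    (fubini_left (coend_class C S) inn)"
  unfolding fubini_left_def
proof (rule coend_desc_preserves[OF nf bij_betw_imp_inj_on[OF bij_betw_coend_desc_nf[OF S]]])
  fix x e assume x: "x \<in> Obj C" "e \<in> Ob F (x, x)"
  obtain u t where e: "e = (u, t)" by fastforce
  have inner': "coend_nf C (G x) (nfG x) (TG x)" "t \<in> coend C (G x)"
    "K x u (coend_desc (nfG x) t) = nf x (u, t)"
    using inner[of x u t] x e by auto
  show "(case e of (u, t) \<Rightarrow>
      coend_desc (\<lambda>y (v, w). coend_class C S y (inn y x (u, v), w)) t) \<in> coend C S \<and>
    coend_desc nfS (case e of (u, t) \<Rightarrow>
      coend_desc (\<lambda>y (v, w). coend_class C S y (inn y x (u, v), w)) t) = nf x e"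
    using coend_map_coordinates[OF inner'(1,2) S, of "\<lambda>y (v, w). (inn y x (u, v), w)" "K x u"]
      key[of x _ u t] x inner'(3)
    by (simp add: coend_map_def e split_def)
qed

lemma fubini_swap_preserves:
  assumes nf: "coend_nf C F nf T" and S: "coend_nf C S nfS TS"
    and inner: "\<And>x u t. \<lbrakk>x \<in> Obj C; (u, t) \<in> Ob F (x, x)\<rbrakk> \<Longrightarrow>
      coend_nf C (G x) (nfG x) (TG x) \<and> t \<in> coend C (G x) \<and> K x u (coend_desc (nfG x) t) = nf x (u, t)"
    and key: "\<And>x y u t v w. \<lbrakk>x \<in> Obj C; y \<in> Obj C; (u, t) \<in> Ob F (x, x); (v, w) \<in> Ob (G x) (y, y)\<rbrakk>
      \<Longrightarrow> (v, inn y x (u, w)) \<in> Ob S (y, y) \<and> nfS y (v, inn y x (u, w)) = K x u (nfG x y (v, w))"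
  shows "preserves (coend_desc nf) (coend C F) (coend_desc nfS) (coend C S)
    (fubini_swap (coend_class C S) inn)"
  unfolding fubini_swap_def
proof (rule coend_desc_preserves[OF nf bij_betw_imp_inj_on[OF bij_betw_coend_desc_nf[OF S]]])
  fix x e assume x: "x \<in> Obj C" "e \<in> Ob F (x, x)"
  obtain u t where e: "e = (u, t)" by fastforce
  have inner': "coend_nf C (G x) (nfG x) (TG x)" "t \<in> coend C (G x)"
    "K x u (coend_desc (nfG x) t) = nf x (u, t)"
    using inner[of x u t] x e by auto
  show "(case e of (u, t) \<Rightarrow>
      coend_desc (\<lambda>y (v, w). coend_class C S y (v, inn y x (u, w))) t) \<in> coend C S \<and>
    coend_desc nfS (case e of (u, t) \<Rightarrow>
      coend_desc (\<lambda>y (v, w). coend_class C S y (v, inn y x (u, w))) t) = nf x e"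
    using coend_map_coordinates[OF inner'(1,2) S, of "\<lambda>y (v, w). (v, inn y x (u, w))" "K x u"]
      key[of x _ u t] x inner'(3)
    by (simp add: coend_map_def e split_def)
qed

text \<open>\<eta> followed by the inverse of \<theta>. Functoriality of G supplies that the
  transported element lies in \<open>Ob G y\<close>, where \<open>inv_into\<close> really inverts
  \<theta>.\<close>

lemma natural_iso_inv_into:
  assumes \<eta>: "natural_iso D F H \<eta>" and \<theta>: "natural_iso D G H \<theta>" and G: "set_functor D G"
  shows "natural_iso D F G (\<lambda>x e. inv_into (Ob G x) (\<theta> x) (\<eta> x e))"
proof (rule natural_isoI)
  interpret G: set_functor D G by fact
  fix x assume "x \<in> Obj D"
  then show "bij_betw (\<lambda>e. inv_into (Ob G x) (\<theta> x) (\<eta> x e)) (Ob F x) (Ob G x)"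
    using bij_betw_trans[OF natural_iso_bij[OF \<eta>] bij_betw_inv_into[OF natural_iso_bij[OF \<theta>]]]
    by (simp add: comp_def)
  fix y f e assume *: "x \<in> Obj D" "y \<in> Obj D" "f \<in> Hom D x y" "e \<in> Ob F x"
  have \<theta>_inv: "inv_into (Ob G z) (\<theta> z) t \<in> Ob G z \<and> \<theta> z (inv_into (Ob G z) (\<theta> z) t) = t"
    if "z \<in> Obj D" "t \<in> Ob H z" for z t
    using bij_betw_imp_surj_on[OF natural_iso_bij[OF \<theta> that(1)]] that(2)
    by (metis f_inv_into_f inv_into_into)
  let ?t = "inv_into (Ob G x) (\<theta> x) (\<eta> x e)"
  have t: "?t \<in> Ob G x" "\<theta> x ?t = \<eta> x e"
    using \<theta>_inv natural_iso_in[OF \<eta>] * by auto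
  \<comment> \<open>Both naturality squares meet in H; inverting \<theta> at y then gives
    naturality.\<close>
  have "\<eta> y (Ar F x y f e) = \<theta> y (Ar G x y f ?t)"
    using natural_iso_natural[OF \<eta>] natural_iso_natural[OF \<theta>] t * by simp
  then show "inv_into (Ob G y) (\<theta> y) (\<eta> y (Ar F x y f e)) = Ar G x y f ?t"
    using inv_into_f_f[OF bij_betw_imp_inj_on[OF natural_iso_bij[OF \<theta> *(2)]] G.Ar_in[OF *(1-3) t(1)]]
    by simp
qed

section \<open>Kernels represented by pairs of morphisms\<close>

text \<open>Freezing the parameters splits the integrand into an external product of two functors of
  the bound variable, the form treated by \<open>coend_nf_coyoneda\<close>. The equation is one of
  records and so can be used for rewriting.\<close>

lemma at_param_left:
  "at_param (assoc_cat C) (left_integrand P) (a, b, c, d) = thd_of_3 C P a b \<otimes> fst_of_3 C P c d"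
  by (simp add: at_param_def left_integrand_def precomp_def ext_prod_def thd_of_3_def fst_of_3_def
      prod_op_simps fun_eq_iff split_def)

lemma at_param_right:
  "at_param (assoc_cat C) (right_integrand P) (a, b, c, d) = thd_of_3 C P b c \<otimes> snd_of_3 C P a d"
  by (simp add: at_param_def right_integrand_def precomp_def ext_prod_def thd_of_3_def snd_of_3_def
      prod_op_simps fun_eq_iff split_def)

lemma at_param_left_unit:
  "at_param (unit_cat C) (left_unit_integrand P J) (b, d) = J \<otimes> fst_of_3 C P b d"
  by (simp add: at_param_def left_unit_integrand_def precomp_def ext_prod_def fst_of_3_def
      prod_op_simps fun_eq_iff split_def)

lemma at_param_right_unit:
  "at_param (unit_cat C) (right_unit_integrand P J) (a, d) = J \<otimes> snd_of_3 C P a d"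
  by (simp add: at_param_def right_unit_integrand_def precomp_def ext_prod_def snd_of_3_def
      prod_op_simps fun_eq_iff split_def)

lemmas at_param_simps = at_param_left at_param_right at_param_left_unit at_param_right_unit

lemma slot_Ob_simps [simp]:
  "Ob (snd_of_2 C U a) x = Ob U (a, x)"
  "Ob (fst_of_3 C P b d) x = Ob P (x, b, d)"
  "Ob (snd_of_3 C P a d) x = Ob P (a, x, d)"
  "Ob (thd_of_3 C P a b) x = Ob P (a, b, x)"
  "Ob (fst_of_4 C T b c d) x = Ob T (x, b, c, d)"
  "Ob (snd_of_4 C T a c d) x = Ob T (a, x, c, d)"
  "Ob (thd_of_4 C T a b d) x = Ob T (a, b, x, d)"
  "Ob (fth_of_4 C T a b c) x = Ob T (a, b, c, x)"
  "Ob (F \<otimes> G) (x, y) = Ob F x \<times> Ob G y"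
  by (simp_all add: snd_of_2_def fst_of_3_def snd_of_3_def thd_of_3_def fst_of_4_def snd_of_4_def
      thd_of_4_def fth_of_4_def precomp_def ext_prod_def)

lemma comp_Ob_simps:
  "Ob (left_comp C P) (a, b, c, d) = coend C (thd_of_3 C P a b \<otimes> fst_of_3 C P c d)"
  "Ob (right_comp C P) (a, b, c, d) = coend C (thd_of_3 C P b c \<otimes> snd_of_3 C P a d)"
  "Ob (left_unit C P J) (b, d) = coend C (J \<otimes> fst_of_3 C P b d)"
  "Ob (right_unit C P J) (a, d) = coend C (J \<otimes> snd_of_3 C P a d)"
  by (simp_all add: left_comp_def right_comp_def left_unit_def right_unit_def coend_functor_def
      at_param_simps)

lemma comp_class_simps:
  "left_comp_class C P (a, b, c, d) = coend_class C (thd_of_3 C P a b \<otimes> fst_of_3 C P c d)"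
  "right_comp_class C P (a, b, c, d) = coend_class C (thd_of_3 C P b c \<otimes> snd_of_3 C P a d)"
  "left_unit_class C P J (b, d) = coend_class C (J \<otimes> fst_of_3 C P b d)"
  "right_unit_class C P J (a, d) = coend_class C (J \<otimes> snd_of_3 C P a d)"
  by (simp_all add: left_comp_class_def right_comp_class_def left_unit_class_def
      right_unit_class_def at_param_simps)

lemma comp_Ar_simps:
  "Ar (left_comp C P) (a, b, c, d) (a', b', c', d') (f, g, k, h) =
    coend_map C (thd_of_3 C P a' b' \<otimes> fst_of_3 C P c' d')
      (\<lambda>x. map_prod (Ar P (a, b, x) (a', b', x) (f, g, Ident C x))
        (Ar P (x, c, d) (x, c', d') (Ident C x, k, h)))"
  "Ar (right_comp C P) (a, b, c, d) (a', b', c', d') (f, g, k, h) =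
    coend_map C (thd_of_3 C P b' c' \<otimes> snd_of_3 C P a' d')
      (\<lambda>x. map_prod (Ar P (b, c, x) (b', c', x) (g, k, Ident C x))
        (Ar P (a, x, d) (a', x, d') (f, Ident C x, h)))"
  "Ar (left_unit C P J) (b, d) (b', d') (f, h) =
    coend_map C (J \<otimes> fst_of_3 C P b' d')
      (\<lambda>x. map_prod (Ar J x x (Ident C x)) (Ar P (x, b, d) (x, b', d') (Ident C x, f, h)))"
  "Ar (right_unit C P J) (a, d) (a', d') (f, h) =
    coend_map C (J \<otimes> snd_of_3 C P a' d')
      (\<lambda>x. map_prod (Ar J x x (Ident C x)) (Ar P (a, x, d) (a', x, d') (f, Ident C x, h)))"
  by (simp_all add: left_comp_def right_comp_def left_unit_def right_unit_def coend_functor_def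
      at_param_simps)
    (simp_all add: left_integrand_def right_integrand_def left_unit_integrand_def
      right_unit_integrand_def precomp_def ext_prod_def)

text \<open>Singleton values of J are expressed as representation by the empty tuple, so that coends
  involving the unit are instances of the same co-Yoneda lemma as those involving P alone.\<close>

locale product_kernel = pair_rep C P \<kappa> + J: set_functor "op_cat C" J
  for C :: "('o, 'm) cat" and P :: "('o \<times> 'o \<times> 'o, 'm \<times> 'm \<times> 'm, 'p) setfun" and \<kappa>
    and J :: "('o, 'm, 'j) setfun" +
  assumes unit_iso: "natural_iso (op_cat C) J (precomp_tuples C []) (\<lambda>_ _. [])"
begin

text \<open>If p has coordinates [s, t] and q has [u, v], the value is [s u, t u, v]. For
  \<open>right_nf\<close>, with [s, t] for q and [u, v] for p, it is [u, s v, t v].\<close>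

definition left_nf where
  "left_nf = (\<lambda>(a, b, c, d) x (p, q). plug C d x 0 [a, b] (\<kappa> (a, b, x) p) (\<kappa> (x, c, d) q))"

definition right_nf where
  "right_nf = (\<lambda>(a, b, c, d) x (q, p). plug C d x 1 [b, c] (\<kappa> (b, c, x) q) (\<kappa> (a, x, d) p))"

text \<open>Substituting the empty tuple deletes the entry that lands in x, so a single morphism d
  -> b remains.\<close>

definition left_unit_nf :: "'o \<times> 'o \<Rightarrow> 'o \<Rightarrow> 'j \<times> 'p \<Rightarrow> 'm list" where
  "left_unit_nf = (\<lambda>(b, d) x (j, p). plug C d x 0 [] [] (\<kappa> (x, b, d) p))"

definition right_unit_nf :: "'o \<times> 'o \<Rightarrow> 'o \<Rightarrow> 'j \<times> 'p \<Rightarrow> 'm list" where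
  "right_unit_nf = (\<lambda>(a, d) x (j, p). plug C d x 1 [] [] (\<kappa> (a, x, d) p))"

lemma left_nf_apply:
    "left_nf (a, b, c, d) x (p, q) = plug C d x 0 [a, b] (\<kappa> (a, b, x) p) (\<kappa> (x, c, d) q)"
  and right_nf_apply:
    "right_nf (a, b, c, d) x (q, p) = plug C d x 1 [b, c] (\<kappa> (b, c, x) q) (\<kappa> (a, x, d) p)"
  by (simp_all add: left_nf_def right_nf_def)

abbreviation "left_coord abcd \<equiv> coend_desc (left_nf abcd)"
abbreviation "right_coord abcd \<equiv> coend_desc (right_nf abcd)"
abbreviation "left_unit_coord bd \<equiv> coend_desc (left_unit_nf bd)"
abbreviation "right_unit_coord ad \<equiv> coend_desc (right_unit_nf ad)"

lemma coend_nf_left: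
  assumes "a \<in> Obj C" "b \<in> Obj C" "c \<in> Obj C" "d \<in> Obj C"
  shows "coend_nf C (thd_of_3 C P a b \<otimes> fst_of_3 C P c d) (left_nf (a, b, c, d)) (homs C d [a, b, c])"
  using coend_nf_coyoneda[OF set_functor_thd_of_3 natural_iso_thd_of_3 set_functor_fst_of_3
      natural_iso_fst_of_3, of a b c d] assms
  by (simp add: left_nf_def)

lemma coend_nf_right:
  assumes "a \<in> Obj C" "b \<in> Obj C" "c \<in> Obj C" "d \<in> Obj C"
  shows "coend_nf C (thd_of_3 C P b c \<otimes> snd_of_3 C P a d) (right_nf (a, b, c, d)) (homs C d [a, b, c])"
  using coend_nf_coyoneda[OF set_functor_thd_of_3 natural_iso_thd_of_3 set_functor_snd_of_3
      natural_iso_snd_of_3, of b c a d] assms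
  by (simp add: right_nf_def)

lemma coend_nf_left_unit:
  assumes "b \<in> Obj C" "d \<in> Obj C"
  shows "coend_nf C (J \<otimes> fst_of_3 C P b d) (left_unit_nf (b, d)) (homs C d [b])"
  using coend_nf_coyoneda[OF J.set_functor_axioms unit_iso set_functor_fst_of_3
      natural_iso_fst_of_3, of b d] assms
  by (simp add: left_unit_nf_def)

lemma coend_nf_right_unit:
  assumes "a \<in> Obj C" "d \<in> Obj C"
  shows "coend_nf C (J \<otimes> snd_of_3 C P a d) (right_unit_nf (a, d)) (homs C d [a])"
  using coend_nf_coyoneda[OF J.set_functor_axioms unit_iso set_functor_snd_of_3
      natural_iso_snd_of_3, of a d] assms
  by (simp add: right_unit_nf_def)

text \<open>Typing and naturality are proved together because \<open>coend_map_coordinates\<close>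
  delivers both; the typing half is what \<open>set_functor_transport\<close> asks for. Here K is
  the action of the model functor.\<close>

lemma left_comp_Ar:
  assumes "a \<in> Obj C" "b \<in> Obj C" "c \<in> Obj C" "d \<in> Obj C"
    "a' \<in> Obj C" "b' \<in> Obj C" "c' \<in> Obj C" "d' \<in> Obj C"
    "f \<in> Hom C a a'" "g \<in> Hom C b b'" "k \<in> Hom C c c'" "h \<in> Hom C d' d"
    "X \<in> Ob (left_comp C P) (a, b, c, d)"
  shows "Ar (left_comp C P) (a, b, c, d) (a', b', c', d') (f, g, k, h) X
      \<in> Ob (left_comp C P) (a', b', c', d')
    \<and> left_coord (a', b', c', d') (Ar (left_comp C P) (a, b, c, d) (a', b', c', d') (f, g, k, h) X)
      = Ar (hom_triples C) (a, b, c, d) (a', b', c', d') (f, g, k, h) (left_coord (a, b, c, d) X)"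
  unfolding comp_Ob_simps comp_Ar_simps
proof (rule coend_map_coordinates[OF coend_nf_left _ coend_nf_left])
  fix x e assume x: "x \<in> Obj C" and "e \<in> Ob (thd_of_3 C P a b \<otimes> fst_of_3 C P c d) (x, x)"
  then obtain p q where e: "e = (p, q)" "p \<in> Ob P (a, b, x)" "q \<in> Ob P (x, c, d)"
    by auto
  obtain s t where "\<kappa> (a, b, x) p = [s, t]" "s \<in> Hom C x a" "t \<in> Hom C x b"
    by (rule rep[of a b x p]) (use assms x e in auto)
  moreover obtain u v where "\<kappa> (x, c, d) q = [u, v]" "u \<in> Hom C d x" "v \<in> Hom C d c"
    by (rule rep[of x c d q]) (use assms x e in auto)
  ultimately show "map_prod (Ar P (a, b, x) (a', b', x) (f, g, Ident C x))
        (Ar P (x, c, d) (x, c', d') (Ident C x, k, h)) e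
      \<in> Ob (thd_of_3 C P a' b' \<otimes> fst_of_3 C P c' d') (x, x) \<and>
    left_nf (a', b', c', d') x (map_prod (Ar P (a, b, x) (a', b', x) (f, g, Ident C x))
        (Ar P (x, c, d) (x, c', d') (Ident C x, k, h)) e) =
    Ar (hom_triples C) (a, b, c, d) (a', b', c', d') (f, g, k, h) (left_nf (a, b, c, d) x e)"
    using assms x e
    by (simp add: left_nf_def plug_def rep_natural Ar_P_in hom_triples_def act_def cat_rules)
qed (use assms in \<open>simp_all add: comp_Ob_simps\<close>)

lemma right_comp_Ar:
  assumes "a \<in> Obj C" "b \<in> Obj C" "c \<in> Obj C" "d \<in> Obj C"
    "a' \<in> Obj C" "b' \<in> Obj C" "c' \<in> Obj C" "d' \<in> Obj C"
    "f \<in> Hom C a a'" "g \<in> Hom C b b'" "k \<in> Hom C c c'" "h \<in> Hom C d' d"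
    "X \<in> Ob (right_comp C P) (a, b, c, d)"
  shows "Ar (right_comp C P) (a, b, c, d) (a', b', c', d') (f, g, k, h) X
      \<in> Ob (right_comp C P) (a', b', c', d')
    \<and> right_coord (a', b', c', d') (Ar (right_comp C P) (a, b, c, d) (a', b', c', d') (f, g, k, h) X)
      = Ar (hom_triples C) (a, b, c, d) (a', b', c', d') (f, g, k, h) (right_coord (a, b, c, d) X)"
  unfolding comp_Ob_simps comp_Ar_simps
proof (rule coend_map_coordinates[OF coend_nf_right _ coend_nf_right])
  fix x e assume x: "x \<in> Obj C" and "e \<in> Ob (thd_of_3 C P b c \<otimes> snd_of_3 C P a d) (x, x)"
  then obtain q p where e: "e = (q, p)" "q \<in> Ob P (b, c, x)" "p \<in> Ob P (a, x, d)"
    by auto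
  obtain s t where "\<kappa> (b, c, x) q = [s, t]" "s \<in> Hom C x b" "t \<in> Hom C x c"
    by (rule rep[of b c x q]) (use assms x e in auto)
  moreover obtain u v where "\<kappa> (a, x, d) p = [u, v]" "u \<in> Hom C d a" "v \<in> Hom C d x"
    by (rule rep[of a x d p]) (use assms x e in auto)
  ultimately show "map_prod (Ar P (b, c, x) (b', c', x) (g, k, Ident C x))
        (Ar P (a, x, d) (a', x, d') (f, Ident C x, h)) e
      \<in> Ob (thd_of_3 C P b' c' \<otimes> snd_of_3 C P a' d') (x, x) \<and>
    right_nf (a', b', c', d') x (map_prod (Ar P (b, c, x) (b', c', x) (g, k, Ident C x))
        (Ar P (a, x, d) (a', x, d') (f, Ident C x, h)) e) =
    Ar (hom_triples C) (a, b, c, d) (a', b', c', d') (f, g, k, h) (right_nf (a, b, c, d) x e)"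
    using assms x e
    by (simp add: right_nf_def plug_def rep_natural Ar_P_in hom_triples_def act_def cat_rules)
qed (use assms in \<open>simp_all add: comp_Ob_simps\<close>)

lemma Ar_J_in: "x \<in> Obj C \<Longrightarrow> j \<in> Ob J x \<Longrightarrow> Ar J x x (Ident C x) j \<in> Ob J x"
  using J.Ar_in[of x x "Ident C x" j] by (simp add: op_cat_def cat_rules)

lemma left_unit_Ar:
  assumes "b \<in> Obj C" "d \<in> Obj C" "b' \<in> Obj C" "d' \<in> Obj C" "f \<in> Hom C b b'" "h \<in> Hom C d' d"
    "X \<in> Ob (left_unit C P J) (b, d)"
  shows "Ar (left_unit C P J) (b, d) (b', d') (f, h) X \<in> Ob (left_unit C P J) (b', d')
    \<and> left_unit_coord (b', d') (Ar (left_unit C P J) (b, d) (b', d') (f, h) X)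
      = Ar (hom_singles C) (b, d) (b', d') (f, h) (left_unit_coord (b, d) X)"
  unfolding comp_Ob_simps comp_Ar_simps
proof (rule coend_map_coordinates[OF coend_nf_left_unit _ coend_nf_left_unit])
  fix x e assume x: "x \<in> Obj C" and "e \<in> Ob (J \<otimes> fst_of_3 C P b d) (x, x)"
  then obtain j p where e: "e = (j, p)" "j \<in> Ob J x" "p \<in> Ob P (x, b, d)"
    by auto
  obtain s t where "\<kappa> (x, b, d) p = [s, t]" "s \<in> Hom C d x" "t \<in> Hom C d b"
    by (rule rep[of x b d p]) (use assms x e in auto)
  then show "map_prod (Ar J x x (Ident C x)) (Ar P (x, b, d) (x, b', d') (Ident C x, f, h)) e
      \<in> Ob (J \<otimes> fst_of_3 C P b' d') (x, x) \<and>
    left_unit_nf (b', d') x (map_prod (Ar J x x (Ident C x))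
        (Ar P (x, b, d) (x, b', d') (Ident C x, f, h)) e) =
    Ar (hom_singles C) (b, d) (b', d') (f, h) (left_unit_nf (b, d) x e)"
    using assms x e
    by (simp add: left_unit_nf_def plug_def rep_natural Ar_P_in Ar_J_in hom_singles_def act_def cat_rules)
qed (use assms in \<open>simp_all add: comp_Ob_simps\<close>)

lemma right_unit_Ar:
  assumes "a \<in> Obj C" "d \<in> Obj C" "a' \<in> Obj C" "d' \<in> Obj C" "f \<in> Hom C a a'" "h \<in> Hom C d' d"
    "X \<in> Ob (right_unit C P J) (a, d)"
  shows "Ar (right_unit C P J) (a, d) (a', d') (f, h) X \<in> Ob (right_unit C P J) (a', d')
    \<and> right_unit_coord (a', d') (Ar (right_unit C P J) (a, d) (a', d') (f, h) X)
      = Ar (hom_singles C) (a, d) (a', d') (f, h) (right_unit_coord (a, d) X)"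
  unfolding comp_Ob_simps comp_Ar_simps
proof (rule coend_map_coordinates[OF coend_nf_right_unit _ coend_nf_right_unit])
  fix x e assume x: "x \<in> Obj C" and "e \<in> Ob (J \<otimes> snd_of_3 C P a d) (x, x)"
  then obtain j p where e: "e = (j, p)" "j \<in> Ob J x" "p \<in> Ob P (a, x, d)"
    by auto
  obtain s t where "\<kappa> (a, x, d) p = [s, t]" "s \<in> Hom C d a" "t \<in> Hom C d x"
    by (rule rep[of a x d p]) (use assms x e in auto)
  then show "map_prod (Ar J x x (Ident C x)) (Ar P (a, x, d) (a', x, d') (f, Ident C x, h)) e
      \<in> Ob (J \<otimes> snd_of_3 C P a' d') (x, x) \<and>
    right_unit_nf (a', d') x (map_prod (Ar J x x (Ident C x))
        (Ar P (a, x, d) (a', x, d') (f, Ident C x, h)) e) =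
    Ar (hom_singles C) (a, d) (a', d') (f, h) (right_unit_nf (a, d) x e)"
    using assms x e
    by (simp add: right_unit_nf_def plug_def rep_natural Ar_P_in Ar_J_in hom_singles_def act_def cat_rules)
qed (use assms in \<open>simp_all add: comp_Ob_simps\<close>)

section \<open>The composites and unit coends as represented functors\<close>

lemma natural_iso_left: "natural_iso (assoc_cat C) (left_comp C P) (hom_triples C) left_coord"
proof (rule natural_isoI)
  fix x assume "x \<in> Obj (assoc_cat C)"
  then show "bij_betw (left_coord x) (Ob (left_comp C P) x) (Ob (hom_triples C) x)"
    by (auto simp: prod_op_simps comp_Ob_simps hom_triples_def
        intro!: bij_betw_coend_desc_nf coend_nf_left)
qed (auto simp: prod_op_simps left_comp_Ar)

lemma natural_iso_right: "natural_iso (assoc_cat C) (right_comp C P) (hom_triples C) right_coord"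
proof (rule natural_isoI)
  fix x assume "x \<in> Obj (assoc_cat C)"
  then show "bij_betw (right_coord x) (Ob (right_comp C P) x) (Ob (hom_triples C) x)"
    by (auto simp: prod_op_simps comp_Ob_simps hom_triples_def
        intro!: bij_betw_coend_desc_nf coend_nf_right)
qed (auto simp: prod_op_simps right_comp_Ar)

lemma natural_iso_left_unit: "natural_iso (unit_cat C) (left_unit C P J) (hom_singles C) left_unit_coord"
proof (rule natural_isoI)
  fix x assume "x \<in> Obj (unit_cat C)"
  then show "bij_betw (left_unit_coord x) (Ob (left_unit C P J) x) (Ob (hom_singles C) x)"
    by (auto simp: prod_op_simps comp_Ob_simps hom_singles_def
        intro!: bij_betw_coend_desc_nf coend_nf_left_unit)
qed (auto simp: prod_op_simps left_unit_Ar)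

lemma natural_iso_right_unit: "natural_iso (unit_cat C) (right_unit C P J) (hom_singles C) right_unit_coord"
proof (rule natural_isoI)
  fix x assume "x \<in> Obj (unit_cat C)"
  then show "bij_betw (right_unit_coord x) (Ob (right_unit C P J) x) (Ob (hom_singles C) x)"
    by (auto simp: prod_op_simps comp_Ob_simps hom_singles_def
        intro!: bij_betw_coend_desc_nf coend_nf_right_unit)
qed (auto simp: prod_op_simps right_unit_Ar)

text \<open>Composites are themselves represented by tuples and can therefore be factors of a
  further coend; this is what makes iterated coends accessible.\<close>

lemma triple_rep_left: "triple_rep C (left_comp C P) left_coord"
proof -
  have "set_functor (assoc_cat C) (left_comp C P)"
    by (rule set_functor_transport[OF set_functor_hom_triples natural_iso_left])
      (auto simp: prod_op_simps left_comp_Ar)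
  then show ?thesis
    by (intro triple_rep.intro triple_rep_axioms.intro small_category_axioms natural_iso_left)
qed

lemma triple_rep_right: "triple_rep C (right_comp C P) right_coord"
proof -
  have "set_functor (assoc_cat C) (right_comp C P)"
    by (rule set_functor_transport[OF set_functor_hom_triples natural_iso_right])
      (auto simp: prod_op_simps right_comp_Ar)
  then show ?thesis
    by (intro triple_rep.intro triple_rep_axioms.intro small_category_axioms natural_iso_right)
qed

lemma single_rep_left_unit: "single_rep C (left_unit C P J) left_unit_coord"
proof -
  have "set_functor (unit_cat C) (left_unit C P J)"
    by (rule set_functor_transport[OF set_functor_hom_singles natural_iso_left_unit])
      (auto simp: prod_op_simps left_unit_Ar)
  then show ?thesis
    by (intro single_rep.intro single_rep_axioms.intro small_category_axioms natural_iso_left_unit)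
qed

lemma single_rep_right_unit: "single_rep C (right_unit C P J) right_unit_coord"
proof -
  have "set_functor (unit_cat C) (right_unit C P J)"
    by (rule set_functor_transport[OF set_functor_hom_singles natural_iso_right_unit])
      (auto simp: prod_op_simps right_unit_Ar)
  then show ?thesis
    by (intro single_rep.intro single_rep_axioms.intro small_category_axioms natural_iso_right_unit)
qed

end

context small_category
begin

lemma natural_iso_hom_profunctor:
  "natural_iso (unit_cat C) (hom_profunctor C) (hom_singles C) (\<lambda>_ f. [f])"
proof (rule natural_isoI)
  fix x assume "x \<in> Obj (unit_cat C)"
  then show "bij_betw (\<lambda>f. [f]) (Ob (hom_profunctor C) x) (Ob (hom_singles C) x)"
    by (auto simp: prod_op_simps hom_profunctor_def hom_functor_def precomp_def hom_singles_def
        bij_betw_def in_homs_Cons inj_on_def image_iff split: prod.splits)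
qed (auto simp: prod_op_simps hom_profunctor_def hom_functor_def precomp_def hom_singles_def act_def)

lemma single_rep_hom_profunctor: "single_rep C (hom_profunctor C) (\<lambda>_ f. [f])"
proof -
  have "set_functor (unit_cat C) (hom_profunctor C)"
    by (rule set_functor_transport[OF set_functor_hom_singles natural_iso_hom_profunctor])
      (auto simp: prod_op_simps hom_profunctor_def hom_functor_def precomp_def cat_rules)
  then show ?thesis
    by (intro single_rep.intro single_rep_axioms.intro small_category_axioms natural_iso_hom_profunctor)
qed

end

context product_kernel
begin

subsection \<open>Normal forms of iterated coends\<close>

text \<open>This lemma and the four after it cover the vertices of the pentagon, with T being
  \<open>left_comp\<close> or \<open>right_comp\<close>. The number in \<open>plug\<close> is the
  position of the bound variable among the targets of the covariant factor; the set of normal forms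
  is the same at every vertex.\<close>

lemma coend_nf_fth_fst:
  assumes T: "triple_rep C T \<tau>"
    and obj: "a \<in> Obj C" "b \<in> Obj C" "c \<in> Obj C" "d \<in> Obj C" "e \<in> Obj C"
  shows "coend_nf C (fth_of_4 C T a b c \<otimes> fst_of_3 C P d e)
    (\<lambda>x (t, p). plug C e x 0 [a, b, c] (\<tau> (a, b, c, x) t) (\<kappa> (x, d, e) p)) (homs C e [a, b, c, d])"
  using coend_nf_coyoneda[OF triple_rep.set_functor_fth_of_4[OF T] triple_rep.natural_iso_fth_of_4[OF T]
      set_functor_fst_of_3 natural_iso_fst_of_3, of a b c d e] obj
  by simp

lemma coend_nf_fth_snd:
  assumes T: "triple_rep C T \<tau>"
    and obj: "a \<in> Obj C" "b \<in> Obj C" "c \<in> Obj C" "d \<in> Obj C" "e \<in> Obj C"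
  shows "coend_nf C (fth_of_4 C T b c d \<otimes> snd_of_3 C P a e)
    (\<lambda>x (t, p). plug C e x 1 [b, c, d] (\<tau> (b, c, d, x) t) (\<kappa> (a, x, e) p)) (homs C e [a, b, c, d])"
  using coend_nf_coyoneda[OF triple_rep.set_functor_fth_of_4[OF T] triple_rep.natural_iso_fth_of_4[OF T]
      set_functor_snd_of_3 natural_iso_snd_of_3, of b c d a e] obj
  by simp

lemma coend_nf_thd_fst:
  assumes T: "triple_rep C T \<tau>"
    and obj: "a \<in> Obj C" "b \<in> Obj C" "c \<in> Obj C" "d \<in> Obj C" "e \<in> Obj C"
  shows "coend_nf C (thd_of_3 C P a b \<otimes> fst_of_4 C T c d e)
    (\<lambda>x (p, t). plug C e x 0 [a, b] (\<kappa> (a, b, x) p) (\<tau> (x, c, d, e) t)) (homs C e [a, b, c, d])"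
  using coend_nf_coyoneda[OF set_functor_thd_of_3 natural_iso_thd_of_3
      triple_rep.set_functor_fst_of_4[OF T] triple_rep.natural_iso_fst_of_4[OF T], of a b c d e] obj
  by simp

lemma coend_nf_thd_snd:
  assumes T: "triple_rep C T \<tau>"
    and obj: "a \<in> Obj C" "b \<in> Obj C" "c \<in> Obj C" "d \<in> Obj C" "e \<in> Obj C"
  shows "coend_nf C (thd_of_3 C P b c \<otimes> snd_of_4 C T a d e)
    (\<lambda>x (p, t). plug C e x 1 [b, c] (\<kappa> (b, c, x) p) (\<tau> (a, x, d, e) t)) (homs C e [a, b, c, d])"
  using coend_nf_coyoneda[OF set_functor_thd_of_3 natural_iso_thd_of_3
      triple_rep.set_functor_snd_of_4[OF T] triple_rep.natural_iso_snd_of_4[OF T], of b c a d e] obj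
  by simp

lemma coend_nf_thd_thd:
  assumes T: "triple_rep C T \<tau>"
    and obj: "a \<in> Obj C" "b \<in> Obj C" "c \<in> Obj C" "d \<in> Obj C" "e \<in> Obj C"
  shows "coend_nf C (thd_of_3 C P c d \<otimes> thd_of_4 C T a b e)
    (\<lambda>x (p, t). plug C e x 2 [c, d] (\<kappa> (c, d, x) p) (\<tau> (a, b, x, e) t)) (homs C e [a, b, c, d])"
  using coend_nf_coyoneda[OF set_functor_thd_of_3 natural_iso_thd_of_3
      triple_rep.set_functor_thd_of_4[OF T] triple_rep.natural_iso_thd_of_4[OF T], of c d a b e] obj
  \<comment> \<open>The co-Yoneda lemma produces the index as the length of [a, b], which simplifies
    to a successor term.\<close>
  by (simp add: numeral_2_eq_2)

text \<open>The source of the triangle: the empty tuple deletes the middle one of three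
  entries.\<close>

lemma coend_nf_unit_snd:
  assumes T: "triple_rep C T \<tau>" and obj: "a \<in> Obj C" "b \<in> Obj C" "d \<in> Obj C"
  shows "coend_nf C (J \<otimes> snd_of_4 C T a b d)
    (\<lambda>x (j, t). plug C d x 1 [] [] (\<tau> (a, x, b, d) t)) (homs C d [a, b])"
  using coend_nf_coyoneda[OF J.set_functor_axioms unit_iso
      triple_rep.set_functor_snd_of_4[OF T] triple_rep.natural_iso_snd_of_4[OF T], of a b d] obj
  by simp

lemma coend_nf_single_fst:
  assumes U: "single_rep C U \<upsilon>" and obj: "a \<in> Obj C" "b \<in> Obj C" "d \<in> Obj C"
  shows "coend_nf C (snd_of_2 C U a \<otimes> fst_of_3 C P b d)
    (\<lambda>x (u, p). plug C d x 0 [a] (\<upsilon> (a, x) u) (\<kappa> (x, b, d) p)) (homs C d [a, b])"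
  using coend_nf_coyoneda[OF single_rep.set_functor_snd_of_2[OF U]
      single_rep.natural_iso_snd_of_2[OF U] set_functor_fst_of_3 natural_iso_fst_of_3, of a b d] obj
  by simp

lemma coend_nf_single_snd:
  assumes U: "single_rep C U \<upsilon>" and obj: "a \<in> Obj C" "b \<in> Obj C" "d \<in> Obj C"
  shows "coend_nf C (snd_of_2 C U b \<otimes> snd_of_3 C P a d)
    (\<lambda>x (u, p). plug C d x 1 [b] (\<upsilon> (b, x) u) (\<kappa> (a, x, d) p)) (homs C d [a, b])"
  using coend_nf_coyoneda[OF single_rep.set_functor_snd_of_2[OF U]
      single_rep.natural_iso_snd_of_2[OF U] set_functor_snd_of_3 natural_iso_snd_of_3, of b a d] obj
  by simp

lemma left_class:
  assumes "a \<in> Obj C" "b \<in> Obj C" "c \<in> Obj C" "d \<in> Obj C" "x \<in> Obj C"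
    "p \<in> Ob P (a, b, x)" "q \<in> Ob P (x, c, d)"
  shows "left_comp_class C P (a, b, c, d) x (p, q) \<in> Ob (left_comp C P) (a, b, c, d)"
    and "left_coord (a, b, c, d) (left_comp_class C P (a, b, c, d) x (p, q)) =
      plug C d x 0 [a, b] (\<kappa> (a, b, x) p) (\<kappa> (x, c, d) q)"
  using coend_class_coordinates[OF coend_nf_left, of a b c d x "(p, q)"] assms
  by (simp_all add: comp_Ob_simps comp_class_simps left_nf_def)

lemma right_class:
  assumes "a \<in> Obj C" "b \<in> Obj C" "c \<in> Obj C" "d \<in> Obj C" "x \<in> Obj C"
    "q \<in> Ob P (b, c, x)" "p \<in> Ob P (a, x, d)"
  shows "right_comp_class C P (a, b, c, d) x (q, p) \<in> Ob (right_comp C P) (a, b, c, d)"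
    and "right_coord (a, b, c, d) (right_comp_class C P (a, b, c, d) x (q, p)) =
      plug C d x 1 [b, c] (\<kappa> (b, c, x) q) (\<kappa> (a, x, d) p)"
  using coend_class_coordinates[OF coend_nf_right, of a b c d x "(q, p)"] assms
  by (simp_all add: comp_Ob_simps comp_class_simps right_nf_def)

lemma left_unit_class:
  assumes "b \<in> Obj C" "d \<in> Obj C" "x \<in> Obj C" "j \<in> Ob J x" "p \<in> Ob P (x, b, d)"
  shows "left_unit_class C P J (b, d) x (j, p) \<in> Ob (left_unit C P J) (b, d)"
    and "left_unit_coord (b, d) (left_unit_class C P J (b, d) x (j, p)) =
      plug C d x 0 [] [] (\<kappa> (x, b, d) p)"
  using coend_class_coordinates[OF coend_nf_left_unit, of b d x "(j, p)"] assms
  by (simp_all add: comp_Ob_simps comp_class_simps left_unit_nf_def)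

lemma right_unit_class:
  assumes "a \<in> Obj C" "d \<in> Obj C" "x \<in> Obj C" "j \<in> Ob J x" "p \<in> Ob P (a, x, d)"
  shows "right_unit_class C P J (a, d) x (j, p) \<in> Ob (right_unit C P J) (a, d)"
    and "right_unit_coord (a, d) (right_unit_class C P J (a, d) x (j, p)) =
      plug C d x 1 [] [] (\<kappa> (a, x, d) p)"
  using coend_class_coordinates[OF coend_nf_right_unit, of a d x "(j, p)"] assms
  by (simp_all add: comp_Ob_simps comp_class_simps right_unit_nf_def)

subsection \<open>The structure maps\<close>

text \<open>The unique map between the two composites that is the identity in coordinates. The
  unitors below follow the same recipe, the inverse of the singleton list map extracting the
  morphism.\<close>

definition associator where
  "associator abcd X = inv_into (Ob (right_comp C P) abcd) (right_coord abcd) (left_coord abcd X)"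

definition left_unitor where
  "left_unitor bd X = inv_into (Ob (hom_profunctor C) bd) (\<lambda>f. [f]) (left_unit_coord bd X)"

definition right_unitor where
  "right_unitor ad X = inv_into (Ob (hom_profunctor C) ad) (\<lambda>f. [f]) (right_unit_coord ad X)"

text \<open>The reversal sits on the target side, so that P and the swapped kernel are both compared
  with \<open>hom_pairs C\<close> at (a, b, d) and \<open>natural_iso_inv_into\<close> yields
  naturality.\<close>

definition symmetry where
  "symmetry = (\<lambda>(a, b, d) p. inv_into (Ob P (b, a, d)) (\<lambda>q. rev (\<kappa> (b, a, d) q)) (\<kappa> (a, b, d) p))"

lemma natural_iso_associator:
  "natural_iso (assoc_cat C) (left_comp C P) (right_comp C P) associator"
  unfolding associator_def[abs_def]
  using triple_rep_right
  by (intro natural_iso_inv_into[OF natural_iso_left natural_iso_right]) (simp add: triple_rep_def)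

lemma natural_iso_left_unitor:
  "natural_iso (unit_cat C) (left_unit C P J) (hom_profunctor C) left_unitor"
  unfolding left_unitor_def[abs_def]
  using single_rep_hom_profunctor
  by (intro natural_iso_inv_into[OF natural_iso_left_unit natural_iso_hom_profunctor])
    (simp add: single_rep_def)

lemma natural_iso_right_unitor:
  "natural_iso (unit_cat C) (right_unit C P J) (hom_profunctor C) right_unitor"
  unfolding right_unitor_def[abs_def]
  using single_rep_hom_profunctor
  by (intro natural_iso_inv_into[OF natural_iso_right_unit natural_iso_hom_profunctor])
    (simp add: single_rep_def)

lemma natural_iso_symmetry:
  "natural_iso (kernel_cat C) P (precomp P (\<lambda>(a, b, d). (b, a, d)) (\<lambda>(f, g, h). (g, f, h))) symmetry"
proof -
  let ?G = "precomp P (\<lambda>(a, b, d). (b, a, d)) (\<lambda>(f, g, h). (g, f, h))"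
  let ?\<theta> = "\<lambda>(a, b, d) q. rev (\<kappa> (b, a, d) q)"
  have G: "set_functor (kernel_cat C) ?G"
    by (rule set_functor_precomp[OF P.set_functor_axioms small_category_kernel_cat])
      (auto simp: prod_op_simps)
  have "natural_iso (kernel_cat C) ?G (hom_pairs C) ?\<theta>"
  proof (rule natural_isoI)
    fix x assume "x \<in> Obj (kernel_cat C)"
    then obtain a b d where x: "x = (a, b, d)" "a \<in> Obj C" "b \<in> Obj C" "d \<in> Obj C"
      by (auto simp: prod_op_simps)
    have "bij_betw rev (homs C d [b, a]) (homs C d [a, b])"
      by (rule bij_betw_byWitness[of _ rev]) (auto simp: in_homs_Cons)
    then show "bij_betw (?\<theta> x) (Ob ?G x) (Ob (hom_pairs C) x)"
      using bij_betw_trans[OF rep_bij[of b a d]] x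
      by (simp add: precomp_def hom_pairs_def comp_def)
    fix y f e assume "y \<in> Obj (kernel_cat C)" "f \<in> Hom (kernel_cat C) x y" "e \<in> Ob ?G x"
    then obtain a' b' d' s t h where y: "y = (a', b', d')" "a' \<in> Obj C" "b' \<in> Obj C" "d' \<in> Obj C"
      "f = (s, t, h)" "s \<in> Hom C a a'" "t \<in> Hom C b b'" "h \<in> Hom C d' d" "e \<in> Ob P (b, a, d)"
      by (auto simp: prod_op_simps x precomp_def)
    obtain u v where "\<kappa> (b, a, d) e = [u, v]"
      by (rule rep[of b a d e]) (use x y in auto)
    then show "?\<theta> y (Ar ?G x y f e) = Ar (hom_pairs C) x y f (?\<theta> x e)"
      using x y by (simp add: precomp_def hom_pairs_def rep_natural)
  qed
  then show ?thesis
    using natural_iso_inv_into[OF iso _ G, of ?\<theta>]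
    by (simp add: symmetry_def precomp_def split_def)
qed

lemma symmetry_rep:
  assumes "a \<in> Obj C" "b \<in> Obj C" "d \<in> Obj C" "p \<in> Ob P (a, b, d)"
  shows "symmetry (a, b, d) p \<in> Ob P (b, a, d)"
    and "\<kappa> (b, a, d) (symmetry (a, b, d) p) = rev (\<kappa> (a, b, d) p)"
proof -
  obtain f g where fg: "\<kappa> (a, b, d) p = [f, g]" "f \<in> Hom C d a" "g \<in> Hom C d b"
    using assms by (rule rep)
  then have "[g, f] \<in> \<kappa> (b, a, d) ` Ob P (b, a, d)"
    using bij_betw_imp_surj_on[OF rep_bij[of b a d]] assms by simp
  then obtain q where "q \<in> Ob P (b, a, d)" "\<kappa> (b, a, d) q = [g, f]"
    by (metis imageE)
  then have "\<kappa> (a, b, d) p \<in> (\<lambda>q. rev (\<kappa> (b, a, d) q)) ` Ob P (b, a, d)"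
    using fg by (intro image_eqI[of _ _ q]) auto
  from inv_into_into[OF this] f_inv_into_f[OF this]
  have "symmetry (a, b, d) p \<in> Ob P (b, a, d) \<and>
      rev (\<kappa> (b, a, d) (symmetry (a, b, d) p)) = \<kappa> (a, b, d) p"
    by (simp add: symmetry_def)
  then show "symmetry (a, b, d) p \<in> Ob P (b, a, d)"
    and "\<kappa> (b, a, d) (symmetry (a, b, d) p) = rev (\<kappa> (a, b, d) p)"
    by (auto simp: rev_swap)
qed

lemma associator_coord:
  assumes "a \<in> Obj C" "b \<in> Obj C" "c \<in> Obj C" "d \<in> Obj C" "X \<in> Ob (left_comp C P) (a, b, c, d)"
  shows "associator (a, b, c, d) X \<in> Ob (right_comp C P) (a, b, c, d)"
    and "right_coord (a, b, c, d) (associator (a, b, c, d) X) = left_coord (a, b, c, d) X"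
proof -
  \<comment> \<open>Both coordinates have range \<open>homs C d [a, b, c]\<close>.\<close>
  have "left_coord (a, b, c, d) X \<in> right_coord (a, b, c, d) ` Ob (right_comp C P) (a, b, c, d)"
    using bij_betw_imp_surj_on[OF triple_rep.rep_bij[OF triple_rep_left, of a b c d]]
      bij_betw_imp_surj_on[OF triple_rep.rep_bij[OF triple_rep_right, of a b c d]] assms by blast
  then show "associator (a, b, c, d) X \<in> Ob (right_comp C P) (a, b, c, d)"
    and "right_coord (a, b, c, d) (associator (a, b, c, d) X) = left_coord (a, b, c, d) X"
    unfolding associator_def by (simp_all add: inv_into_into f_inv_into_f)
qed

lemma left_unitor_coord:
  assumes "b \<in> Obj C" "d \<in> Obj C" "X \<in> Ob (left_unit C P J) (b, d)"
  shows "left_unitor (b, d) X \<in> Ob (hom_profunctor C) (b, d)"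
    and "[left_unitor (b, d) X] = left_unit_coord (b, d) X"
proof -
  have "left_unit_coord (b, d) X \<in> (\<lambda>f. [f]) ` Ob (hom_profunctor C) (b, d)"
    using bij_betw_imp_surj_on[OF single_rep.rep_bij[OF single_rep_left_unit, of b d]]
      bij_betw_imp_surj_on[OF single_rep.rep_bij[OF single_rep_hom_profunctor, of b d]] assms by blast
  from inv_into_into[OF this] f_inv_into_f[OF this]
  show "left_unitor (b, d) X \<in> Ob (hom_profunctor C) (b, d)"
    and "[left_unitor (b, d) X] = left_unit_coord (b, d) X"
    unfolding left_unitor_def by simp_all
qed

lemma right_unitor_coord:
  assumes "a \<in> Obj C" "d \<in> Obj C" "X \<in> Ob (right_unit C P J) (a, d)"
  shows "right_unitor (a, d) X \<in> Ob (hom_profunctor C) (a, d)"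
    and "[right_unitor (a, d) X] = right_unit_coord (a, d) X"
proof -
  have "right_unit_coord (a, d) X \<in> (\<lambda>f. [f]) ` Ob (hom_profunctor C) (a, d)"
    using bij_betw_imp_surj_on[OF single_rep.rep_bij[OF single_rep_right_unit, of a d]]
      bij_betw_imp_surj_on[OF single_rep.rep_bij[OF single_rep_hom_profunctor, of a d]] assms by blast
  from inv_into_into[OF this] f_inv_into_f[OF this]
  show "right_unitor (a, d) X \<in> Ob (hom_profunctor C) (a, d)"
    and "[right_unitor (a, d) X] = right_unit_coord (a, d) X"
    unfolding right_unitor_def by simp_all
qed

subsection \<open>Coherence\<close>

text \<open>Along the whole path the coordinate is one and the same quadruple of morphisms out of e:
  associators keep it by construction, Fubini maps by associativity of composition.\<close>

lemma pentagon_three_preserves: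
  assumes obj: "a \<in> Obj C" "b \<in> Obj C" "c \<in> Obj C" "d \<in> Obj C" "e \<in> Obj C"
  shows "preserves
    (coend_desc (\<lambda>y (t, p). plug C e y 0 [a, b, c] (left_coord (a, b, c, y) t) (\<kappa> (y, d, e) p)))
    (pentagon_source C P a b c d e)
    (coend_desc (\<lambda>z (t, p). plug C e z 1 [b, c, d] (right_coord (b, c, d, z) t) (\<kappa> (a, z, e) p)))
    (coend C (fth_of_4 C (right_comp C P) b c d \<otimes> snd_of_3 C P a e))
    (pentagon_three C P associator a b c d e)"
  unfolding pentagon_three_def pentagon_source_def
\<comment> \<open>The coordinates at the intermediate vertices are left schematic here; the
  statements shown below fix them, consecutive legs sharing a vertex.\<close>
proof (intro preserves_comp)
  note L = triple_rep_left and R = triple_rep_right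
  show "preserves
      (coend_desc (\<lambda>y (t, p). plug C e y 0 [a, b, c] (left_coord (a, b, c, y) t) (\<kappa> (y, d, e) p)))
      (coend C (fth_of_4 C (left_comp C P) a b c \<otimes> fst_of_3 C P d e))
      (coend_desc (\<lambda>y (t, p). plug C e y 0 [a, b, c] (right_coord (a, b, c, y) t) (\<kappa> (y, d, e) p)))
      (coend C (fth_of_4 C (right_comp C P) a b c \<otimes> fst_of_3 C P d e))
      (coend_map C (fth_of_4 C (right_comp C P) a b c \<otimes> fst_of_3 C P d e)
        (\<lambda>y (t, p). (associator (a, b, c, y) t, p)))"
    by (rule coend_map_preserves[OF coend_nf_fth_fst[OF L obj] coend_nf_fth_fst[OF R obj]])
      (use obj in \<open>auto simp: associator_coord\<close>)
  show "preserves
      (coend_desc (\<lambda>y (t, p). plug C e y 0 [a, b, c] (right_coord (a, b, c, y) t) (\<kappa> (y, d, e) p)))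
      (coend C (fth_of_4 C (right_comp C P) a b c \<otimes> fst_of_3 C P d e))
      (coend_desc (\<lambda>x (p, t). plug C e x 1 [b, c] (\<kappa> (b, c, x) p) (left_coord (a, x, d, e) t)))
      (coend C (thd_of_3 C P b c \<otimes> snd_of_4 C (left_comp C P) a d e))
      (fubini_right (coend_class C (thd_of_3 C P b c \<otimes> snd_of_4 C (left_comp C P) a d e))
        (\<lambda>x. left_comp_class C P (a, x, d, e)))"
  proof (rule fubini_right_preserves[OF coend_nf_fth_fst[OF R obj] coend_nf_thd_snd[OF L obj],
        where G = "\<lambda>y. thd_of_3 C P b c \<otimes> snd_of_3 C P a y" and nfG = "\<lambda>y. right_nf (a, b, c, y)"
          and TG = "\<lambda>y. homs C y [a, b, c]" and K = "\<lambda>y w l. plug C e y 0 [a, b, c] l (\<kappa> (y, d, e) w)"])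
    fix x y t w u v
    assume "x \<in> Obj C" "y \<in> Obj C"
      and "(t, w) \<in> Ob (fth_of_4 C (right_comp C P) a b c \<otimes> fst_of_3 C P d e) (y, y)"
      and "(u, v) \<in> Ob (thd_of_3 C P b c \<otimes> snd_of_3 C P a y) (x, x)"
    then have *: "x \<in> Obj C" "y \<in> Obj C" "w \<in> Ob P (y, d, e)" "u \<in> Ob P (b, c, x)" "v \<in> Ob P (a, x, y)"
      by auto
    obtain u1 u2 where "\<kappa> (b, c, x) u = [u1, u2]" "u1 \<in> Hom C x b" "u2 \<in> Hom C x c"
      by (rule rep[of b c x u]) (use obj * in auto)
    moreover obtain v1 v2 where "\<kappa> (a, x, y) v = [v1, v2]" "v1 \<in> Hom C y a" "v2 \<in> Hom C y x"
      by (rule rep[of a x y v]) (use obj * in auto)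
    moreover obtain w1 w2 where "\<kappa> (y, d, e) w = [w1, w2]" "w1 \<in> Hom C e y" "w2 \<in> Hom C e d"
      by (rule rep[of y d e w]) (use obj * in auto)
    \<comment> \<open>Up to bracketing both sides are [v1 w1, u1 v2 w1, u2 v2 w1, w2].\<close>
    ultimately show "(u, left_comp_class C P (a, x, d, e) y (v, w)) \<in>
          Ob (thd_of_3 C P b c \<otimes> snd_of_4 C (left_comp C P) a d e) (x, x) \<and>
        (\<lambda>(p, t). plug C e x 1 [b, c] (\<kappa> (b, c, x) p) (left_coord (a, x, d, e) t))
          (u, left_comp_class C P (a, x, d, e) y (v, w)) =
        plug C e y 0 [a, b, c] (right_nf (a, b, c, y) x (u, v)) (\<kappa> (y, d, e) w)"
      using obj * by (simp add: left_class right_nf_apply plug_def cat_rules)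
  qed (use obj in \<open>auto simp: comp_Ob_simps coend_nf_right\<close>)
  show "preserves
      (coend_desc (\<lambda>x (p, t). plug C e x 1 [b, c] (\<kappa> (b, c, x) p) (left_coord (a, x, d, e) t)))
      (coend C (thd_of_3 C P b c \<otimes> snd_of_4 C (left_comp C P) a d e))
      (coend_desc (\<lambda>x (p, t). plug C e x 1 [b, c] (\<kappa> (b, c, x) p) (right_coord (a, x, d, e) t)))
      (coend C (thd_of_3 C P b c \<otimes> snd_of_4 C (right_comp C P) a d e))
      (coend_map C (thd_of_3 C P b c \<otimes> snd_of_4 C (right_comp C P) a d e)
        (\<lambda>x (p, t). (p, associator (a, x, d, e) t)))"
    by (rule coend_map_preserves[OF coend_nf_thd_snd[OF L obj] coend_nf_thd_snd[OF R obj]])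
      (use obj in \<open>auto simp: associator_coord\<close>)
  show "preserves
      (coend_desc (\<lambda>x (p, t). plug C e x 1 [b, c] (\<kappa> (b, c, x) p) (right_coord (a, x, d, e) t)))
      (coend C (thd_of_3 C P b c \<otimes> snd_of_4 C (right_comp C P) a d e))
      (coend_desc (\<lambda>z (t, p). plug C e z 1 [b, c, d] (left_coord (b, c, d, z) t) (\<kappa> (a, z, e) p)))
      (coend C (fth_of_4 C (left_comp C P) b c d \<otimes> snd_of_3 C P a e))
      (fubini_left (coend_class C (fth_of_4 C (left_comp C P) b c d \<otimes> snd_of_3 C P a e))
        (\<lambda>z. left_comp_class C P (b, c, d, z)))"
  proof (rule fubini_left_preserves[OF coend_nf_thd_snd[OF R obj] coend_nf_fth_snd[OF L obj],
        where G = "\<lambda>x. thd_of_3 C P x d \<otimes> snd_of_3 C P a e" and nfG = "\<lambda>x. right_nf (a, x, d, e)"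
          and TG = "\<lambda>x. homs C e [a, x, d]" and K = "\<lambda>x u l. plug C e x 1 [b, c] (\<kappa> (b, c, x) u) l"])
    fix x y u t v w
    assume "x \<in> Obj C" "y \<in> Obj C"
      and "(u, t) \<in> Ob (thd_of_3 C P b c \<otimes> snd_of_4 C (right_comp C P) a d e) (x, x)"
      and "(v, w) \<in> Ob (thd_of_3 C P x d \<otimes> snd_of_3 C P a e) (y, y)"
    then have *: "x \<in> Obj C" "y \<in> Obj C" "u \<in> Ob P (b, c, x)" "v \<in> Ob P (x, d, y)" "w \<in> Ob P (a, y, e)"
      by auto
    obtain u1 u2 where "\<kappa> (b, c, x) u = [u1, u2]" "u1 \<in> Hom C x b" "u2 \<in> Hom C x c"
      by (rule rep[of b c x u]) (use obj * in auto)
    moreover obtain v1 v2 where "\<kappa> (x, d, y) v = [v1, v2]" "v1 \<in> Hom C y x" "v2 \<in> Hom C y d"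
      by (rule rep[of x d y v]) (use obj * in auto)
    moreover obtain w1 w2 where "\<kappa> (a, y, e) w = [w1, w2]" "w1 \<in> Hom C e a" "w2 \<in> Hom C e y"
      by (rule rep[of a y e w]) (use obj * in auto)
    \<comment> \<open>Up to bracketing both sides are [w1, u1 v1 w2, u2 v1 w2, v2 w2].\<close>
    ultimately show "(left_comp_class C P (b, c, d, y) x (u, v), w) \<in>
          Ob (fth_of_4 C (left_comp C P) b c d \<otimes> snd_of_3 C P a e) (y, y) \<and>
        (\<lambda>(t, p). plug C e y 1 [b, c, d] (left_coord (b, c, d, y) t) (\<kappa> (a, y, e) p))
          (left_comp_class C P (b, c, d, y) x (u, v), w) =
        plug C e x 1 [b, c] (\<kappa> (b, c, x) u) (right_nf (a, x, d, e) y (v, w))"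
      using obj * by (simp add: left_class right_nf_apply plug_def cat_rules)
  qed (use obj in \<open>auto simp: comp_Ob_simps coend_nf_right\<close>)
  show "preserves
      (coend_desc (\<lambda>z (t, p). plug C e z 1 [b, c, d] (left_coord (b, c, d, z) t) (\<kappa> (a, z, e) p)))
      (coend C (fth_of_4 C (left_comp C P) b c d \<otimes> snd_of_3 C P a e))
      (coend_desc (\<lambda>z (t, p). plug C e z 1 [b, c, d] (right_coord (b, c, d, z) t) (\<kappa> (a, z, e) p)))
      (coend C (fth_of_4 C (right_comp C P) b c d \<otimes> snd_of_3 C P a e))
      (coend_map C (fth_of_4 C (right_comp C P) b c d \<otimes> snd_of_3 C P a e)
        (\<lambda>z (t, p). (associator (b, c, d, z) t, p)))"
    by (rule coend_map_preserves[OF coend_nf_fth_snd[OF L obj] coend_nf_fth_snd[OF R obj]])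
      (use obj in \<open>auto simp: associator_coord\<close>)
qed

text \<open>The end coordinates are those of \<open>pentagon_three_preserves\<close>, so the two
  paths can be compared by \<open>preserves_unique\<close>.\<close>

lemma pentagon_two_preserves:
  assumes obj: "a \<in> Obj C" "b \<in> Obj C" "c \<in> Obj C" "d \<in> Obj C" "e \<in> Obj C"
  shows "preserves
    (coend_desc (\<lambda>y (t, p). plug C e y 0 [a, b, c] (left_coord (a, b, c, y) t) (\<kappa> (y, d, e) p)))
    (pentagon_source C P a b c d e)
    (coend_desc (\<lambda>z (t, p). plug C e z 1 [b, c, d] (right_coord (b, c, d, z) t) (\<kappa> (a, z, e) p)))
    (coend C (fth_of_4 C (right_comp C P) b c d \<otimes> snd_of_3 C P a e))
    (pentagon_two C P associator a b c d e)"
  unfolding pentagon_two_def pentagon_source_def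
proof (intro preserves_comp)
  note L = triple_rep_left and R = triple_rep_right
  show "preserves
      (coend_desc (\<lambda>y (t, p). plug C e y 0 [a, b, c] (left_coord (a, b, c, y) t) (\<kappa> (y, d, e) p)))
      (coend C (fth_of_4 C (left_comp C P) a b c \<otimes> fst_of_3 C P d e))
      (coend_desc (\<lambda>x (p, t). plug C e x 0 [a, b] (\<kappa> (a, b, x) p) (left_coord (x, c, d, e) t)))
      (coend C (thd_of_3 C P a b \<otimes> fst_of_4 C (left_comp C P) c d e))
      (fubini_right (coend_class C (thd_of_3 C P a b \<otimes> fst_of_4 C (left_comp C P) c d e))
        (\<lambda>x. left_comp_class C P (x, c, d, e)))"
  proof (rule fubini_right_preserves[OF coend_nf_fth_fst[OF L obj] coend_nf_thd_fst[OF L obj],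
        where G = "\<lambda>y. thd_of_3 C P a b \<otimes> fst_of_3 C P c y" and nfG = "\<lambda>y. left_nf (a, b, c, y)"
          and TG = "\<lambda>y. homs C y [a, b, c]" and K = "\<lambda>y w l. plug C e y 0 [a, b, c] l (\<kappa> (y, d, e) w)"])
    fix x y t w u v
    assume "x \<in> Obj C" "y \<in> Obj C"
      and "(t, w) \<in> Ob (fth_of_4 C (left_comp C P) a b c \<otimes> fst_of_3 C P d e) (y, y)"
      and "(u, v) \<in> Ob (thd_of_3 C P a b \<otimes> fst_of_3 C P c y) (x, x)"
    then have *: "x \<in> Obj C" "y \<in> Obj C" "w \<in> Ob P (y, d, e)" "u \<in> Ob P (a, b, x)" "v \<in> Ob P (x, c, y)"
      by auto
    obtain u1 u2 where "\<kappa> (a, b, x) u = [u1, u2]" "u1 \<in> Hom C x a" "u2 \<in> Hom C x b"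
      by (rule rep[of a b x u]) (use obj * in auto)
    moreover obtain v1 v2 where "\<kappa> (x, c, y) v = [v1, v2]" "v1 \<in> Hom C y x" "v2 \<in> Hom C y c"
      by (rule rep[of x c y v]) (use obj * in auto)
    moreover obtain w1 w2 where "\<kappa> (y, d, e) w = [w1, w2]" "w1 \<in> Hom C e y" "w2 \<in> Hom C e d"
      by (rule rep[of y d e w]) (use obj * in auto)
    \<comment> \<open>Up to bracketing both sides are [u1 v1 w1, u2 v1 w1, v2 w1, w2].\<close>
    ultimately show "(u, left_comp_class C P (x, c, d, e) y (v, w)) \<in>
          Ob (thd_of_3 C P a b \<otimes> fst_of_4 C (left_comp C P) c d e) (x, x) \<and>
        (\<lambda>(p, t). plug C e x 0 [a, b] (\<kappa> (a, b, x) p) (left_coord (x, c, d, e) t))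
          (u, left_comp_class C P (x, c, d, e) y (v, w)) =
        plug C e y 0 [a, b, c] (left_nf (a, b, c, y) x (u, v)) (\<kappa> (y, d, e) w)"
      using obj * by (simp add: left_class left_nf_apply plug_def cat_rules)
  qed (use obj in \<open>auto simp: comp_Ob_simps coend_nf_left\<close>)
  show "preserves
      (coend_desc (\<lambda>x (p, t). plug C e x 0 [a, b] (\<kappa> (a, b, x) p) (left_coord (x, c, d, e) t)))
      (coend C (thd_of_3 C P a b \<otimes> fst_of_4 C (left_comp C P) c d e))
      (coend_desc (\<lambda>x (p, t). plug C e x 0 [a, b] (\<kappa> (a, b, x) p) (right_coord (x, c, d, e) t)))
      (coend C (thd_of_3 C P a b \<otimes> fst_of_4 C (right_comp C P) c d e))
      (coend_map C (thd_of_3 C P a b \<otimes> fst_of_4 C (right_comp C P) c d e)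
        (\<lambda>x (p, t). (p, associator (x, c, d, e) t)))"
    by (rule coend_map_preserves[OF coend_nf_thd_fst[OF L obj] coend_nf_thd_fst[OF R obj]])
      (use obj in \<open>auto simp: associator_coord\<close>)
  show "preserves
      (coend_desc (\<lambda>x (p, t). plug C e x 0 [a, b] (\<kappa> (a, b, x) p) (right_coord (x, c, d, e) t)))
      (coend C (thd_of_3 C P a b \<otimes> fst_of_4 C (right_comp C P) c d e))
      (coend_desc (\<lambda>w (p, t). plug C e w 2 [c, d] (\<kappa> (c, d, w) p) (left_coord (a, b, w, e) t)))
      (coend C (thd_of_3 C P c d \<otimes> thd_of_4 C (left_comp C P) a b e))
      (fubini_swap (coend_class C (thd_of_3 C P c d \<otimes> thd_of_4 C (left_comp C P) a b e))
        (\<lambda>w. left_comp_class C P (a, b, w, e)))"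
  proof (rule fubini_swap_preserves[OF coend_nf_thd_fst[OF R obj] coend_nf_thd_thd[OF L obj],
        where G = "\<lambda>x. thd_of_3 C P c d \<otimes> snd_of_3 C P x e" and nfG = "\<lambda>x. right_nf (x, c, d, e)"
          and TG = "\<lambda>x. homs C e [x, c, d]" and K = "\<lambda>x u l. plug C e x 0 [a, b] (\<kappa> (a, b, x) u) l"])
    fix x y u t v w
    assume "x \<in> Obj C" "y \<in> Obj C"
      and "(u, t) \<in> Ob (thd_of_3 C P a b \<otimes> fst_of_4 C (right_comp C P) c d e) (x, x)"
      and "(v, w) \<in> Ob (thd_of_3 C P c d \<otimes> snd_of_3 C P x e) (y, y)"
    then have *: "x \<in> Obj C" "y \<in> Obj C" "u \<in> Ob P (a, b, x)" "v \<in> Ob P (c, d, y)" "w \<in> Ob P (x, y, e)"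
      by auto
    obtain u1 u2 where "\<kappa> (a, b, x) u = [u1, u2]" "u1 \<in> Hom C x a" "u2 \<in> Hom C x b"
      by (rule rep[of a b x u]) (use obj * in auto)
    moreover obtain v1 v2 where "\<kappa> (c, d, y) v = [v1, v2]" "v1 \<in> Hom C y c" "v2 \<in> Hom C y d"
      by (rule rep[of c d y v]) (use obj * in auto)
    moreover obtain w1 w2 where "\<kappa> (x, y, e) w = [w1, w2]" "w1 \<in> Hom C e x" "w2 \<in> Hom C e y"
      by (rule rep[of x y e w]) (use obj * in auto)
    \<comment> \<open>Here u and v are substituted into different entries of w, and such
      substitutions commute: both sides are [u1 w1, u2 w1, v1 w2, v2 w2].\<close>
    ultimately show "(v, left_comp_class C P (a, b, y, e) x (u, w)) \<in>
          Ob (thd_of_3 C P c d \<otimes> thd_of_4 C (left_comp C P) a b e) (y, y) \<and>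
        (\<lambda>(p, t). plug C e y 2 [c, d] (\<kappa> (c, d, y) p) (left_coord (a, b, y, e) t))
          (v, left_comp_class C P (a, b, y, e) x (u, w)) =
        plug C e x 0 [a, b] (\<kappa> (a, b, x) u) (right_nf (x, c, d, e) y (v, w))"
      using obj * by (simp add: left_class right_nf_apply plug_def cat_rules)
  qed (use obj in \<open>auto simp: comp_Ob_simps coend_nf_right\<close>)
  show "preserves
      (coend_desc (\<lambda>w (p, t). plug C e w 2 [c, d] (\<kappa> (c, d, w) p) (left_coord (a, b, w, e) t)))
      (coend C (thd_of_3 C P c d \<otimes> thd_of_4 C (left_comp C P) a b e))
      (coend_desc (\<lambda>w (p, t). plug C e w 2 [c, d] (\<kappa> (c, d, w) p) (right_coord (a, b, w, e) t)))
      (coend C (thd_of_3 C P c d \<otimes> thd_of_4 C (right_comp C P) a b e))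
      (coend_map C (thd_of_3 C P c d \<otimes> thd_of_4 C (right_comp C P) a b e)
        (\<lambda>w (p, t). (p, associator (a, b, w, e) t)))"
    by (rule coend_map_preserves[OF coend_nf_thd_thd[OF L obj] coend_nf_thd_thd[OF R obj]])
      (use obj in \<open>auto simp: associator_coord\<close>)
  show "preserves
      (coend_desc (\<lambda>w (p, t). plug C e w 2 [c, d] (\<kappa> (c, d, w) p) (right_coord (a, b, w, e) t)))
      (coend C (thd_of_3 C P c d \<otimes> thd_of_4 C (right_comp C P) a b e))
      (coend_desc (\<lambda>z (t, p). plug C e z 1 [b, c, d] (right_coord (b, c, d, z) t) (\<kappa> (a, z, e) p)))
      (coend C (fth_of_4 C (right_comp C P) b c d \<otimes> snd_of_3 C P a e))
      (fubini_left (coend_class C (fth_of_4 C (right_comp C P) b c d \<otimes> snd_of_3 C P a e))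
        (\<lambda>z. right_comp_class C P (b, c, d, z)))"
  proof (rule fubini_left_preserves[OF coend_nf_thd_thd[OF R obj] coend_nf_fth_snd[OF R obj],
        where G = "\<lambda>x. thd_of_3 C P b x \<otimes> snd_of_3 C P a e" and nfG = "\<lambda>x. right_nf (a, b, x, e)"
          and TG = "\<lambda>x. homs C e [a, b, x]" and K = "\<lambda>x u l. plug C e x 2 [c, d] (\<kappa> (c, d, x) u) l"])
    fix x y u t v w
    assume "x \<in> Obj C" "y \<in> Obj C"
      and "(u, t) \<in> Ob (thd_of_3 C P c d \<otimes> thd_of_4 C (right_comp C P) a b e) (x, x)"
      and "(v, w) \<in> Ob (thd_of_3 C P b x \<otimes> snd_of_3 C P a e) (y, y)"
    then have *: "x \<in> Obj C" "y \<in> Obj C" "u \<in> Ob P (c, d, x)" "v \<in> Ob P (b, x, y)" "w \<in> Ob P (a, y, e)"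
      by auto
    obtain u1 u2 where "\<kappa> (c, d, x) u = [u1, u2]" "u1 \<in> Hom C x c" "u2 \<in> Hom C x d"
      by (rule rep[of c d x u]) (use obj * in auto)
    moreover obtain v1 v2 where "\<kappa> (b, x, y) v = [v1, v2]" "v1 \<in> Hom C y b" "v2 \<in> Hom C y x"
      by (rule rep[of b x y v]) (use obj * in auto)
    moreover obtain w1 w2 where "\<kappa> (a, y, e) w = [w1, w2]" "w1 \<in> Hom C e a" "w2 \<in> Hom C e y"
      by (rule rep[of a y e w]) (use obj * in auto)
    \<comment> \<open>Up to bracketing both sides are [w1, v1 w2, u1 v2 w2, u2 v2 w2].\<close>
    ultimately show "(right_comp_class C P (b, c, d, y) x (u, v), w) \<in>
          Ob (fth_of_4 C (right_comp C P) b c d \<otimes> snd_of_3 C P a e) (y, y) \<and>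
        (\<lambda>(t, p). plug C e y 1 [b, c, d] (right_coord (b, c, d, y) t) (\<kappa> (a, y, e) p))
          (right_comp_class C P (b, c, d, y) x (u, v), w) =
        plug C e x 2 [c, d] (\<kappa> (c, d, x) u) (right_nf (a, b, x, e) y (v, w))"
      using obj * by (simp add: right_class right_nf_apply plug_def cat_rules)
  qed (use obj in \<open>auto simp: comp_Ob_simps coend_nf_right\<close>)
qed

lemma pentagon:
  assumes obj: "a \<in> Obj C" "b \<in> Obj C" "c \<in> Obj C" "d \<in> Obj C" "e \<in> Obj C"
    and X: "X \<in> pentagon_source C P a b c d e"
  shows "pentagon_three C P associator a b c d e X = pentagon_two C P associator a b c d e X"
  using preserves_unique[OF pentagon_three_preserves[OF obj] pentagon_two_preserves[OF obj] _ X]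
    bij_betw_imp_inj_on[OF bij_betw_coend_desc_nf[OF coend_nf_fth_snd[OF triple_rep_right obj]]]
  by blast

lemma triangle_right_preserves:
  assumes obj: "a \<in> Obj C" "b \<in> Obj C" "d \<in> Obj C"
  shows "preserves (coend_desc (\<lambda>x (j, t). plug C d x 1 [] [] (left_coord (a, x, b, d) t)))
    (triangle_source C P J a b d) (\<kappa> (a, b, d)) (Ob P (a, b, d))
    (triangle_right C P J right_unitor a b d)"
  unfolding triangle_right_def triangle_source_def
proof (intro preserves_comp)
  note L = triple_rep_left and U = single_rep_right_unit and H = single_rep_hom_profunctor
  show "preserves (coend_desc (\<lambda>x (j, t). plug C d x 1 [] [] (left_coord (a, x, b, d) t)))
      (coend C (J \<otimes> snd_of_4 C (left_comp C P) a b d))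
      (coend_desc (\<lambda>x (u, p). plug C d x 0 [a] (right_unit_coord (a, x) u) (\<kappa> (x, b, d) p)))
      (coend C (snd_of_2 C (right_unit C P J) a \<otimes> fst_of_3 C P b d))
      (fubini_left (coend_class C (snd_of_2 C (right_unit C P J) a \<otimes> fst_of_3 C P b d))
        (\<lambda>x. right_unit_class C P J (a, x)))"
  proof (rule fubini_left_preserves[OF coend_nf_unit_snd[OF L obj] coend_nf_single_fst[OF U obj],
        where G = "\<lambda>x. thd_of_3 C P a x \<otimes> fst_of_3 C P b d" and nfG = "\<lambda>x. left_nf (a, x, b, d)"
          and TG = "\<lambda>x. homs C d [a, x, b]" and K = "\<lambda>x u l. plug C d x 1 [] [] l"])
    fix x y u t v w
    assume "x \<in> Obj C" "y \<in> Obj C"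
      and "(u, t) \<in> Ob (J \<otimes> snd_of_4 C (left_comp C P) a b d) (x, x)"
      and "(v, w) \<in> Ob (thd_of_3 C P a x \<otimes> fst_of_3 C P b d) (y, y)"
    then have *: "x \<in> Obj C" "y \<in> Obj C" "u \<in> Ob J x" "v \<in> Ob P (a, x, y)" "w \<in> Ob P (y, b, d)"
      by auto
    obtain v1 v2 where "\<kappa> (a, x, y) v = [v1, v2]" "v1 \<in> Hom C y a" "v2 \<in> Hom C y x"
      by (rule rep[of a x y v]) (use obj * in auto)
    moreover obtain w1 w2 where "\<kappa> (y, b, d) w = [w1, w2]" "w1 \<in> Hom C d y" "w2 \<in> Hom C d b"
      by (rule rep[of y b d w]) (use obj * in auto)
    \<comment> \<open>Both sides are [v1 w1, w2]: the entry built from v2, which lands in the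
      variable shared with J, is deleted before or after composing with w.\<close>
    ultimately show "(right_unit_class C P J (a, y) x (u, v), w) \<in>
          Ob (snd_of_2 C (right_unit C P J) a \<otimes> fst_of_3 C P b d) (y, y) \<and>
        (\<lambda>(u, p). plug C d y 0 [a] (right_unit_coord (a, y) u) (\<kappa> (y, b, d) p))
          (right_unit_class C P J (a, y) x (u, v), w) =
        plug C d x 1 [] [] (left_nf (a, x, b, d) y (v, w))"
      using obj * by (simp add: right_unit_class left_nf_apply plug_def cat_rules)
  qed (use obj in \<open>auto simp: comp_Ob_simps coend_nf_left\<close>)
  show "preserves
      (coend_desc (\<lambda>x (u, p). plug C d x 0 [a] (right_unit_coord (a, x) u) (\<kappa> (x, b, d) p)))
      (coend C (snd_of_2 C (right_unit C P J) a \<otimes> fst_of_3 C P b d))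
      (coend_desc (\<lambda>x (f, p). plug C d x 0 [a] [f] (\<kappa> (x, b, d) p)))
      (coend C (snd_of_2 C (hom_profunctor C) a \<otimes> fst_of_3 C P b d))
      (coend_map C (snd_of_2 C (hom_profunctor C) a \<otimes> fst_of_3 C P b d)
        (\<lambda>x (t, p). (right_unitor (a, x) t, p)))"
    by (rule coend_map_preserves[OF coend_nf_single_fst[OF U obj] coend_nf_single_fst[OF H obj]])
      (use obj in \<open>auto simp: right_unitor_coord\<close>)
  show "preserves (coend_desc (\<lambda>x (f, p). plug C d x 0 [a] [f] (\<kappa> (x, b, d) p)))
      (coend C (snd_of_2 C (hom_profunctor C) a \<otimes> fst_of_3 C P b d))
      (\<kappa> (a, b, d)) (Ob P (a, b, d))
      (coend_desc (\<lambda>x (f, p). Ar P (x, b, d) (a, b, d) (f, Ident C b, Ident C d) p))"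
  \<comment> \<open>The Yoneda map ends in a value of P itself, so the target coordinate is
    \<kappa>; the action of f composes it onto the first entry, just as \<open>plug\<close>
    does.\<close>
  proof (rule coend_desc_preserves[OF coend_nf_single_fst[OF H obj]
        bij_betw_imp_inj_on[OF rep_bij[OF obj]]])
    fix x e assume x: "x \<in> Obj C" and "e \<in> Ob (snd_of_2 C (hom_profunctor C) a \<otimes> fst_of_3 C P b d) (x, x)"
    then obtain f p where e: "e = (f, p)" "f \<in> Hom C x a" "p \<in> Ob P (x, b, d)"
      by (auto simp: hom_profunctor_def hom_functor_def precomp_def)
    obtain p1 p2 where "\<kappa> (x, b, d) p = [p1, p2]" "p1 \<in> Hom C d x" "p2 \<in> Hom C d b"
      by (rule rep[of x b d p]) (use obj x e in auto)
    then show "(case e of (f, p) \<Rightarrow> Ar P (x, b, d) (a, b, d) (f, Ident C b, Ident C d) p) \<in> Ob P (a, b, d) \<and>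
        \<kappa> (a, b, d) (case e of (f, p) \<Rightarrow> Ar P (x, b, d) (a, b, d) (f, Ident C b, Ident C d) p) =
        (case e of (f, p) \<Rightarrow> plug C d x 0 [a] [f] (\<kappa> (x, b, d) p))"
      using obj x e by (simp add: rep_natural Ar_P_in act_def plug_def cat_rules)
  qed
qed

lemma triangle_left_preserves:
  assumes obj: "a \<in> Obj C" "b \<in> Obj C" "d \<in> Obj C"
  shows "preserves (coend_desc (\<lambda>x (j, t). plug C d x 1 [] [] (left_coord (a, x, b, d) t)))
    (triangle_source C P J a b d) (\<kappa> (a, b, d)) (Ob P (a, b, d))
    (triangle_left C P J associator left_unitor a b d)"
  unfolding triangle_left_def triangle_source_def
proof (intro preserves_comp)
  note L = triple_rep_left and R = triple_rep_right and U = single_rep_left_unit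
    and H = single_rep_hom_profunctor
  show "preserves (coend_desc (\<lambda>x (j, t). plug C d x 1 [] [] (left_coord (a, x, b, d) t)))
      (coend C (J \<otimes> snd_of_4 C (left_comp C P) a b d))
      (coend_desc (\<lambda>x (j, t). plug C d x 1 [] [] (right_coord (a, x, b, d) t)))
      (coend C (J \<otimes> snd_of_4 C (right_comp C P) a b d))
      (coend_map C (J \<otimes> snd_of_4 C (right_comp C P) a b d)
        (\<lambda>y (j, t). (j, associator (a, y, b, d) t)))"
    by (rule coend_map_preserves[OF coend_nf_unit_snd[OF L obj] coend_nf_unit_snd[OF R obj]])
      (use obj in \<open>auto simp: associator_coord\<close>)
  show "preserves (coend_desc (\<lambda>x (j, t). plug C d x 1 [] [] (right_coord (a, x, b, d) t)))
      (coend C (J \<otimes> snd_of_4 C (right_comp C P) a b d))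
      (coend_desc (\<lambda>x (u, p). plug C d x 1 [b] (left_unit_coord (b, x) u) (\<kappa> (a, x, d) p)))
      (coend C (snd_of_2 C (left_unit C P J) b \<otimes> snd_of_3 C P a d))
      (fubini_left (coend_class C (snd_of_2 C (left_unit C P J) b \<otimes> snd_of_3 C P a d))
        (\<lambda>x. left_unit_class C P J (b, x)))"
  proof (rule fubini_left_preserves[OF coend_nf_unit_snd[OF R obj] coend_nf_single_snd[OF U obj],
        where G = "\<lambda>x. thd_of_3 C P x b \<otimes> snd_of_3 C P a d" and nfG = "\<lambda>x. right_nf (a, x, b, d)"
          and TG = "\<lambda>x. homs C d [a, x, b]" and K = "\<lambda>x u l. plug C d x 1 [] [] l"])
    fix x y u t v w
    assume "x \<in> Obj C" "y \<in> Obj C"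
      and "(u, t) \<in> Ob (J \<otimes> snd_of_4 C (right_comp C P) a b d) (x, x)"
      and "(v, w) \<in> Ob (thd_of_3 C P x b \<otimes> snd_of_3 C P a d) (y, y)"
    then have *: "x \<in> Obj C" "y \<in> Obj C" "u \<in> Ob J x" "v \<in> Ob P (x, b, y)" "w \<in> Ob P (a, y, d)"
      by auto
    obtain v1 v2 where "\<kappa> (x, b, y) v = [v1, v2]" "v1 \<in> Hom C y x" "v2 \<in> Hom C y b"
      by (rule rep[of x b y v]) (use obj * in auto)
    moreover obtain w1 w2 where "\<kappa> (a, y, d) w = [w1, w2]" "w1 \<in> Hom C d a" "w2 \<in> Hom C d y"
      by (rule rep[of a y d w]) (use obj * in auto)
    \<comment> \<open>Both sides are [w1, v2 w2], the entry built from v1 being deleted.\<close>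
    ultimately show "(left_unit_class C P J (b, y) x (u, v), w) \<in>
          Ob (snd_of_2 C (left_unit C P J) b \<otimes> snd_of_3 C P a d) (y, y) \<and>
        (\<lambda>(u, p). plug C d y 1 [b] (left_unit_coord (b, y) u) (\<kappa> (a, y, d) p))
          (left_unit_class C P J (b, y) x (u, v), w) =
        plug C d x 1 [] [] (right_nf (a, x, b, d) y (v, w))"
      using obj * by (simp add: left_unit_class right_nf_apply plug_def cat_rules)
  qed (use obj in \<open>auto simp: comp_Ob_simps coend_nf_right\<close>)
  show "preserves
      (coend_desc (\<lambda>x (u, p). plug C d x 1 [b] (left_unit_coord (b, x) u) (\<kappa> (a, x, d) p)))
      (coend C (snd_of_2 C (left_unit C P J) b \<otimes> snd_of_3 C P a d))
      (coend_desc (\<lambda>x (f, p). plug C d x 1 [b] [f] (\<kappa> (a, x, d) p)))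
      (coend C (snd_of_2 C (hom_profunctor C) b \<otimes> snd_of_3 C P a d))
      (coend_map C (snd_of_2 C (hom_profunctor C) b \<otimes> snd_of_3 C P a d)
        (\<lambda>x (t, p). (left_unitor (b, x) t, p)))"
    by (rule coend_map_preserves[OF coend_nf_single_snd[OF U obj] coend_nf_single_snd[OF H obj]])
      (use obj in \<open>auto simp: left_unitor_coord\<close>)
  show "preserves (coend_desc (\<lambda>x (f, p). plug C d x 1 [b] [f] (\<kappa> (a, x, d) p)))
      (coend C (snd_of_2 C (hom_profunctor C) b \<otimes> snd_of_3 C P a d))
      (\<kappa> (a, b, d)) (Ob P (a, b, d))
      (coend_desc (\<lambda>x (f, p). Ar P (a, x, d) (a, b, d) (Ident C a, f, Ident C d) p))"
  proof (rule coend_desc_preserves[OF coend_nf_single_snd[OF H obj]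
        bij_betw_imp_inj_on[OF rep_bij[OF obj]]])
    fix x e assume x: "x \<in> Obj C" and "e \<in> Ob (snd_of_2 C (hom_profunctor C) b \<otimes> snd_of_3 C P a d) (x, x)"
    then obtain f p where e: "e = (f, p)" "f \<in> Hom C x b" "p \<in> Ob P (a, x, d)"
      by (auto simp: hom_profunctor_def hom_functor_def precomp_def)
    obtain p1 p2 where "\<kappa> (a, x, d) p = [p1, p2]" "p1 \<in> Hom C d a" "p2 \<in> Hom C d x"
      by (rule rep[of a x d p]) (use obj x e in auto)
    then show "(case e of (f, p) \<Rightarrow> Ar P (a, x, d) (a, b, d) (Ident C a, f, Ident C d) p) \<in> Ob P (a, b, d) \<and>
        \<kappa> (a, b, d) (case e of (f, p) \<Rightarrow> Ar P (a, x, d) (a, b, d) (Ident C a, f, Ident C d) p) =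
        (case e of (f, p) \<Rightarrow> plug C d x 1 [b] [f] (\<kappa> (a, x, d) p))"
      using obj x e by (simp add: rep_natural Ar_P_in act_def plug_def cat_rules)
  qed
qed

lemma triangle:
  assumes obj: "a \<in> Obj C" "b \<in> Obj C" "d \<in> Obj C" and Y: "Y \<in> triangle_source C P J a b d"
  shows "triangle_left C P J associator left_unitor a b d Y = triangle_right C P J right_unitor a b d Y"
  using preserves_unique[OF triangle_left_preserves[OF obj] triangle_right_preserves[OF obj] _ Y]
    bij_betw_imp_inj_on[OF rep_bij[OF obj]]
  by blast

lemma symmetry_involutive:
  assumes "a \<in> Obj C" "b \<in> Obj C" "d \<in> Obj C" "p \<in> Ob P (a, b, d)"
  shows "symmetry (b, a, d) (symmetry (a, b, d) p) = p"
  using symmetry_rep[of a b d p] symmetry_rep[of b a d "symmetry (a, b, d) p"]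
    bij_betw_imp_inj_on[OF rep_bij[of a b d]] assms
  by (auto dest: inj_onD)

text \<open>Associators do not change coordinates, so the hexagon says that the cyclic shift of
  three entries is the exchange of the first two followed by the exchange of the last two. The
  integrands appear in the split form given by \<open>at_param_left\<close> and
  \<open>at_param_right\<close>.\<close>

lemma hexagon:
  assumes obj: "a \<in> Obj C" "b \<in> Obj C" "c \<in> Obj C" "d \<in> Obj C"
    and X: "X \<in> Ob (left_comp C P) (a, b, c, d)"
  shows "associator (b, c, a, d)
      (coend_map C (thd_of_3 C P b c \<otimes> fst_of_3 C P a d) (\<lambda>y (q, p). (q, symmetry (a, y, d) p))
        (associator (a, b, c, d) X)) =
    coend_map C (thd_of_3 C P c a \<otimes> snd_of_3 C P b d) (\<lambda>y (q, p). (symmetry (a, c, y) q, p))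
      (associator (b, a, c, d)
        (coend_map C (thd_of_3 C P b a \<otimes> fst_of_3 C P c d) (\<lambda>x (p, q). (symmetry (a, b, x) p, q)) X))"
proof -
  let ?\<phi> = "coend_map C (thd_of_3 C P b c \<otimes> fst_of_3 C P a d) (\<lambda>y (q, p). (q, symmetry (a, y, d) p))"
  let ?\<psi> = "coend_map C (thd_of_3 C P c a \<otimes> snd_of_3 C P b d) (\<lambda>y (q, p). (symmetry (a, c, y) q, p))"
  let ?\<chi> = "coend_map C (thd_of_3 C P b a \<otimes> fst_of_3 C P c d) (\<lambda>x (p, q). (symmetry (a, b, x) p, q))"
  \<comment> \<open>The symmetry at (a, y, d) moves the entry for a behind the block substituted for
    y: [p1, q1 p2, q2 p2] becomes [q1 p2, q2 p2, p1].\<close>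
  have \<phi>: "?\<phi> Y \<in> Ob (left_comp C P) (b, c, a, d) \<and>
      left_coord (b, c, a, d) (?\<phi> Y) = (\<lambda>l. [l ! 1, l ! 2, l ! 0]) (right_coord (a, b, c, d) Y)"
    if "Y \<in> Ob (right_comp C P) (a, b, c, d)" for Y
    unfolding comp_Ob_simps
  proof (rule coend_map_coordinates[OF coend_nf_right _ coend_nf_left])
    fix y e assume y: "y \<in> Obj C" and "e \<in> Ob (thd_of_3 C P b c \<otimes> snd_of_3 C P a d) (y, y)"
    then obtain q p where e: "e = (q, p)" "q \<in> Ob P (b, c, y)" "p \<in> Ob P (a, y, d)"
      by auto
    obtain q1 q2 where "\<kappa> (b, c, y) q = [q1, q2]"
      by (rule rep[of b c y q]) (use obj y e in auto)
    moreover obtain p1 p2 where "\<kappa> (a, y, d) p = [p1, p2]"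
      by (rule rep[of a y d p]) (use obj y e in auto)
    ultimately show "(case e of (q, p) \<Rightarrow> (q, symmetry (a, y, d) p)) \<in>
          Ob (thd_of_3 C P b c \<otimes> fst_of_3 C P a d) (y, y) \<and>
        left_nf (b, c, a, d) y (case e of (q, p) \<Rightarrow> (q, symmetry (a, y, d) p)) =
        [right_nf (a, b, c, d) y e ! 1, right_nf (a, b, c, d) y e ! 2, right_nf (a, b, c, d) y e ! 0]"
      using obj y e by (simp add: symmetry_rep left_nf_apply right_nf_apply plug_def)
  qed (use obj that in \<open>auto simp: comp_Ob_simps\<close>)
  have \<chi>: "?\<chi> Y \<in> Ob (left_comp C P) (b, a, c, d) \<and>
      left_coord (b, a, c, d) (?\<chi> Y) = (\<lambda>l. [l ! 1, l ! 0, l ! 2]) (left_coord (a, b, c, d) Y)"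
    if "Y \<in> Ob (left_comp C P) (a, b, c, d)" for Y
    unfolding comp_Ob_simps
  proof (rule coend_map_coordinates[OF coend_nf_left _ coend_nf_left])
    fix x e assume x: "x \<in> Obj C" and "e \<in> Ob (thd_of_3 C P a b \<otimes> fst_of_3 C P c d) (x, x)"
    then obtain p q where e: "e = (p, q)" "p \<in> Ob P (a, b, x)" "q \<in> Ob P (x, c, d)"
      by auto
    obtain p1 p2 where "\<kappa> (a, b, x) p = [p1, p2]"
      by (rule rep[of a b x p]) (use obj x e in auto)
    moreover obtain q1 q2 where "\<kappa> (x, c, d) q = [q1, q2]"
      by (rule rep[of x c d q]) (use obj x e in auto)
    ultimately show "(case e of (p, q) \<Rightarrow> (symmetry (a, b, x) p, q)) \<in>
          Ob (thd_of_3 C P b a \<otimes> fst_of_3 C P c d) (x, x) \<and>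
        left_nf (b, a, c, d) x (case e of (p, q) \<Rightarrow> (symmetry (a, b, x) p, q)) =
        [left_nf (a, b, c, d) x e ! 1, left_nf (a, b, c, d) x e ! 0, left_nf (a, b, c, d) x e ! 2]"
      using obj x e by (simp add: symmetry_rep left_nf_apply plug_def)
  qed (use obj that in \<open>auto simp: comp_Ob_simps\<close>)
  have \<psi>: "?\<psi> Y \<in> Ob (right_comp C P) (b, c, a, d) \<and>
      right_coord (b, c, a, d) (?\<psi> Y) = (\<lambda>l. [l ! 0, l ! 2, l ! 1]) (right_coord (b, a, c, d) Y)"
    if "Y \<in> Ob (right_comp C P) (b, a, c, d)" for Y
    unfolding comp_Ob_simps
  proof (rule coend_map_coordinates[OF coend_nf_right _ coend_nf_right])
    fix y e assume y: "y \<in> Obj C" and "e \<in> Ob (thd_of_3 C P a c \<otimes> snd_of_3 C P b d) (y, y)"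
    then obtain q p where e: "e = (q, p)" "q \<in> Ob P (a, c, y)" "p \<in> Ob P (b, y, d)"
      by auto
    obtain q1 q2 where "\<kappa> (a, c, y) q = [q1, q2]"
      by (rule rep[of a c y q]) (use obj y e in auto)
    moreover obtain p1 p2 where "\<kappa> (b, y, d) p = [p1, p2]"
      by (rule rep[of b y d p]) (use obj y e in auto)
    ultimately show "(case e of (q, p) \<Rightarrow> (symmetry (a, c, y) q, p)) \<in>
          Ob (thd_of_3 C P c a \<otimes> snd_of_3 C P b d) (y, y) \<and>
        right_nf (b, c, a, d) y (case e of (q, p) \<Rightarrow> (symmetry (a, c, y) q, p)) =
        [right_nf (b, a, c, d) y e ! 0, right_nf (b, a, c, d) y e ! 2, right_nf (b, a, c, d) y e ! 1]"
      using obj y e by (simp add: symmetry_rep right_nf_apply plug_def)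
  qed (use obj that in \<open>auto simp: comp_Ob_simps\<close>)
  show ?thesis
    by (rule inj_onD[OF bij_betw_imp_inj_on[OF triple_rep.rep_bij[OF triple_rep_right, of b c a d]]])
      (use obj X \<phi> \<chi> \<psi> in \<open>simp_all add: associator_coord\<close>)
qed

lemma symmetric_promonoidal:
  "symmetric_promonoidal_category C P J associator left_unitor right_unitor symmetry"
  by unfold_locales
    (simp_all add: natural_iso_associator natural_iso_left_unitor natural_iso_right_unitor pentagon
      triangle natural_iso_symmetry symmetry_involutive hexagon at_param_left at_param_right)

end

section \<open>The kernel of a category with a terminal object\<close>

text \<open>The integrand of \<open>simplex_kernel\<close> over an arbitrary category, written the
  same way so that the specialisation is mere unfolding.\<close>

definition product_kernel_integrand where
  "product_kernel_integrand C = precomp (hom_functor C \<otimes> hom_functor C \<otimes> hom_functor C)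
     (\<lambda>((p, q, r), (m, m')). ((m, p), (m, q), (r, m')))
     (\<lambda>((p, q, r), (m, m')). ((m, p), (m, q), (r, m')))"

definition representable_kernel where
  "representable_kernel C = coend_functor (kernel_cat C) C (product_kernel_integrand C)"

text \<open>The isomorphism from P (p, q; r) to C(r, p) x C(r, q) on representatives: the morphism w
  : r -> m is absorbed into the other two.\<close>

definition representable_nf where
  "representable_nf C = (\<lambda>(p, q, r) m (u, v, w). [Comp C r m p u w, Comp C r m q v w])"

context small_category
begin

lemma at_param_kernel:
  "Ob (at_param (kernel_cat C) (product_kernel_integrand C) (p, q, r)) (m, m') =
    Hom C m p \<times> Hom C m q \<times> Hom C r m'"
  "Ar (at_param (kernel_cat C) (product_kernel_integrand C) (p, q, r)) (m, m') (n, n') (f, g) (u, v, w) =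
    (Comp C n m p (Comp C m p p (Ident C p) u) f, Comp C n m q (Comp C m q q (Ident C q) v) f,
     Comp C r r n' (Comp C r m' n' g w) (Ident C r))"
  by (simp_all add: at_param_def product_kernel_integrand_def precomp_def ext_prod_def hom_functor_def
      prod_op_simps)

text \<open>The triple nests as u, (v, w), so the integrand is not literally an external product of
  a contravariant and a covariant factor; the co-Yoneda argument is carried out directly.\<close>

lemma coend_nf_kernel:
  assumes obj: "p \<in> Obj C" "q \<in> Obj C" "r \<in> Obj C"
  shows "coend_nf C (at_param (kernel_cat C) (product_kernel_integrand C) (p, q, r))
    (representable_nf C (p, q, r)) (homs C r [p, q])" (is "coend_nf C ?F _ _")
proof (rule coend_nfI)
  fix x y f z assume "x \<in> Obj C" "y \<in> Obj C" "f \<in> Hom C x y" "z \<in> Ob ?F (y, x)"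
  then show "representable_nf C (p, q, r) x (Ar ?F (y, x) (x, x) (f, Ident C x) z) =
      representable_nf C (p, q, r) y (Ar ?F (y, x) (y, y) (Ident C y, f) z)"
    using obj by (auto simp: at_param_kernel representable_nf_def cat_rules)
next
  \<comment> \<open>One generating step along w, taken at the mixed element (u, v,
    \<open>Ident C r\<close>), leaves the identity as third component.\<close>
  have canonical: "((r, (Comp C r x p u w, Comp C r x q v w, Ident C r)), (x, (u, v, w))) \<in> coend_rel C ?F"
    if "x \<in> Obj C" "u \<in> Hom C x p" "v \<in> Hom C x q" "w \<in> Hom C r x" for x u v w
  proof -
    have "((r, (Comp C r x p u w, Comp C r x q v w, Ident C r)), (x, (u, v, w))) \<in> coend_step C ?F"
      unfolding coend_step_def mem_Collect_eq
      by (rule exI[of _ r], rule exI[of _ x], rule exI[of _ w], rule exI[of _ "(u, v, Ident C r)"])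
        (use that obj in \<open>simp add: at_param_kernel cat_rules\<close>)
    then show ?thesis
      using that obj by (auto simp: coend_rel_def coend_carrier_def at_param_kernel cat_rules)
  qed
  fix x y e e'
  assume "x \<in> Obj C" "y \<in> Obj C" "e \<in> Ob ?F (x, x)" "e' \<in> Ob ?F (y, y)"
    and eq: "representable_nf C (p, q, r) x e = representable_nf C (p, q, r) y e'"
  then obtain u v w u' v' w' where e: "e = (u, v, w)" "e' = (u', v', w')"
    "((r, (Comp C r x p u w, Comp C r x q v w, Ident C r)), (x, e)) \<in> coend_rel C ?F"
    "((r, (Comp C r y p u' w', Comp C r y q v' w', Ident C r)), (y, e')) \<in> coend_rel C ?F"
    using canonical by (auto simp: at_param_kernel)
  then have "((r, (Comp C r x p u w, Comp C r x q v w, Ident C r)), (y, e')) \<in> coend_rel C ?F"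
    using eq by (simp add: representable_nf_def)
  then show "((x, e), (y, e')) \<in> coend_rel C ?F"
    using e(3) equiv_coend_rel[of C ?F] by (auto simp: equiv_def dest: symD transD)
next
  fix x e assume "x \<in> Obj C" "e \<in> Ob ?F (x, x)"
  then show "representable_nf C (p, q, r) x e \<in> homs C r [p, q]"
    using obj by (auto simp: at_param_kernel representable_nf_def Comp_in)
next
  fix t assume "t \<in> homs C r [p, q]"
  then obtain f g where "t = [f, g]" "f \<in> Hom C r p" "g \<in> Hom C r q"
    by (auto simp: in_homs_Cons)
  then show "\<exists>x\<in>Obj C. \<exists>e\<in>Ob ?F (x, x). representable_nf C (p, q, r) x e = t"
    using obj by (intro bexI[of _ r] bexI[of _ "(f, g, Ident C r)"])
      (auto simp: at_param_kernel representable_nf_def cat_rules)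
qed

abbreviation "kernel_coord pqr \<equiv> coend_desc (representable_nf C pqr)"

lemma kernel_Ar:
  assumes "a \<in> Obj C" "b \<in> Obj C" "d \<in> Obj C" "a' \<in> Obj C" "b' \<in> Obj C" "d' \<in> Obj C"
    "f \<in> Hom C a a'" "g \<in> Hom C b b'" "h \<in> Hom C d' d" "X \<in> Ob (representable_kernel C) (a, b, d)"
  shows "Ar (representable_kernel C) (a, b, d) (a', b', d') (f, g, h) X
      \<in> Ob (representable_kernel C) (a', b', d') \<and>
    kernel_coord (a', b', d') (Ar (representable_kernel C) (a, b, d) (a', b', d') (f, g, h) X) =
    Ar (hom_pairs C) (a, b, d) (a', b', d') (f, g, h) (kernel_coord (a, b, d) X)"
  unfolding representable_kernel_def coend_functor_def setfun.simps
proof (rule coend_map_coordinates[OF coend_nf_kernel _ coend_nf_kernel])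
  show "X \<in> coend C (at_param (kernel_cat C) (product_kernel_integrand C) (a, b, d))"
    using assms by (simp add: representable_kernel_def coend_functor_def)
  fix x e assume x: "x \<in> Obj C"
    and "e \<in> Ob (at_param (kernel_cat C) (product_kernel_integrand C) (a, b, d)) (x, x)"
  then obtain u v w where e: "e = (u, v, w)" "u \<in> Hom C x a" "v \<in> Hom C x b" "w \<in> Hom C d x"
    by (auto simp: at_param_kernel)
  let ?e = "Ar (product_kernel_integrand C) ((a, b, d), x, x) ((a', b', d'), x, x)
    ((f, g, h), Ident C x, Ident C x) e"
  have "?e = (Comp C x a a' f u, Comp C x b b' g v, Comp C d' d x w h)"
    using assms x e
    by (simp add: product_kernel_integrand_def precomp_def ext_prod_def hom_functor_def cat_rules)
  then show "?e \<in> Ob (at_param (kernel_cat C) (product_kernel_integrand C) (a', b', d')) (x, x) \<and>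
    representable_nf C (a', b', d') x ?e =
    Ar (hom_pairs C) (a, b, d) (a', b', d') (f, g, h) (representable_nf C (a, b, d) x e)"
    using assms x e
    by (simp add: at_param_kernel representable_nf_def hom_pairs_def act_def cat_rules)
qed (use assms in simp_all)

lemma natural_iso_kernel:
  "natural_iso (kernel_cat C) (representable_kernel C) (hom_pairs C) kernel_coord"
proof (rule natural_isoI)
  fix x assume "x \<in> Obj (kernel_cat C)"
  then obtain p q r where x: "x = (p, q, r)" "p \<in> Obj C" "q \<in> Obj C" "r \<in> Obj C"
    by (auto simp: prod_op_simps)
  then show "bij_betw (kernel_coord x) (Ob (representable_kernel C) x) (Ob (hom_pairs C) x)"
    using bij_betw_coend_desc_nf[OF coend_nf_kernel[OF x(2-4)]]
    by (simp add: hom_pairs_def representable_kernel_def coend_functor_def)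
qed (auto simp: prod_op_simps kernel_Ar)

lemma pair_rep_kernel: "pair_rep C (representable_kernel C) kernel_coord"
proof -
  have "set_functor (kernel_cat C) (representable_kernel C)"
    by (rule set_functor_transport[OF set_functor_hom_pairs natural_iso_kernel])
      (auto simp: prod_op_simps kernel_Ar)
  then show ?thesis
    by (intro pair_rep.intro pair_rep_axioms.intro small_category_axioms natural_iso_kernel)
qed

lemma symmetric_promonoidal_terminal:
  assumes t: "t \<in> Obj C" and terminal: "\<And>x. x \<in> Obj C \<Longrightarrow> \<exists>j. Hom C x t = {j}"
  shows "\<exists>\<alpha> l \<rho> \<sigma>. symmetric_promonoidal_category C (representable_kernel C)
    (precomp (hom_functor C) (\<lambda>r. (r, t)) (\<lambda>f. (f, Ident C t))) \<alpha> l \<rho> \<sigma>"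
proof -
  let ?J = "precomp (hom_functor C) (\<lambda>r. (r, t)) (\<lambda>f. (f, Ident C t))"
  have "set_functor (op_cat C) ?J"
  proof -
    interpret D: small_category "op_cat C" by (rule small_category_op[OF small_category_axioms])
    show ?thesis
      by unfold_locales (use t in \<open>auto simp: precomp_def hom_functor_def op_cat_def cat_rules\<close>)
  qed
  \<comment> \<open>By terminality each value of J is a singleton, and so is the set of empty
    tuples.\<close>
  moreover have "natural_iso (op_cat C) ?J (precomp_tuples C []) (\<lambda>_ _. [])"
  proof (rule natural_isoI)
    fix x assume "x \<in> Obj (op_cat C)"
    then obtain j where "Hom C x t = {j}"
      using terminal by (auto simp: op_cat_def)
    then show "bij_betw (\<lambda>_. []) (Ob ?J x) (Ob (precomp_tuples C []) x)"
      by (simp add: precomp_def hom_functor_def precomp_tuples_def bij_betw_def)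
  qed (simp add: precomp_tuples_def)
  ultimately have "product_kernel C (representable_kernel C) kernel_coord ?J"
    by (intro product_kernel.intro product_kernel_axioms.intro pair_rep_kernel)
  then show ?thesis
    using product_kernel.symmetric_promonoidal by blast
qed

end

section \<open>The simplex category\<close>

lemma small_category_simplex_cat: "small_category simplex_cat"
proof
  fix w x y z :: nat and f g h
  show "Ident simplex_cat x \<in> Hom simplex_cat x x"
    by (auto simp: simplex_cat_def intro: mono_onI)
  assume f: "f \<in> Hom simplex_cat w x"
  have f': "f \<in> {..w} \<rightarrow>\<^sub>E {..x}" "mono_on {..w} f"
    using f by (auto simp: simplex_cat_def)
  \<comment> \<open>The unit laws hold as equations of total functions because f is already
    undefined outside its domain, where \<open>compose\<close> is made so.\<close>
  show "Comp simplex_cat w x x (Ident simplex_cat x) f = f"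
    "Comp simplex_cat w w x f (Ident simplex_cat w) = f"
    using f' by (auto simp: simplex_cat_def compose_def fun_eq_iff PiE_iff extensional_def)
  assume g: "g \<in> Hom simplex_cat x y"
  then have g': "g \<in> {..x} \<rightarrow>\<^sub>E {..y}" "mono_on {..x} g"
    by (auto simp: simplex_cat_def)
  show "Comp simplex_cat w x y g f \<in> Hom simplex_cat w y"
    using f' g' by (auto simp: simplex_cat_def compose_def PiE_iff mono_on_def)
  show "Comp simplex_cat w y z h (Comp simplex_cat w x y g f) =
      Comp simplex_cat w x z (Comp simplex_cat x y z h g) f"
    using f' by (auto simp: simplex_cat_def compose_def fun_eq_iff PiE_iff)
qed

lemma simplex_cat_terminal: "\<exists>j. Hom simplex_cat x 0 = {j}"
proof
  \<comment> \<open>Values in \<open>{..0}\<close> are 0 on the domain, and extensionality fixes the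
    function elsewhere.\<close>
  show "Hom simplex_cat x 0 = {\<lambda>i\<in>{..x}. 0}"
    by (auto simp: simplex_cat_def PiE_iff extensional_def fun_eq_iff mono_on_def)
qed

theorem theorem1:
  shows "\<exists>\<alpha> l \<rho> \<sigma>.
    symmetric_promonoidal_category simplex_cat simplex_kernel simplex_unit \<alpha> l \<rho> \<sigma>"
  using small_category.symmetric_promonoidal_terminal[OF small_category_simplex_cat, of 0]
    simplex_cat_terminal
  by (simp add: simplex_kernel_def simplex_unit_def representable_kernel_def
      product_kernel_integrand_def simplex_cat_def)

end
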